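(* Let $\tilde u:S\to\mathbb R\times M$ be a finite energy strip as described in the context, let $(0,p_+)$ be its limit as $s\to+\infty$ and let $v$ be its representation, for large $s$, in the coordinates around $(0,p_+)$ described in the context. There exist numbers $\rho,s'>0$ such that for each multi-index $\alpha\in\mathbb N^2$, $|\alpha|\ge0$, there is a constant $c_\alpha>0$ with $$\sup_{t\in[0,1]}|\partial^\alpha v(s,t)|\le c_\alpha e^{-\rho(s-s')}\quad\text{for all } s\ge s'.$$
   Context: Global setting. $(M,\lambda)$ is a three-dimensional contact manifold (the letter $M$ is also used for the matrix function below), $\xi=\ker\lambda$, and $X_\lambda$ is the Reeb vector field ($i_{X_\lambda}d\lambda=0$, $\lambda(X_\lambda)=1$). $J:\xi\to\xi$ is a complex structure such that $d\lambda(\cdot,J\cdot)$ is a bundle metric on $\xi$, and $\tilde J$ is the almost complex structure on $\mathbb R\times M$ with $\tilde J=J$ on $\xi$, $\tilde J(\partial/\partial\tau)=X_\lambda$, $\tilde J X_\lambda=-\partial/\partial\tau$, where $\tau$ is the coordinate on $\mathbb R$. $\mathcal L\subset M$ is a Legendrian knot and $\mathcal D\subset M$ a compact oriented embedded surface with $\partial\mathcal D=\mathcal L$. A point $p\in\mathcal D$ is singular if $T_p\mathcal D=\ker\lambda(p)$; with $\sigma$ a volume form on $\mathcal D$, $j$ the inclusion and $Z$ the vector field with $i_Z\sigma=j^*\lambda$, a singular point is non-degenerate if $Z'(p)$ has no eigenvalue on the imaginary axis. All singular points are non-degenerate. $\mathcal D^{**}$ denotes $\mathcal D$ with some open neighborhood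 of the set of singular points removed. Normalization near $\mathcal L$. There is a neighborhood of $\mathcal L$ with coordinates $(\theta,x,y)\in S^1\times\mathbb R^2$, $S^1=\mathbb R/\mathbb Z$, in which $\lambda=dy+x\,d\theta$, $\mathcal L=S^1\times\{(0,0)\}$, and near $\mathcal L$ the surface $\mathcal D$ is $\{(\theta,a(\theta)r,b(\theta)r): r\ge0\text{ small}\}$ with smooth $1$-periodic $a,b$, $(a,b)\neq(0,0)$ everywhere; the singular points on $\mathcal L$ are the points $(\theta,0,0)$ with $b(\theta)=0$. Near $\mathcal L$, $J(1,0,-x)=(0,-1,0)$, $J(0,1,0)=(1,0,-x)$. Finite energy strips. $S=\mathbb R\times[0,1]$. The map $\tilde u=(a,u):S\to\mathbb R\times M$ satisfies $\partial_s\tilde u+\tilde J(\tilde u)\partial_t\tilde u=0$, $\tilde u(s,0)\in\mathbb R\times\mathcal L$, $\tilde u(s,1)\in\{0\}\times\mathcal D^{**}$, and $E(\tilde u):=\sup_{\phi\in\Sigma}\int_S\tilde u^*d(\phi\lambda)<\infty$, $\Sigma=\{\phi\in C^\infty(\mathbb R,[0,1]):\phi'\ge0\}$; also $u(S)$ lies in a compact subset of $M$. The limit $\lim_{s\to+\infty}\tilde u(s,t)=(0,p_+)$ exists in $C^\infty([0,1])$ with $p_+\in\mathcal L$ not singular. Coordinates at the positive end. Shift $\theta$ so that $p_+$ corresponds to $\theta=0$, put $q(\theta)=a(\theta)/b(\theta)$ for $\theta$ near $0$, and use near $(0,p_+)$ the coordinates obtained from $(\tau,\theta,x,y)$ by $(\tau,\theta,x,y)\mapsto(\tau,\theta,x-q(\theta)y,y)$.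 Then $(0,p_+)$ is $0\in\mathbb R^4$, $\mathbb R\times\mathcal L$ is $L_0=\mathbb R^2\times\{0\}\times\{0\}$, and $\{0\}\times\mathcal D^{**}$ lies in $L_1=\{0\}\times\mathbb R\times\{0\}\times\mathbb R$. $v(s,t)\in\mathbb R^4$ is $\tilde u(s,t)$ in these coordinates; with $M(\cdot)$ the matrix of $\tilde J$ in these coordinates it satisfies $\partial_sv+M(v)\partial_tv=0$, $v(s,0)\in L_0$, $v(s,1)\in L_1$ for all large $s$. *)

theory Defs
  imports "HOL-Analysis.Analysis"
begin

section \<open>Smoothness of maps between Euclidean spaces\<close>

type_synonym R2 = "real \<times> real"
type_synonym R3 = "real \<times> real \<times> real"
type_synonym R4 = "real \<times> real \<times> real \<times> real"

text \<open>
  Derivatives are taken within the set, so that one notion covers open sets as well as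
  strips, half-planes and intervals. It is intended for relatively open subsets of convex
  sets with nonempty interior; on such a set derivatives within it are unique and
  \<open>smooth_on\<close> means smooth up to the boundary.
\<close>

fun Ck_on :: "nat \<Rightarrow> 'a::euclidean_space set \<Rightarrow> ('a \<Rightarrow> 'b::real_normed_vector) \<Rightarrow> bool" where
  "Ck_on 0 S f \<longleftrightarrow> continuous_on S f"
| "Ck_on (Suc k) S f \<longleftrightarrow>
     f differentiable_on S \<and> (\<forall>v. Ck_on k S (\<lambda>x. frechet_derivative f (at x within S) v))"

definition smooth_on :: "'a::euclidean_space set \<Rightarrow> ('a \<Rightarrow> 'b::real_normed_vector) \<Rightarrow> bool" where
  "smooth_on S f \<longleftrightarrow> (\<forall>k. Ck_on k S f)"

section \<open>Smooth 3-manifolds\<close>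

text \<open>
  The manifold is a whole Hausdorff, second countable type. A chart is a pair of its domain
  and its coordinate map; the values of the coordinate map off the domain are irrelevant.
\<close>

type_synonym 'm chart = "'m set \<times> ('m \<Rightarrow> R3)"

abbreviation dom_of :: "'m chart \<Rightarrow> 'm set" where "dom_of c \<equiv> fst c"
abbreviation coord :: "'m chart \<Rightarrow> 'm \<Rightarrow> R3" where "coord c \<equiv> snd c"

definition img_of :: "'m chart \<Rightarrow> R3 set" where
  "img_of c = coord c ` dom_of c"

definition param :: "'m chart \<Rightarrow> R3 \<Rightarrow> 'm" where
  "param c = inv_into (dom_of c) (coord c)"

definition is_chart :: "'m::topological_space chart \<Rightarrow> bool" where
  "is_chart c \<longleftrightarrow> open (dom_of c) \<and> open (img_of c) \<and>
     homeomorphism (dom_of c) (img_of c) (coord c) (param c)"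

definition smoothly_compatible :: "'m chart \<Rightarrow> 'm chart \<Rightarrow> bool" where
  "smoothly_compatible c c' \<longleftrightarrow>
     smooth_on (coord c ` (dom_of c \<inter> dom_of c')) (coord c' \<circ> param c) \<and>
     smooth_on (coord c' ` (dom_of c \<inter> dom_of c')) (coord c \<circ> param c')"

definition smooth_structure :: "'m::{t2_space,second_countable_topology} chart set \<Rightarrow> bool" where
  "smooth_structure A \<longleftrightarrow>
     (\<forall>c\<in>A. is_chart c) \<and> (\<Union>c\<in>A. dom_of c) = UNIV \<and>
     (\<forall>c\<in>A. \<forall>c'\<in>A. smoothly_compatible c c') \<and>
     (\<forall>c. is_chart c \<and> (\<forall>c'\<in>A. smoothly_compatible c c') \<longrightarrow> c \<in> A)"

definition smooth_map ::
  "'m::topological_space chart set \<Rightarrow> 'a::euclidean_space set \<Rightarrow> ('a \<Rightarrow> 'm) \<Rightarrow> bool" where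
  "smooth_map A S f \<longleftrightarrow> continuous_on S f \<and>
     (\<forall>c\<in>A. smooth_on {x\<in>S. f x \<in> dom_of c} (coord c \<circ> f))"

text \<open>The change of components, at \<open>p\<close>, of a tangent vector from chart \<open>c\<close> to chart \<open>c'\<close>.\<close>

definition change :: "'m chart \<Rightarrow> 'm chart \<Rightarrow> 'm \<Rightarrow> R3 \<Rightarrow> R3" where
  "change c c' p = frechet_derivative (coord c' \<circ> param c) (at (coord c p))"

section \<open>Contact forms\<close>

text \<open>
  Tensors are given by their components in all charts of the atlas, subject to the
  transformation rule: \<open>lam c y w\<close> is the value of the form, in the chart \<open>c\<close>, at the
  coordinate point \<open>y\<close> on the vector with components \<open>w\<close>.
\<close>

definition one_form :: "'m chart set \<Rightarrow> ('m chart \<Rightarrow> R3 \<Rightarrow> R3 \<Rightarrow> real) \<Rightarrow> bool" where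
  "one_form A lam \<longleftrightarrow> (\<forall>c\<in>A.
     (\<forall>y\<in>img_of c. linear (lam c y)) \<and>
     (\<forall>w. smooth_on (img_of c) (\<lambda>y. lam c y w)) \<and>
     (\<forall>c'\<in>A. \<forall>p\<in>dom_of c \<inter> dom_of c'. \<forall>w.
        lam c' (coord c' p) (change c c' p w) = lam c (coord c p) w))"

text \<open>Exterior derivative of a 1-form on an open set, \<open>d\<omega>(v,w) = v(\<omega>(w)) - w(\<omega>(v))\<close> for constant
  vector fields \<open>v\<close>, \<open>w\<close>.\<close>

definition extd :: "('a::real_normed_vector \<Rightarrow> 'a \<Rightarrow> real) \<Rightarrow> 'a \<Rightarrow> 'a \<Rightarrow> 'a \<Rightarrow> real" where
  "extd \<omega> x v w =
     frechet_derivative (\<lambda>y. \<omega> y w) (at x) v - frechet_derivative (\<lambda>y. \<omega> y v) (at x) w"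

text \<open>The last condition says \<open>\<lambda> \<and> d\<lambda> \<noteq> 0\<close>, evaluated on the standard basis.\<close>

definition contact_form :: "'m chart set \<Rightarrow> ('m chart \<Rightarrow> R3 \<Rightarrow> R3 \<Rightarrow> real) \<Rightarrow> bool" where
  "contact_form A lam \<longleftrightarrow> one_form A lam \<and>
     (\<forall>c\<in>A. \<forall>y\<in>img_of c.
        lam c y (1,0,0) * extd (lam c) y (0,1,0) (0,0,1) +
        lam c y (0,1,0) * extd (lam c) y (0,0,1) (1,0,0) +
        lam c y (0,0,1) * extd (lam c) y (1,0,0) (0,1,0) \<noteq> 0)"

definition reeb :: "(R3 \<Rightarrow> R3 \<Rightarrow> real) \<Rightarrow> R3 \<Rightarrow> R3" where
  "reeb \<omega> y = (THE X. (\<forall>w. extd \<omega> y X w = 0) \<and> \<omega> y X = 1)"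

definition ker_form :: "(R3 \<Rightarrow> R3 \<Rightarrow> real) \<Rightarrow> R3 \<Rightarrow> R3 set" where
  "ker_form \<omega> y = {w. \<omega> y w = 0}"

definition xi_proj :: "(R3 \<Rightarrow> R3 \<Rightarrow> real) \<Rightarrow> R3 \<Rightarrow> R3 \<Rightarrow> R3" where
  "xi_proj \<omega> y w = w - \<omega> y w *\<^sub>R reeb \<omega> y"

text \<open>\<open>J c y\<close> matters only on the contact plane; smoothness is required of its extension by \<open>0\<close>
  along the Reeb field.\<close>

definition compatible_complex_structure ::
  "'m chart set \<Rightarrow> ('m chart \<Rightarrow> R3 \<Rightarrow> R3 \<Rightarrow> real) \<Rightarrow> ('m chart \<Rightarrow> R3 \<Rightarrow> R3 \<Rightarrow> R3) \<Rightarrow> bool" where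
  "compatible_complex_structure A lam J \<longleftrightarrow> (\<forall>c\<in>A.
     (\<forall>y\<in>img_of c. \<forall>v\<in>ker_form (lam c) y. 
        J c y v \<in> ker_form (lam c) y \<and> J c y (J c y v) = - v \<and>
        (\<forall>r. J c y (r *\<^sub>R v) = r *\<^sub>R J c y v) \<and>
        (\<forall>w\<in>ker_form (lam c) y. J c y (v + w) = J c y v + J c y w \<and>
           extd (lam c) y v (J c y w) = extd (lam c) y w (J c y v)) \<and>
        (v \<noteq> 0 \<longrightarrow> extd (lam c) y v (J c y v) > 0)) \<and>
     (\<forall>w. smooth_on (img_of c) (\<lambda>y. J c y (xi_proj (lam c) y w))) \<and>
     (\<forall>c'\<in>A. \<forall>p\<in>dom_of c \<inter> dom_of c'. \<forall>v\<in>ker_form (lam c) (coord c p).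
        J c' (coord c' p) (change c c' p v) = change c c' p (J c (coord c p) v)))"

text \<open>The almost complex structure on the symplectization, in the chart \<open>c\<close>, on
  \<open>h \<partial>/\<partial>\<tau> + w\<close>.\<close>

definition Jtilde ::
  "('m chart \<Rightarrow> R3 \<Rightarrow> R3 \<Rightarrow> real) \<Rightarrow> ('m chart \<Rightarrow> R3 \<Rightarrow> R3 \<Rightarrow> R3) \<Rightarrow> 'm chart \<Rightarrow> R3 \<Rightarrow> R4 \<Rightarrow> R4" where
  "Jtilde lam J c y = (\<lambda>(h, w).
     (- lam c y w, J c y (xi_proj (lam c) y w) + h *\<^sub>R reeb (lam c) y))"

section \<open>Legendrian knots and surfaces\<close>

definition legendrian_knot ::
  "'m::topological_space chart set \<Rightarrow> ('m chart \<Rightarrow> R3 \<Rightarrow> R3 \<Rightarrow> real) \<Rightarrow> 'm set \<Rightarrow> bool" where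
  "legendrian_knot A lam L \<longleftrightarrow> (\<exists>\<gamma>::real \<Rightarrow> 'm.
     smooth_map A UNIV \<gamma> \<and> range \<gamma> = L \<and>
     (\<forall>\<theta> \<theta>'. \<gamma> \<theta> = \<gamma> \<theta>' \<longleftrightarrow> \<theta> - \<theta>' \<in> \<int>) \<and>
     (\<forall>\<theta>. \<forall>c\<in>A. \<gamma> \<theta> \<in> dom_of c \<longrightarrow>
        vector_derivative (coord c \<circ> \<gamma>) (at \<theta>) \<noteq> 0 \<and>
        lam c (coord c (\<gamma> \<theta>)) (vector_derivative (coord c \<circ> \<gamma>) (at \<theta>)) = 0))"

definition interior_slice :: "'m chart set \<Rightarrow> 'm set \<Rightarrow> 'm chart \<Rightarrow> bool" where
  "interior_slice A D c \<longleftrightarrow> c \<in> A \<and>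
     coord c ` (dom_of c \<inter> D) = img_of c \<inter> {(x1, x2, x3). x3 = 0}"

definition boundary_slice :: "'m chart set \<Rightarrow> 'm set \<Rightarrow> 'm chart \<Rightarrow> bool" where
  "boundary_slice A D c \<longleftrightarrow> c \<in> A \<and>
     coord c ` (dom_of c \<inter> D) = img_of c \<inter> {(x1, x2, x3). x3 = 0 \<and> 0 \<le> x2}"

definition slice_chart :: "'m chart set \<Rightarrow> 'm set \<Rightarrow> 'm chart \<Rightarrow> bool" where
  "slice_chart A D c \<longleftrightarrow> interior_slice A D c \<or> boundary_slice A D c"

definition embedded_surface :: "'m chart set \<Rightarrow> 'm set \<Rightarrow> bool" where
  "embedded_surface A D \<longleftrightarrow> (\<forall>p\<in>D. \<exists>c. slice_chart A D c \<and> p \<in> dom_of c)"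

definition surface_boundary :: "'m chart set \<Rightarrow> 'm set \<Rightarrow> 'm set" where
  "surface_boundary A D =
     {p\<in>D. \<exists>c. boundary_slice A D c \<and> p \<in> dom_of c \<and> fst (snd (coord c p)) = 0}"

text \<open>A slice chart induces coordinates \<open>(x1, x2)\<close> on \<open>D\<close>, ranging over \<open>slice_dom D c\<close>.\<close>

abbreviation (input) incl :: "R2 \<Rightarrow> R3" where "incl x \<equiv> (fst x, snd x, 0)"
abbreviation (input) drop3 :: "R3 \<Rightarrow> R2" where "drop3 y \<equiv> (fst y, fst (snd y))"

definition slice_dom :: "'m set \<Rightarrow> 'm chart \<Rightarrow> R2 set" where
  "slice_dom D c = {x. incl x \<in> coord c ` (dom_of c \<inter> D)}"

text \<open>A volume form on \<open>D\<close>, given by its components in the slice charts. Its existence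
  is the orientability of \<open>D\<close>, and it induces an orientation.\<close>

definition surface_volume_form ::
  "'m chart set \<Rightarrow> 'm set \<Rightarrow> ('m chart \<Rightarrow> R2 \<Rightarrow> R2 \<Rightarrow> R2 \<Rightarrow> real) \<Rightarrow> bool" where
  "surface_volume_form A D \<sigma> \<longleftrightarrow> (\<forall>c. slice_chart A D c \<longrightarrow>
     (\<forall>x\<in>slice_dom D c. bilinear (\<sigma> c x) \<and> (\<forall>v. \<sigma> c x v v = 0) \<and> \<sigma> c x (1,0) (0,1) \<noteq> 0) \<and>
     (\<forall>v w. smooth_on (slice_dom D c) (\<lambda>x. \<sigma> c x v w)) \<and>
     (\<forall>c'. slice_chart A D c' \<longrightarrow> (\<forall>p\<in>D \<inter> dom_of c \<inter> dom_of c'. \<forall>v w.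
        \<sigma> c' (drop3 (coord c' p)) (drop3 (change c c' p (incl v))) (drop3 (change c c' p (incl w)))
        = \<sigma> c (drop3 (coord c p)) v w)))"

definition singular_point ::
  "'m chart set \<Rightarrow> ('m chart \<Rightarrow> R3 \<Rightarrow> R3 \<Rightarrow> real) \<Rightarrow> 'm set \<Rightarrow> 'm \<Rightarrow> bool" where
  "singular_point A lam D p \<longleftrightarrow> p \<in> D \<and>
     (\<exists>c. slice_chart A D c \<and> p \<in> dom_of c \<and> ker_form (lam c) (coord c p) = range (\<lambda>x. incl x))"

text \<open>The field \<open>Z\<close> on \<open>D\<close> with \<open>i_Z \<sigma> = j^*\<lambda>\<close>, in the coordinates of a slice chart.\<close>

definition char_field ::
  "('m chart \<Rightarrow> R3 \<Rightarrow> R3 \<Rightarrow> real) \<Rightarrow> ('m chart \<Rightarrow> R2 \<Rightarrow> R2 \<Rightarrow> R2 \<Rightarrow> real) \<Rightarrow> 'm chart \<Rightarrow> R2 \<Rightarrow> R2" where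
  "char_field lam \<sigma> c x = (THE Z. \<forall>w. \<sigma> c x Z w = lam c (incl x) (incl w))"

definition complex_eigenvalue :: "(R2 \<Rightarrow> R2) \<Rightarrow> complex \<Rightarrow> bool" where
  "complex_eigenvalue T \<mu> \<longleftrightarrow> (\<exists>z1 z2. (z1, z2) \<noteq> (0, 0) \<and>
     of_real (fst (T (1,0))) * z1 + of_real (fst (T (0,1))) * z2 = \<mu> * z1 \<and>
     of_real (snd (T (1,0))) * z1 + of_real (snd (T (0,1))) * z2 = \<mu> * z2)"

definition nondegenerate_point ::
  "'m chart set \<Rightarrow> ('m chart \<Rightarrow> R3 \<Rightarrow> R3 \<Rightarrow> real) \<Rightarrow> 'm set \<Rightarrow>
   ('m chart \<Rightarrow> R2 \<Rightarrow> R2 \<Rightarrow> R2 \<Rightarrow> real) \<Rightarrow> 'm \<Rightarrow> bool" where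
  "nondegenerate_point A lam D \<sigma> p \<longleftrightarrow> (\<forall>c. slice_chart A D c \<and> p \<in> dom_of c \<longrightarrow>
     \<not> (\<exists>\<mu>. Re \<mu> = 0 \<and> complex_eigenvalue
          (frechet_derivative (char_field lam \<sigma> c) (at (drop3 (coord c p)) within slice_dom D c)) \<mu>))"

section \<open>Normalization near the knot\<close>

text \<open>
  Coordinates in \<open>S^1 \<times> R^2\<close>, \<open>S^1 = R/Z\<close>, on a neighbourhood of the knot are encoded by the
  inverse map \<open>\<Phi>\<close>, lifted to a set \<open>V\<close> of triples \<open>(\<theta>, x, y)\<close> which is invariant under integer
  shifts of \<open>\<theta>\<close>. Restricting \<open>\<theta>\<close> to an interval of length 1 and inverting gives honest charts.
\<close>

definition tube_piece :: "R3 set \<Rightarrow> real \<Rightarrow> R3 set" where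
  "tube_piece V \<theta>0 = {z\<in>V. \<bar>fst z - \<theta>0\<bar> < 1/2}"

definition tube_chart :: "R3 set \<Rightarrow> (R3 \<Rightarrow> 'm) \<Rightarrow> real \<Rightarrow> 'm chart" where
  "tube_chart V \<Phi> \<theta>0 = (\<Phi> ` tube_piece V \<theta>0, inv_into (tube_piece V \<theta>0) \<Phi>)"

definition tube_coordinates ::
  "'m::topological_space chart set \<Rightarrow> ('m chart \<Rightarrow> R3 \<Rightarrow> R3 \<Rightarrow> real) \<Rightarrow>
   ('m chart \<Rightarrow> R3 \<Rightarrow> R3 \<Rightarrow> R3) \<Rightarrow> 'm set \<Rightarrow> R3 set \<Rightarrow> (R3 \<Rightarrow> 'm) \<Rightarrow> bool" where
  "tube_coordinates A lam J L V \<Phi> \<longleftrightarrow>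
     open V \<and> (\<forall>\<theta>. (\<theta>,0,0) \<in> V) \<and>
     (\<forall>\<theta> x y. (\<theta>,x,y) \<in> V \<longleftrightarrow> (\<theta>+1,x,y) \<in> V) \<and>
     (\<forall>z\<in>V. \<forall>z'\<in>V. \<Phi> z = \<Phi> z' \<longleftrightarrow> fst z - fst z' \<in> \<int> \<and> snd z = snd z') \<and>
     (\<forall>\<theta>0. tube_chart V \<Phi> \<theta>0 \<in> A) \<and>
     L = {\<Phi> (\<theta>,0,0) | \<theta>. True} \<and>
     (\<forall>\<theta>0 \<theta> x y h k l. (\<theta>,x,y) \<in> tube_piece V \<theta>0 \<longrightarrow>
        lam (tube_chart V \<Phi> \<theta>0) (\<theta>,x,y) (h,k,l) = l + x * h) \<and>
     (\<exists>N. open N \<and> L \<subseteq> N \<and> (\<forall>\<theta>0 \<theta> x y. (\<theta>,x,y) \<in> tube_piece V \<theta>0 \<and> \<Phi> (\<theta>,x,y) \<in> N \<longrightarrow>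
        J (tube_chart V \<Phi> \<theta>0) (\<theta>,x,y) (1,0,-x) = (0,-1,0) \<and>
        J (tube_chart V \<Phi> \<theta>0) (\<theta>,x,y) (0,1,0) = (1,0,-x)))"

definition surface_normal_form ::
  "'m::topological_space chart set \<Rightarrow> ('m chart \<Rightarrow> R3 \<Rightarrow> R3 \<Rightarrow> real) \<Rightarrow> 'm set \<Rightarrow> 'm set \<Rightarrow>
   R3 set \<Rightarrow> (R3 \<Rightarrow> 'm) \<Rightarrow> (real \<Rightarrow> real) \<Rightarrow> (real \<Rightarrow> real) \<Rightarrow> bool" where
  "surface_normal_form A lam L D V \<Phi> a b \<longleftrightarrow>
     smooth_on UNIV a \<and> smooth_on UNIV b \<and>
     (\<forall>\<theta>. a (\<theta>+1) = a \<theta> \<and> b (\<theta>+1) = b \<theta> \<and> (a \<theta>, b \<theta>) \<noteq> (0,0)) \<and>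
     (\<exists>\<epsilon>>0. \<exists>N. open N \<and> L \<subseteq> N \<and>
        (\<forall>\<theta> r. 0 \<le> r \<and> r < \<epsilon> \<longrightarrow> (\<theta>, a \<theta> * r, b \<theta> * r) \<in> V) \<and>
        D \<inter> N = {\<Phi> (\<theta>, a \<theta> * r, b \<theta> * r) | \<theta> r. 0 \<le> r \<and> r < \<epsilon>}) \<and>
     (\<forall>\<theta>. singular_point A lam D (\<Phi> (\<theta>,0,0)) \<longleftrightarrow> b \<theta> = 0)"

section \<open>Finite energy strips\<close>

definition strip :: "R2 set" where
  "strip = UNIV \<times> {0..1}"

definition pd_s :: "(R2 \<Rightarrow> 'b::real_normed_vector) \<Rightarrow> R2 \<Rightarrow> 'b" where
  "pd_s f = (\<lambda>(s, t). vector_derivative (\<lambda>s'. f (s', t)) (at s))"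

definition pd_t :: "(R2 \<Rightarrow> 'b::real_normed_vector) \<Rightarrow> R2 \<Rightarrow> 'b" where
  "pd_t f = (\<lambda>(s, t). vector_derivative (\<lambda>t'. f (s, t')) (at t within {0..1}))"

text \<open>A map \<open>(f, u)\<close> into the symplectization, in the chart \<open>c\<close>.\<close>

definition in_chart :: "'m chart \<Rightarrow> (R2 \<Rightarrow> real) \<Rightarrow> (R2 \<Rightarrow> 'm) \<Rightarrow> R2 \<Rightarrow> R4" where
  "in_chart c f u = (\<lambda>z. (f z, coord c (u z)))"

definition cutoffs :: "(real \<Rightarrow> real) set" where
  "cutoffs = {\<phi>. smooth_on UNIV \<phi> \<and> (\<forall>\<tau>. 0 \<le> \<phi> \<tau> \<and> \<phi> \<tau> \<le> 1 \<and> 0 \<le> deriv \<phi> \<tau>)}"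

text \<open>The coefficient of \<open>ds \<and> dt\<close> in the pullback of \<open>d(\<phi>\<lambda>)\<close>; it does not depend on the
  chart that is chosen.\<close>

definition energy_density ::
  "'m chart set \<Rightarrow> ('m chart \<Rightarrow> R3 \<Rightarrow> R3 \<Rightarrow> real) \<Rightarrow> (real \<Rightarrow> real) \<Rightarrow>
   (R2 \<Rightarrow> real) \<Rightarrow> (R2 \<Rightarrow> 'm) \<Rightarrow> R2 \<Rightarrow> real" where
  "energy_density A lam \<phi> f u z =
     (let c = (SOME c. c \<in> A \<and> u z \<in> dom_of c); w = in_chart c f u in
      extd (\<lambda>(\<tau>, y) (h, k). \<phi> \<tau> * lam c y k) (w z) (pd_s w z) (pd_t w z))"

text \<open>On solutions of the Cauchy-Riemann equation the density is nonnegative, so that nothing is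
  lost in the conversion to extended nonnegative reals.\<close>

definition energy ::
  "'m chart set \<Rightarrow> ('m chart \<Rightarrow> R3 \<Rightarrow> R3 \<Rightarrow> real) \<Rightarrow> (R2 \<Rightarrow> real) \<Rightarrow> (R2 \<Rightarrow> 'm) \<Rightarrow> ennreal" where
  "energy A lam f u =
     (SUP \<phi>\<in>cutoffs. \<integral>\<^sup>+z\<in>strip. ennreal (energy_density A lam \<phi> f u z) \<partial>lborel)"

definition finite_energy_strip ::
  "'m::topological_space chart set \<Rightarrow> ('m chart \<Rightarrow> R3 \<Rightarrow> R3 \<Rightarrow> real) \<Rightarrow>
   ('m chart \<Rightarrow> R3 \<Rightarrow> R3 \<Rightarrow> R3) \<Rightarrow> 'm set \<Rightarrow> 'm set \<Rightarrow> (R2 \<Rightarrow> real) \<Rightarrow> (R2 \<Rightarrow> 'm) \<Rightarrow> bool" where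
  "finite_energy_strip A lam J L D' f u \<longleftrightarrow>
     smooth_on strip f \<and> smooth_map A strip u \<and>
     (\<forall>z\<in>strip. \<forall>c\<in>A. u z \<in> dom_of c \<longrightarrow>
        pd_s (in_chart c f u) z + Jtilde lam J c (coord c (u z)) (pd_t (in_chart c f u) z) = 0) \<and>
     (\<forall>s. u (s, 0) \<in> L) \<and>
     (\<forall>s. f (s, 1) = 0 \<and> u (s, 1) \<in> D') \<and>
     energy A lam f u < \<infinity> \<and>
     (\<exists>K. compact K \<and> u ` strip \<subseteq> K)"

text \<open>Convergence of \<open>(f, u)(s, t)\<close> to \<open>(0, p)\<close> in \<open>C^\<infinity>([0,1])\<close> as \<open>s \<rightarrow> \<infinity>\<close>.\<close>

definition smooth_limit_at_infinity ::
  "'m chart set \<Rightarrow> (R2 \<Rightarrow> real) \<Rightarrow> (R2 \<Rightarrow> 'm) \<Rightarrow> 'm \<Rightarrow> bool" where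
  "smooth_limit_at_infinity A f u p \<longleftrightarrow> (\<forall>c\<in>A. p \<in> dom_of c \<longrightarrow>
     (\<forall>\<^sub>F s in at_top. \<forall>t\<in>{0..1}. u (s, t) \<in> dom_of c) \<and>
     (\<forall>k. uniform_limit {0..1} (\<lambda>s t. (pd_t ^^ k) (in_chart c f u) (s, t))
            (\<lambda>t. if k = 0 then (0, coord c p) else 0) at_top))"

section \<open>Coordinates at the positive end\<close>

text \<open>
  The end point is \<open>\<Phi> (\<theta>0, 0, 0)\<close>. Its \<open>\<theta>\<close>-coordinate is shifted to \<open>0\<close>, and
  \<open>q(\<theta>) = a(\<theta>) / b(\<theta>)\<close> refers to the shifted coordinate. The coordinates are defined where
  \<open>b \<noteq> 0\<close>.
\<close>

definition end_dom :: "R3 set \<Rightarrow> (R3 \<Rightarrow> 'm) \<Rightarrow> (real \<Rightarrow> real) \<Rightarrow> real \<Rightarrow> 'm set" where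
  "end_dom V \<Phi> b \<theta>0 = {\<Phi> z | z. z \<in> tube_piece V \<theta>0 \<and> b (fst z) \<noteq> 0}"

definition end_coords ::
  "R3 set \<Rightarrow> (R3 \<Rightarrow> 'm) \<Rightarrow> (real \<Rightarrow> real) \<Rightarrow> (real \<Rightarrow> real) \<Rightarrow> real \<Rightarrow> real \<Rightarrow> 'm \<Rightarrow> R4" where
  "end_coords V \<Phi> a b \<theta>0 \<tau> p =
     (let q = (\<lambda>\<theta>. a (\<theta>0 + \<theta>) / b (\<theta>0 + \<theta>));
          (\<theta>', x, y) = coord (tube_chart V \<Phi> \<theta>0) p;
          \<theta> = \<theta>' - \<theta>0
      in (\<tau>, \<theta>, x - q \<theta> * y, y))"

end

theory Submission
  imports Defs "HOL-Real_Asymp.Real_Asymp"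
begin

text \<open>
  The nonlinear Cauchy-Riemann equation can be linearized exactly. In the tube coordinates
  \<open>(\<tau>, \<theta>, x, y)\<close>, where \<open>\<lambda> = dy + x d\<theta>\<close>, the map \<open>(f, \<theta>, x, y)\<close> satisfies
  \<open>f_s = y_t + x \<theta>_t\<close>, \<open>\<theta>_s = - x_t\<close>, \<open>x_s = \<theta>_t\<close>, \<open>y_s = - f_t + x x_t\<close>. Since
  \<open>x \<theta>_t = x x_s = (x\<^sup>2/2)_s\<close>, the function \<open>g = f - x\<^sup>2/2\<close> turns this into the statement that
  \<open>F = x + i\<theta>\<close> and \<open>G = g + iy\<close> are both holomorphic, in the sense \<open>P_s = - i P_t\<close>. All
  nonlinearity is now in the boundary conditions: \<open>x = y = 0\<close> for \<open>t = 0\<close>, and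
  \<open>g = - x\<^sup>2/2\<close>, \<open>x = q(\<theta>) y\<close> for \<open>t = 1\<close>.

  The decay comes from one energy estimate (\<open>dirichlet_energy_decay\<close>) for the real part \<open>h\<close> of a
  holomorphic function with \<open>h(s,0) = 0\<close>. With \<open>D = \<integral> h_t\<^sup>2 + h_s\<^sup>2 dt\<close> and
  \<open>K = - \<integral> h h_s dt\<close> one has \<open>K' = - D + (h h_t)(s,1)\<close>, while the Poincare inequality gives
  \<open>\<bar>K\<bar> \<le> D/2\<close>. So \<open>K\<close> decays exponentially as soon as the boundary term is at most
  \<open>D/2 + C e^{-rs}\<close> and \<open>h\<close> tends to \<open>0\<close>; and \<open>K\<close> controls \<open>\<integral> h\<^sup>2 dt\<close>. The estimate is applied twice.

  For \<open>h = y\<close> the boundary term is \<open>y y_t = y g_s = - q(\<theta>) x_s y\<^sup>2\<close>, a small multiple of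
  \<open>y(s,1)\<^sup>2 \<le> D\<close>. Hence \<open>y\<close>, and with it \<open>G\<close>, decays.

  The boundary planes of the linearized problem meet in the \<open>\<theta>\<close>-axis, so that
  imaginary constants are solutions \<open>F\<close> that do not decay. The combination
  \<open>F + i q(\<theta>0) G\<close> separates this kernel: its real part
  \<open>x - q(\<theta>0) y\<close> vanishes at \<open>t = 0\<close> and equals \<open>(q(\<theta>) - q(\<theta>0)) y\<close> at \<open>t = 1\<close>, which is already
  known to decay. The second application gives the decay of this real part. Its conjugate
  \<open>\<theta> + q(\<theta>0) g\<close> then has decaying derivatives, and converges to \<open>\<theta>0\<close> exponentially
  (\<open>coupled_cauchy_riemann_decay\<close>).

  Convergence in \<open>C^\<infinity>\<close> bounds every derivative. Interpolating between the decaying function and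
  its bounded higher derivatives shows that all derivatives decay, and that the loss of
  exponent can be bounded uniformly in the order (\<open>interpolated_rates\<close>), which is why a single
  \<open>\<rho>\<close> serves all multi-indices. Finally, \<open>v\<close> is obtained from these functions by products
  and by composition with the smooth function \<open>q\<close>.
\<close>

section \<open>Decay of functions on a half-strip\<close>

definition half_strip :: "real \<Rightarrow> R2 set" where
  "half_strip c = {c<..} \<times> {0..1}"

text \<open>
  Derivatives in \<open>t\<close> are one-sided at \<open>t = 0\<close> and \<open>t = 1\<close>, whereas the half-strip is open in \<open>s\<close>.
  This matches the partial derivatives \<open>pd_s\<close> and \<open>pd_t\<close>.
\<close>
definition has_partials ::
  "real \<Rightarrow> (R2 \<Rightarrow> 'b::real_normed_vector) \<Rightarrow> (R2 \<Rightarrow> 'b) \<Rightarrow> (R2 \<Rightarrow> 'b) \<Rightarrow> bool" where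
  "has_partials c h hs ht \<longleftrightarrow> (\<forall>s>c. \<forall>t\<in>{0..1}.
     ((\<lambda>s'. h (s', t)) has_vector_derivative hs (s, t)) (at s) \<and>
     ((\<lambda>t'. h (s, t')) has_vector_derivative ht (s, t)) (at t within {0..1}))"

text \<open>
  The rate \<open>r = 0\<close> is included: bounded functions are then the factors that preserve decay.
\<close>
definition decays :: "real \<Rightarrow> real \<Rightarrow> (R2 \<Rightarrow> 'b::real_normed_vector) \<Rightarrow> bool" where
  "decays c r h \<longleftrightarrow> (\<exists>C. \<forall>s>c. \<forall>t\<in>{0..1}. norm (h (s, t)) \<le> C * exp (- r * s))"

lemma half_strip_mono: "c \<le> c' \<Longrightarrow> half_strip c' \<subseteq> half_strip c"
  by (auto simp: half_strip_def)

lemma mem_half_strip [simp]: "(s, t) \<in> half_strip c \<longleftrightarrow> c < s \<and> 0 \<le> t \<and> t \<le> 1"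
  by (auto simp: half_strip_def)

lemma has_partialsD:
  assumes "has_partials c h hs ht" "c < s" "t \<in> {0..1}"
  shows "((\<lambda>s'. h (s', t)) has_vector_derivative hs (s, t)) (at s)"
    and "((\<lambda>t'. h (s, t')) has_vector_derivative ht (s, t)) (at t within {0..1})"
  using assms unfolding has_partials_def by blast+

lemma has_partials_restrict: "has_partials c h hs ht \<Longrightarrow> c \<le> c' \<Longrightarrow> has_partials c' h hs ht"
  unfolding has_partials_def by auto

lemma decaysE:
  assumes "decays c r h"
  obtains C where "0 < C" "\<And>s t. c < s \<Longrightarrow> t \<in> {0..1} \<Longrightarrow> norm (h (s, t)) \<le> C * exp (- r * s)"
proof -
  from assms obtain C where
    C: "\<And>s t. c < s \<Longrightarrow> t \<in> {0..1} \<Longrightarrow> norm (h (s, t)) \<le> C * exp (- r * s)"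
    unfolding decays_def by blast
  show thesis
  proof (rule that[of "\<bar>C\<bar> + 1"])
    fix s t :: real assume st: "c < s" "t \<in> {0..1}"
    have "C * exp (- r * s) \<le> (\<bar>C\<bar> + 1) * exp (- r * s)" by (intro mult_right_mono) auto
    then show "norm (h (s, t)) \<le> (\<bar>C\<bar> + 1) * exp (- r * s)"
      using C[OF st] by linarith
  qed auto
qed

lemma decaysI:
  assumes "\<And>s t. c < s \<Longrightarrow> t \<in> {0..1} \<Longrightarrow> norm (h (s, t)) \<le> C * exp (- r * s)"
  shows "decays c r h"
  using assms unfolding decays_def by blast

lemma decays_cong:
  assumes "\<And>z. z \<in> half_strip c \<Longrightarrow> h z = h' z"
  shows "decays c r h \<longleftrightarrow> decays c r h'"
  unfolding decays_def using assms by (auto simp: half_strip_def)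

lemma decays_restrict: "decays c r h \<Longrightarrow> c \<le> c' \<Longrightarrow> decays c' r h"
  unfolding decays_def by force

lemma decays_mono:
  assumes "decays c r h" "r' \<le> r"
  shows "decays c r' h"
proof -
  obtain C where C: "0 < C"
    "\<And>s t. c < s \<Longrightarrow> t \<in> {0..1} \<Longrightarrow> norm (h (s, t)) \<le> C * exp (- r * s)"
    using assms(1) by (rule decaysE) blast
  show ?thesis
  proof (rule decaysI[where C = "C * exp ((r' - r) * c)"])
    fix s t :: real assume st: "c < s" "t \<in> {0..1}"
    have "exp (- r * s) = exp ((r' - r) * s) * exp (- r' * s)"
      by (simp add: exp_add[symmetric] algebra_simps)
    also have "\<dots> \<le> exp ((r' - r) * c) * exp (- r' * s)"
      using st assms(2) by (intro mult_right_mono) (auto intro: mult_left_mono_neg)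
    finally have "C * exp (- r * s) \<le> C * (exp ((r' - r) * c) * exp (- r' * s))"
      using C(1) by simp
    with C(2)[OF st] show "norm (h (s, t)) \<le> C * exp ((r' - r) * c) * exp (- r' * s)"
      by (simp add: mult.assoc)
  qed
qed

lemma decays_add:
  assumes "decays c r h" "decays c r h'"
  shows "decays c r (\<lambda>z. h z + h' z)"
proof -
  obtain C where C: "\<And>s t. c < s \<Longrightarrow> t \<in> {0..1} \<Longrightarrow> norm (h (s, t)) \<le> C * exp (- r * s)"
    using assms(1) by (rule decaysE) blast
  obtain D where D: "\<And>s t. c < s \<Longrightarrow> t \<in> {0..1} \<Longrightarrow> norm (h' (s, t)) \<le> D * exp (- r * s)"
    using assms(2) by (rule decaysE) blast
  show ?thesis
    by (rule decaysI[where C = "C + D"])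
      (use C D in \<open>auto simp: distrib_right intro!: norm_triangle_le add_mono\<close>)
qed

lemma decays_le:
  assumes "decays c r h"
    "\<And>s t. c < s \<Longrightarrow> t \<in> {0..1} \<Longrightarrow> norm (h' (s, t)) \<le> B * norm (h (s, t))"
  shows "decays c r h'"
proof -
  obtain C where C: "\<And>s t. c < s \<Longrightarrow> t \<in> {0..1} \<Longrightarrow> norm (h (s, t)) \<le> C * exp (- r * s)"
    using assms(1) by (rule decaysE) blast
  show ?thesis
  proof (rule decaysI[where C = "\<bar>B\<bar> * C"])
    fix s t :: real assume st: "c < s" "t \<in> {0..1}"
    have "norm (h' (s, t)) \<le> \<bar>B\<bar> * norm (h (s, t))"
      using assms(2)[OF st] mult_right_mono[OF abs_ge_self[of B] norm_ge_zero[of "h (s, t)"]] by linarith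
    also have "\<dots> \<le> \<bar>B\<bar> * (C * exp (- r * s))" by (intro mult_left_mono C st) auto
    finally show "norm (h' (s, t)) \<le> \<bar>B\<bar> * C * exp (- r * s)" by (simp add: mult.assoc)
  qed
qed

lemma decays_mult:
  fixes h h' :: "R2 \<Rightarrow> 'b::real_normed_algebra"
  assumes "decays c r h" "decays c r' h'"
  shows "decays c (r + r') (\<lambda>z. h z * h' z)"
proof -
  obtain C where C: "0 < C"
    "\<And>s t. c < s \<Longrightarrow> t \<in> {0..1} \<Longrightarrow> norm (h (s, t)) \<le> C * exp (- r * s)"
    using assms(1) by (rule decaysE) blast
  obtain D where D: "\<And>s t. c < s \<Longrightarrow> t \<in> {0..1} \<Longrightarrow> norm (h' (s, t)) \<le> D * exp (- r' * s)"
    using assms(2) by (rule decaysE) blast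
  show ?thesis
  proof (rule decaysI[where C = "C * D"])
    fix s t :: real assume st: "c < s" "t \<in> {0..1}"
    have "norm (h (s, t) * h' (s, t)) \<le> norm (h (s, t)) * norm (h' (s, t))"
      by (rule norm_mult_ineq)
    also have "\<dots> \<le> (C * exp (- r * s)) * (D * exp (- r' * s))"
      using C(1) by (intro mult_mono C(2) D st) auto
    also have "\<dots> = C * D * exp (- (r + r') * s)"
      by (simp add: exp_add[symmetric] algebra_simps)
    finally show "norm (h (s, t) * h' (s, t)) \<le> C * D * exp (- (r + r') * s)" .
  qed
qed

lemma decays_const: "decays c 0 (\<lambda>z. a)"
  by (rule decaysI[where C = "norm a"]) simp

lemma continuous_on_half_strip_slices:
  assumes "continuous_on (half_strip c) h"
  shows "c < s \<Longrightarrow> continuous_on {0..1} (\<lambda>t. h (s, t))"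
    and "c < a \<Longrightarrow> t \<in> {0..1} \<Longrightarrow> continuous_on {a..b} (\<lambda>s. h (s, t))"
proof -
  show "continuous_on {0..1} (\<lambda>t. h (s, t))" if "c < s"
    by (rule continuous_on_compose2[OF assms]) (use that in \<open>auto intro!: continuous_intros\<close>)
  show "continuous_on {a..b} (\<lambda>s. h (s, t))" if "c < a" "t \<in> {0..1}"
    by (rule continuous_on_compose2[OF assms]) (use that in \<open>auto intro!: continuous_intros\<close>)
qed

text \<open>
  A form of the symmetry of mixed derivatives that assumes only what a first-order evolution
  equation provides: writing \<open>h(s) = h(s0) + \<integral> h_s\<close>, differentiating under the integral in \<open>t\<close>
  and then in \<open>s\<close> shows that \<open>h_t\<close> is differentiable in \<open>s\<close>.
\<close>
lemma s_derivative_of_t_derivative: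
  fixes h :: "R2 \<Rightarrow> 'b::banach"
  assumes h: "has_partials c h hs ht"
    and hs: "\<And>s t. c < s \<Longrightarrow> t \<in> {0..1} \<Longrightarrow>
      ((\<lambda>t'. hs (s, t')) has_vector_derivative hst (s, t)) (at t within {0..1})"
    and cont_hs: "continuous_on (half_strip c) hs" and cont_hst: "continuous_on (half_strip c) hst"
    and st: "c < s" "t \<in> {0..1}"
  shows "((\<lambda>s'. ht (s', t)) has_vector_derivative hst (s, t)) (at s)"
proof -
  define s0 where "s0 = (c + s) / 2"
  have s0: "c < s0" "s0 < s" using st by (auto simp: s0_def)
  have ht: "ht (s', t) = ht (s0, t) + integral {s0..s'} (\<lambda>\<sigma>. hst (\<sigma>, t))" if "s0 \<le> s'" for s'
  proof -
    have eq: "h (s', \<tau>) = h (s0, \<tau>) + integral {s0..s'} (\<lambda>\<sigma>. hs (\<sigma>, \<tau>))" if "\<tau> \<in> {0..1}" for \<tau>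
    proof -
      have "((\<lambda>\<sigma>. hs (\<sigma>, \<tau>)) has_integral h (s', \<tau>) - h (s0, \<tau>)) {s0..s'}"
        using s0 \<open>s0 \<le> s'\<close> that
        by (intro fundamental_theorem_of_calculus
              has_vector_derivative_at_within[OF has_partialsD(1)[OF h]]) auto
      then show ?thesis by (simp add: integral_unique)
    qed
    have cont': "continuous_on ({0..1} \<times> cbox s0 s') (\<lambda>(\<tau>, \<sigma>). hst (\<sigma>, \<tau>))"
      unfolding case_prod_unfold
      by (rule continuous_on_compose2[OF cont_hst]) (use s0 in \<open>auto intro!: continuous_intros\<close>)
    have "((\<lambda>\<tau>. integral (cbox s0 s') (\<lambda>\<sigma>. hs (\<sigma>, \<tau>))) has_vector_derivative
            integral (cbox s0 s') (\<lambda>\<sigma>. hst (\<sigma>, t))) (at t within {0..1})"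
    proof (rule leibniz_rule_vector_derivative[OF _ _ cont'])
      show "((\<lambda>\<tau>. hs (\<sigma>, \<tau>)) has_vector_derivative hst (\<sigma>, \<tau>)) (at \<tau> within {0..1})"
        if "\<tau> \<in> {0..1}" "\<sigma> \<in> cbox s0 s'" for \<tau> \<sigma>
        using that s0 by (intro hs) auto
      show "(\<lambda>\<sigma>. hs (\<sigma>, \<tau>)) integrable_on cbox s0 s'" if "\<tau> \<in> {0..1}" for \<tau>
        using that s0 continuous_on_half_strip_slices(2)[OF cont_hs]
        by (intro integrable_continuous) auto
    qed (use st in auto)
    then have "((\<lambda>\<tau>. h (s0, \<tau>) + integral {s0..s'} (\<lambda>\<sigma>. hs (\<sigma>, \<tau>))) has_vector_derivative
            ht (s0, t) + integral {s0..s'} (\<lambda>\<sigma>. hst (\<sigma>, t))) (at t within {0..1})"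
      using s0 st by (intro has_vector_derivative_add has_partialsD(2)[OF h]) auto
    then have "((\<lambda>\<tau>. h (s', \<tau>)) has_vector_derivative
            ht (s0, t) + integral {s0..s'} (\<lambda>\<sigma>. hst (\<sigma>, t))) (at t within {0..1})"
      by (rule has_vector_derivative_transform[rotated 2]) (use st eq in auto)
    moreover have "((\<lambda>\<tau>. h (s', \<tau>)) has_vector_derivative ht (s', t)) (at t within {0..1})"
      using s0 st that by (intro has_partialsD(2)[OF h]) auto
    ultimately show ?thesis
      using st by (intro vector_derivative_unique_within_closed_interval[of 0 1 t]) (simp_all add: box_real)
  qed
  have "((\<lambda>s'. integral {s0..s'} (\<lambda>\<sigma>. hst (\<sigma>, t))) has_vector_derivative hst (s, t))
      (at s within {s0..s+1})"
    using s0 st by (intro integral_has_vector_derivative continuous_on_half_strip_slices(2)[OF cont_hst]) auto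
  then have "((\<lambda>s'. integral {s0..s'} (\<lambda>\<sigma>. hst (\<sigma>, t))) has_vector_derivative hst (s, t)) (at s)"
    using s0 by (simp add: at_within_Icc_at)
  then have "((\<lambda>s'. ht (s0, t) + integral {s0..s'} (\<lambda>\<sigma>. hst (\<sigma>, t))) has_vector_derivative hst (s, t))
      (at s)"
    by (auto intro!: derivative_eq_intros)
  then show ?thesis
    by (rule has_vector_derivative_transform_within_open[where S = "{s0<..}"])
      (use s0 in \<open>auto simp: ht[symmetric]\<close>)
qed

section \<open>Holomorphic jets on a half-strip\<close>

lemma has_partials_mult:
  fixes f h :: "R2 \<Rightarrow> 'b::real_normed_algebra"
  assumes "has_partials c f fs ft" "has_partials c h hs ht"
  shows "has_partials c (\<lambda>z. f z * h z) (\<lambda>z. f z * hs z + fs z * h z) (\<lambda>z. f z * ht z + ft z * h z)"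
  unfolding has_partials_def
  by (intro allI impI ballI conjI has_vector_derivative_mult
      has_partialsD[OF assms(1)] has_partialsD[OF assms(2)])

lemma has_partials_add:
  assumes "has_partials c f fs ft" "has_partials c h hs ht"
  shows "has_partials c (\<lambda>z. f z + h z) (\<lambda>z. fs z + hs z) (\<lambda>z. ft z + ht z)"
  unfolding has_partials_def
  by (intro allI impI ballI conjI has_vector_derivative_add
      has_partialsD[OF assms(1)] has_partialsD[OF assms(2)])

lemma has_partials_linear:
  assumes "bounded_linear T" "has_partials c h hs ht"
  shows "has_partials c (\<lambda>z. T (h z)) (\<lambda>z. T (hs z)) (\<lambda>z. T (ht z))"
  unfolding has_partials_def
  by (intro allI impI ballI conjI bounded_linear.has_vector_derivative[OF assms(1)]
      has_partialsD[OF assms(2)])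

lemma has_partials_cong:
  assumes "has_partials c h hs ht" "\<And>z. z \<in> half_strip c \<Longrightarrow> hs' z = hs z"
    "\<And>z. z \<in> half_strip c \<Longrightarrow> ht' z = ht z"
  shows "has_partials c h hs' ht'"
  using assms unfolding has_partials_def by (auto simp: half_strip_def)

text \<open>
  \<open>P k\<close> is the \<open>k\<close>-th \<open>t\<close>-derivative of \<open>P 0\<close>. The equation \<open>P_s = - \<i> P_t\<close> says that \<open>P 0\<close> is a
  holomorphic function of \<open>s + \<i>t\<close>, so that the \<open>t\<close>-derivatives determine all others.
\<close>
definition cr_jet :: "real \<Rightarrow> (nat \<Rightarrow> R2 \<Rightarrow> complex) \<Rightarrow> bool" where
  "cr_jet c P \<longleftrightarrow> (\<forall>k. continuous_on (half_strip c) (P k) \<and> decays c 0 (P k) \<and>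
     has_partials c (P k) (\<lambda>z. - \<i> * P (Suc k) z) (P (Suc k)))"

lemma cr_jetD:
  assumes "cr_jet c P"
  shows "continuous_on (half_strip c) (P k)" "decays c 0 (P k)"
    "has_partials c (P k) (\<lambda>z. - \<i> * P (Suc k) z) (P (Suc k))"
  using assms unfolding cr_jet_def by auto

lemma cr_jet_restrict: "cr_jet c P \<Longrightarrow> c \<le> c' \<Longrightarrow> cr_jet c' P"
  unfolding cr_jet_def
  by (meson continuous_on_subset decays_restrict half_strip_mono has_partials_restrict)

lemma cr_jet_lincomb:
  assumes "cr_jet c P" "cr_jet c Q"
  shows "cr_jet c (\<lambda>k z. a * P k z + b * Q k z)"
  unfolding cr_jet_def
proof (intro allI conjI)
  fix k
  note P = cr_jetD[OF assms(1), of k] and Q = cr_jetD[OF assms(2), of k]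
  show "continuous_on (half_strip c) (\<lambda>z. a * P k z + b * Q k z)"
    by (intro continuous_intros P Q)
  show "decays c 0 (\<lambda>z. a * P k z + b * Q k z)"
    using decays_add[OF decays_mult[OF decays_const P(2)] decays_mult[OF decays_const Q(2)], of a b]
    by simp
  show "has_partials c (\<lambda>z. a * P k z + b * Q k z)
      (\<lambda>z. - \<i> * (a * P (Suc k) z + b * Q (Suc k) z)) (\<lambda>z. a * P (Suc k) z + b * Q (Suc k) z)"
    by (rule has_partials_cong[OF has_partials_add[OF
          has_partials_linear[OF bounded_linear_mult_right P(3), of a]
          has_partials_linear[OF bounded_linear_mult_right Q(3), of b]]])
      (simp_all add: algebra_simps)
qed

text \<open>
  It is enough to have the Cauchy-Riemann equation for \<open>P 0\<close>: it can be differentiated in \<open>t\<close> by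
  the symmetry of mixed derivatives.
\<close>
lemma cr_jetI:
  assumes cont: "\<And>k. continuous_on (half_strip c) (P k)" and bd: "\<And>k. decays c 0 (P k)"
    and dt: "\<And>k s t. c < s \<Longrightarrow> t \<in> {0..1} \<Longrightarrow>
      ((\<lambda>t'. P k (s, t')) has_vector_derivative P (Suc k) (s, t)) (at t within {0..1})"
    and ds: "\<And>s t. c < s \<Longrightarrow> t \<in> {0..1} \<Longrightarrow>
      ((\<lambda>s'. P 0 (s', t)) has_vector_derivative - \<i> * P 1 (s, t)) (at s)"
  shows "cr_jet c P"
proof -
  have "has_partials c (P k) (\<lambda>z. - \<i> * P (Suc k) z) (P (Suc k))" for k
  proof (induction k)
    case 0
    show ?case using dt ds by (auto simp: has_partials_def)
  next
    case (Suc k)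
    have "((\<lambda>s'. P (Suc k) (s', t)) has_vector_derivative - \<i> * P (Suc (Suc k)) (s, t)) (at s)"
      if "c < s" "t \<in> {0..1}" for s t
    proof (rule s_derivative_of_t_derivative[OF Suc, where hst = "\<lambda>z. - \<i> * P (Suc (Suc k)) z"])
      show "((\<lambda>t'. - \<i> * P (Suc k) (s, t')) has_vector_derivative - \<i> * P (Suc (Suc k)) (s, t))
          (at t within {0..1})" if "c < s" "t \<in> {0..1}" for s t
        by (rule bounded_linear.has_vector_derivative[OF bounded_linear_mult_right dt[OF that]])
    qed (use that in \<open>auto intro!: continuous_on_mult continuous_on_minus cont continuous_on_const\<close>)
    then show ?case using dt by (auto simp: has_partials_def)
  qed
  then show ?thesis using cont bd by (auto simp: cr_jet_def)
qed

lemma slice_integral_derivative: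
  fixes h :: "R2 \<Rightarrow> real"
  assumes h: "has_partials c h hs ht" "continuous_on (half_strip c) h"
    and hs: "continuous_on (half_strip c) hs" and s: "c < s"
  shows "((\<lambda>s. integral {0..1} (\<lambda>t. h (s, t))) has_real_derivative
    integral {0..1} (\<lambda>t. hs (s, t))) (at s)"
proof -
  have "((\<lambda>s. integral (cbox 0 1) (\<lambda>t. h (s, t))) has_field_derivative
      integral (cbox 0 1) (\<lambda>t. hs (s, t))) (at s within {c<..})"
  proof (rule leibniz_rule_field_derivative)
    show "((\<lambda>s. h (s, t)) has_field_derivative hs (s, t)) (at s within {c<..})"
      if "s \<in> {c<..}" "t \<in> cbox 0 1" for s t
      using has_partialsD(1)[OF h(1), of s t] that
      by (simp add: has_real_derivative_iff_has_vector_derivative has_vector_derivative_at_within)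
    show "(\<lambda>t. h (s, t)) integrable_on cbox 0 1" if "s \<in> {c<..}" for s
      using that continuous_on_half_strip_slices(1)[OF h(2)] by (intro integrable_continuous) auto
    show "continuous_on ({c<..} \<times> cbox 0 1) (\<lambda>(s, t). hs (s, t))"
      using hs by (simp add: half_strip_def case_prod_unfold)
  qed (use s in auto)
  then show ?thesis using s by (simp add: at_within_open[of s "{c<..}"])
qed

text \<open>
  The Poincare inequality, from \<open>0 \<le> \<integral> (p - h(t))\<^sup>2\<close> over \<open>[0,t]\<close> and \<open>\<integral> p = h(t)\<close>.
\<close>
lemma square_le_integral_derivative_square:
  fixes h p :: "real \<Rightarrow> real"
  assumes h: "\<And>t. t \<in> {0..1} \<Longrightarrow> (h has_vector_derivative p t) (at t within {0..1})"
    and p: "continuous_on {0..1} p" and "h 0 = 0" and t: "t \<in> {0..1}"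
  shows "(h t)\<^sup>2 \<le> integral {0..1} (\<lambda>t. (p t)\<^sup>2)"
proof -
  have pt: "continuous_on {0..t} p" using p t by (auto intro: continuous_on_subset)
  have int: "(p has_integral h t) {0..t}"
  proof -
    have "(h has_vector_derivative p x) (at x within {0..t})" if "x \<in> {0..t}" for x
      using that t by (intro has_vector_derivative_within_subset[OF h]) auto
    then show ?thesis
      using fundamental_theorem_of_calculus[of 0 t h p] t \<open>h 0 = 0\<close> by auto
  qed
  have "((\<lambda>x. (p x)\<^sup>2 + (h t)\<^sup>2 - 2 * h t * p x) has_integral
      integral {0..t} (\<lambda>t. (p t)\<^sup>2) + t * (h t)\<^sup>2 - 2 * h t * h t) {0..t}"
    using has_integral_const_real[of "(h t)\<^sup>2" 0 t] t
    by (intro has_integral_diff has_integral_add has_integral_mult_right int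
        integrable_integral integrable_continuous_real continuous_intros pt) auto
  moreover have "(p x)\<^sup>2 + (h t)\<^sup>2 - 2 * h t * p x = (p x - h t)\<^sup>2" for x
    by (simp add: power2_eq_square algebra_simps)
  ultimately have "((\<lambda>x. (p x - h t)\<^sup>2) has_integral
      integral {0..t} (\<lambda>t. (p t)\<^sup>2) + t * (h t)\<^sup>2 - 2 * h t * h t) {0..t}"
    by simp
  then have "0 \<le> integral {0..t} (\<lambda>t. (p t)\<^sup>2) + t * (h t)\<^sup>2 - 2 * h t * h t"
    by (rule has_integral_nonneg) simp
  moreover have "t * (h t)\<^sup>2 \<le> 1 * (h t)\<^sup>2" using t by (intro mult_right_mono) auto
  moreover have "integral {0..t} (\<lambda>t. (p t)\<^sup>2) \<le> integral {0..1} (\<lambda>t. (p t)\<^sup>2)"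
    using t by (intro integral_subset_le integrable_continuous_real continuous_intros pt p) auto
  ultimately show ?thesis by (simp add: power2_eq_square)
qed

lemma nonneg_of_nonincreasing_to_zero:
  fixes \<phi> :: "real \<Rightarrow> real"
  assumes "\<And>s. c < s \<Longrightarrow> \<exists>d. (\<phi> has_real_derivative d) (at s) \<and> d \<le> 0"
    and lim: "(\<phi> \<longlongrightarrow> 0) at_top" and "c < s"
  shows "0 \<le> \<phi> s"
proof (rule tendsto_upperbound[OF lim])
  show "\<forall>\<^sub>F x in at_top. \<phi> x \<le> \<phi> s"
    using eventually_ge_at_top[of s]
    by eventually_elim (rule DERIV_nonpos_imp_nonincreasing, use assms in auto)
qed simp

section \<open>The energy estimate\<close>

text \<open>
  Let \<open>h\<close> be the real part of \<open>P 0\<close>; then \<open>P 1 = h_t + \<i> h_s\<close>. Adding \<open>(C/r) e^{-rs}\<close> to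
  \<open>K = - \<integral> h h_s dt\<close> absorbs the inhomogeneous part of the boundary term, so that the sum \<open>K1\<close>
  satisfies \<open>K1' \<le> - D/2 \<le> - K\<close>; this differential inequality makes \<open>K1\<close> decay. The function
  \<open>W = \<integral> h\<^sup>2/2\<close> satisfies \<open>W' = - K \<ge> K1'\<close>, and as both tend to \<open>0\<close>, \<open>W \<le> K1\<close>. The passage from
  \<open>\<integral> h\<^sup>2 dt = O(e^{-rs})\<close> to the supremum norm uses the bound on \<open>h_t\<close> and costs a further
  factor in the exponent.
\<close>
lemma dirichlet_energy_decay:
  assumes P: "cr_jet c P" and bot: "\<And>s. c < s \<Longrightarrow> Re (P 0 (s, 0)) = 0"
    and r: "0 < r" "r < 1" and C: "0 \<le> C"
    and top: "\<And>s. c < s \<Longrightarrow> Re (P 0 (s, 1)) * Re (P 1 (s, 1)) \<le>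
      integral {0..1} (\<lambda>t. (Re (P 1 (s, t)))\<^sup>2 + (Im (P 1 (s, t)))\<^sup>2) / 2 + C * exp (- r * s)"
    and lim: "uniform_limit {0..1} (\<lambda>s t. Re (P 0 (s, t))) (\<lambda>_. 0) at_top"
  shows "decays (c + 1) (r / 4) (\<lambda>z. Re (P 0 z))"
proof -
  define h p q where "h = (\<lambda>z. Re (P 0 z))" and "p = (\<lambda>z. Re (P 1 z))" and "q = (\<lambda>z. Im (P 1 z))"
  define p' where "p' = (\<lambda>z. Re (P 2 z))"
  define D where "D = (\<lambda>s. integral {0..1} (\<lambda>t. (p (s, t))\<^sup>2 + (q (s, t))\<^sup>2))"
  define K where "K = (\<lambda>s. - integral {0..1} (\<lambda>t. h (s, t) * q (s, t)))"
  define W where "W = (\<lambda>s. integral {0..1} (\<lambda>t. (h (s, t))\<^sup>2) / 2)"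
  define K1 where "K1 = (\<lambda>s. K s + C / r * exp (- r * s))"
  have cont_P: "continuous_on (half_strip c) (P k)" for k by (rule cr_jetD[OF P])
  have cont: "continuous_on (half_strip c) h" "continuous_on (half_strip c) p"
    "continuous_on (half_strip c) q" "continuous_on (half_strip c) p'"
    unfolding h_def p_def q_def p'_def by (intro continuous_intros cont_P)+
  have slice: "continuous_on {0..1} (\<lambda>t. h (s, t))" "continuous_on {0..1} (\<lambda>t. p (s, t))"
    "continuous_on {0..1} (\<lambda>t. q (s, t))" "continuous_on {0..1} (\<lambda>t. p' (s, t))" if "c < s" for s
    by (rule continuous_on_half_strip_slices(1)[OF cont(1) that]
        continuous_on_half_strip_slices(1)[OF cont(2) that]
        continuous_on_half_strip_slices(1)[OF cont(3) that]
        continuous_on_half_strip_slices(1)[OF cont(4) that])+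
  have h_partials: "has_partials c h q p"
    by (rule has_partials_cong[OF has_partials_linear[OF bounded_linear_Re cr_jetD(3)[OF P, of 0]],
          folded h_def]) (simp_all add: p_def q_def)
  have q_s: "has_partials c q (\<lambda>z. - p' z) (\<lambda>z. Im (P 2 z))"
    using has_partials_linear[OF bounded_linear_Im cr_jetD(3)[OF P, of 1]]
    by (simp add: q_def p'_def numeral_2_eq_2)
  have p_t: "((\<lambda>t. p (s, t)) has_vector_derivative p' (s, t)) (at t within {0..1})"
    if "c < s" "t \<in> {0..1}" for s t
    using has_partialsD(2)[OF has_partials_linear[OF bounded_linear_Re cr_jetD(3)[OF P, of 1]] that]
    by (simp add: p_def p'_def numeral_2_eq_2)

  \<comment> \<open>By harmonicity \<open>h_ss = - h_tt\<close>, and integration by parts in \<open>t\<close> leaves only the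
      boundary value at \<open>t = 1\<close>.\<close>
  have K_deriv: "(K has_real_derivative h (s, 1) * p (s, 1) - D s) (at s)" if s: "c < s" for s
  proof -
    have "((\<lambda>s. integral {0..1} (\<lambda>t. h (s, t) * q (s, t))) has_real_derivative
        integral {0..1} (\<lambda>t. h (s, t) * - p' (s, t) + q (s, t) * q (s, t))) (at s)"
      by (intro slice_integral_derivative[OF has_partials_mult[OF h_partials q_s]]
          continuous_intros cont s)
    then have "(K has_real_derivative
        - integral {0..1} (\<lambda>t. h (s, t) * - p' (s, t) + q (s, t) * q (s, t))) (at s)"
      unfolding K_def by (rule DERIV_minus)
    moreover have "((\<lambda>t. h (s, t) * p' (s, t) + p (s, t) * p (s, t)) has_integral
        h (s, 1) * p (s, 1) - h (s, 0) * p (s, 0)) {0..1}"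
      using s by (intro fundamental_theorem_of_calculus has_vector_derivative_mult p_t
          has_partialsD(2)[OF h_partials]) auto
    moreover have "((\<lambda>t. (p (s, t))\<^sup>2 + (q (s, t))\<^sup>2) has_integral D s) {0..1}"
      unfolding D_def
      by (intro integrable_integral integrable_continuous_real continuous_intros slice s)
    ultimately have "((\<lambda>t. (p (s, t))\<^sup>2 + (q (s, t))\<^sup>2 - (h (s, t) * p' (s, t) + p (s, t) * p (s, t)))
        has_integral D s - (h (s, 1) * p (s, 1) - h (s, 0) * p (s, 0))) {0..1}"
      by (intro has_integral_diff)
    then have "integral {0..1} (\<lambda>t. h (s, t) * - p' (s, t) + q (s, t) * q (s, t)) =
        D s - h (s, 1) * p (s, 1)"
      using bot[OF s] by (intro integral_unique) (simp add: power2_eq_square h_def algebra_simps)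
    with \<open>(K has_real_derivative _) (at s)\<close> show ?thesis by simp
  qed
  have h_le: "(h (s, t))\<^sup>2 \<le> integral {0..1} (\<lambda>t. (p (s, t))\<^sup>2)" if "c < s" "t \<in> {0..1}" for s t
    using that bot slice
    by (intro square_le_integral_derivative_square[where h = "\<lambda>t. h (s, t)"]
        has_partialsD(2)[OF h_partials]) (auto simp: h_def)
  have K_le: "\<bar>K s\<bar> \<le> D s / 2" if s: "c < s" for s
  proof -
    define I where "I = integral {0..1} (\<lambda>t. (p (s, t))\<^sup>2)"
    have q2: "((\<lambda>t. (q (s, t))\<^sup>2) has_integral integral {0..1} (\<lambda>t. (q (s, t))\<^sup>2)) {0..1}"
      by (intro integrable_integral integrable_continuous_real continuous_intros slice s)
    have p2: "((\<lambda>t. (p (s, t))\<^sup>2) has_integral I) {0..1}" unfolding I_def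
      by (intro integrable_integral integrable_continuous_real continuous_intros slice s)
    have D: "D s = I + integral {0..1} (\<lambda>t. (q (s, t))\<^sup>2)"
      unfolding D_def by (intro integral_unique has_integral_add p2 q2)
    have "((\<lambda>t. (I + (q (s, t))\<^sup>2) / 2) has_integral D s / 2) {0..1}"
      unfolding D
      by (intro has_integral_divide has_integral_add q2) (use has_integral_const_real[of I 0 1] in simp)
    moreover have "((\<lambda>t. h (s, t) * q (s, t)) has_integral - K s) {0..1}"
      unfolding K_def minus_minus
      by (intro integrable_integral integrable_continuous_real continuous_intros slice s)
    moreover have "\<bar>h (s, t) * q (s, t)\<bar> \<le> (I + (q (s, t))\<^sup>2) / 2" if "t \<in> {0..1}" for t
      using h_le[OF s that] sum_squares_bound[of "\<bar>h (s, t)\<bar>" "\<bar>q (s, t)\<bar>"]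
      by (simp add: I_def abs_mult)
    ultimately show ?thesis
      using integral_norm_bound_integral[of "\<lambda>t. h (s, t) * q (s, t)" "{0..1}" "\<lambda>t. (I + (q (s, t))\<^sup>2) / 2"]
      by (auto simp: has_integral_iff)
  qed
  have K1_deriv: "\<exists>d. (K1 has_real_derivative d) (at s) \<and> d \<le> - D s / 2" if s: "c < s" for s
  proof (intro exI conjI)
    show "(K1 has_real_derivative h (s, 1) * p (s, 1) - D s - C * exp (- r * s)) (at s)"
      unfolding K1_def using r by (auto intro!: derivative_eq_intros K_deriv s)
    show "h (s, 1) * p (s, 1) - D s - C * exp (- r * s) \<le> - D s / 2"
      using top[OF s] by (simp add: h_def p_def q_def D_def)
  qed
  have W_deriv: "(W has_real_derivative - K s) (at s)" if s: "c < s" for s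
  proof -
    have "((\<lambda>s. integral {0..1} (\<lambda>t. h (s, t) * h (s, t))) has_real_derivative
        integral {0..1} (\<lambda>t. h (s, t) * q (s, t) + q (s, t) * h (s, t))) (at s)"
      by (intro slice_integral_derivative[OF has_partials_mult[OF h_partials h_partials]]
          continuous_intros cont s)
    moreover have "integral {0..1} (\<lambda>t. h (s, t) * q (s, t) + q (s, t) * h (s, t)) = - 2 * K s"
    proof -
      have "integral {0..1} (\<lambda>t. h (s, t) * q (s, t) + q (s, t) * h (s, t)) =
          integral {0..1} (\<lambda>t. 2 * (h (s, t) * q (s, t)))"
        by (rule arg_cong[where f = "integral {0..1}"]) (auto simp: algebra_simps)
      then show ?thesis by (simp add: K_def)
    qed
    ultimately show ?thesis
      unfolding W_def power2_eq_square by (auto intro!: derivative_eq_intros)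
  qed

  obtain B where B: "0 < B" "\<And>s t. c < s \<Longrightarrow> t \<in> {0..1} \<Longrightarrow> cmod (P 1 (s, t)) \<le> B"
    using cr_jetD(2)[OF P, of 1] by (rule decaysE) auto
  have pB: "\<bar>p (s, t)\<bar> \<le> B" and qB: "\<bar>q (s, t)\<bar> \<le> B" if "c < s" "t \<in> {0..1}" for s t
    using B(2)[OF that] abs_Re_le_cmod[of "P 1 (s, t)"] abs_Im_le_cmod[of "P 1 (s, t)"]
    by (auto simp: p_def q_def)
  have small: "\<forall>\<^sub>F s in at_top. \<bar>K s\<bar> \<le> e * B \<and> \<bar>W s\<bar> \<le> e\<^sup>2" if "0 < e" for e
    using uniform_limitD[OF lim that] eventually_gt_at_top[of c]
  proof eventually_elim
    case (elim s)
    then have h: "\<bar>h (s, t)\<bar> \<le> e" if "t \<in> {0..1}" for t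
      using that by (force simp: h_def)
    have "\<bar>h (s, t) * q (s, t)\<bar> \<le> e * B" if "t \<in> {0..1}" for t
      unfolding abs_mult using h[OF that] qB[OF elim(2) that] \<open>0 < e\<close> by (intro mult_mono) auto
    then have "\<bar>K s\<bar> \<le> e * B"
      using integral_norm_bound_integral[of "\<lambda>t. h (s, t) * q (s, t)" "{0..1}" "\<lambda>t. e * B"] slice[OF elim(2)]
      by (auto simp: K_def integrable_continuous_real continuous_intros)
    moreover have "\<bar>(h (s, t))\<^sup>2\<bar> \<le> e\<^sup>2" if "t \<in> {0..1}" for t
      using h[OF that] \<open>0 < e\<close> by (simp add: abs_le_square_iff[symmetric])
    then have "\<bar>W s\<bar> \<le> e\<^sup>2 / 2"
      using integral_norm_bound_integral[of "\<lambda>t. (h (s, t))\<^sup>2" "{0..1}" "\<lambda>t. e\<^sup>2"] slice[OF elim(2)]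
      by (auto simp: W_def integrable_continuous_real continuous_intros)
    ultimately show ?case using zero_le_power2[of e] by linarith
  qed
  have K_lim: "(K \<longlongrightarrow> 0) at_top"
  proof (rule tendstoI)
    fix e :: real assume "0 < e"
    with small[of "e / (2 * B)"] B(1) show "\<forall>\<^sub>F s in at_top. dist (K s) 0 < e"
      by (auto elim!: eventually_mono)
  qed
  have W_lim: "(W \<longlongrightarrow> 0) at_top"
  proof (rule tendstoI)
    fix e :: real assume "0 < e"
    then have "\<forall>\<^sub>F s in at_top. \<bar>W s\<bar> \<le> e / 2"
      using small[of "sqrt (e / 2)"] by (auto elim!: eventually_mono)
    then show "\<forall>\<^sub>F s in at_top. dist (W s) 0 < e"
      using \<open>0 < e\<close> by (auto elim!: eventually_mono)
  qed
  have K1_lim: "(K1 \<longlongrightarrow> 0) at_top"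
  proof -
    have "LIM s at_top. - r * s :> at_bot"
      by (rule filterlim_tendsto_neg_mult_at_bot[OF tendsto_const _ filterlim_ident]) (use r in simp)
    then have "((\<lambda>s. C / r * exp (- r * s)) \<longlongrightarrow> C / r * 0) at_top"
      by (intro tendsto_mult tendsto_const filterlim_compose[OF exp_at_bot])
    from tendsto_add[OF K_lim this] show ?thesis by (simp add: K1_def[abs_def])
  qed

  have W_le: "W s \<le> K1 s" if s: "c < s" for s
  proof -
    have "0 \<le> K1 s - W s"
    proof (rule nonneg_of_nonincreasing_to_zero[OF _ _ s])
      show "((\<lambda>s. K1 s - W s) \<longlongrightarrow> 0) at_top" using tendsto_diff[OF K1_lim W_lim] by simp
    next
      fix x assume x: "c < x"
      from K1_deriv[OF x] obtain d where d: "(K1 has_real_derivative d) (at x)" "d \<le> - D x / 2"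
        by auto
      show "\<exists>d. ((\<lambda>s. K1 s - W s) has_real_derivative d) (at x) \<and> d \<le> 0"
        using DERIV_diff[OF d(1) W_deriv[OF x]] d(2) K_le[OF x] by (intro exI conjI) auto
    qed
    then show ?thesis by simp
  qed
  \<comment> \<open>Gronwall: \<open>e^s K1\<close> minus a particular solution is nonincreasing.\<close>
  define E where "E = (\<lambda>s. exp s * K1 s - C / (r * (1 - r)) * exp ((1 - r) * s))"
  have E_le: "E s \<le> E (c + 1)" if "c + 1 \<le> s" for s
  proof (rule DERIV_nonpos_imp_nonincreasing[OF that])
    fix x assume "c + 1 \<le> x"
    then have x: "c < x" by simp
    from K1_deriv[OF x] obtain d where d: "(K1 has_real_derivative d) (at x)" "d \<le> - D x / 2"
      by auto
    have "(E has_real_derivative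
        exp x * (K1 x + d) - C / (r * (1 - r)) * ((1 - r) * exp ((1 - r) * x))) (at x)"
      unfolding E_def using r by (auto intro!: derivative_eq_intros d simp: distrib_left)
    moreover have "C / (r * (1 - r)) * ((1 - r) * exp ((1 - r) * x)) = exp x * (C / r * exp (- r * x))"
    proof -
      have "exp ((1 - r) * x) = exp x * exp (- r * x)"
        by (simp add: exp_add[symmetric] algebra_simps)
      then show ?thesis using r by simp
    qed
    moreover have "exp x * (K1 x + d) \<le> exp x * (C / r * exp (- r * x))"
      using d(2) K_le[OF x] by (intro mult_left_mono) (auto simp: K1_def)
    ultimately show "\<exists>y. (E has_real_derivative y) (at x) \<and> y \<le> 0"
      by (metis diff_le_0_iff_le)
  qed
  define M where "M = \<bar>E (c + 1)\<bar> * exp (- (1 - r) * (c + 1)) + C / (r * (1 - r))"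
  have W_decay: "W s \<le> M * exp (- r * s)" if s: "c + 1 \<le> s" for s
  proof -
    have "exp s * K1 s \<le> \<bar>E (c + 1)\<bar> + C / (r * (1 - r)) * exp ((1 - r) * s)"
      using E_le[OF s] by (simp add: E_def)
    then have "exp (- s) * (exp s * K1 s) \<le>
        exp (- s) * (\<bar>E (c + 1)\<bar> + C / (r * (1 - r)) * exp ((1 - r) * s))"
      by (intro mult_left_mono) auto
    also have "exp (- s) * (exp s * K1 s) = K1 s"
      by (simp add: exp_minus field_simps)
    also have "exp (- s) * (\<bar>E (c + 1)\<bar> + C / (r * (1 - r)) * exp ((1 - r) * s)) =
        exp (- s) * \<bar>E (c + 1)\<bar> + C / (r * (1 - r)) * (exp (- s) * exp ((1 - r) * s))"
      by (simp only: distrib_left mult.left_commute)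
    also have "exp (- s) * exp ((1 - r) * s) = exp (- r * s)"
      by (simp add: exp_add[symmetric] algebra_simps)
    also have "exp (- s) * \<bar>E (c + 1)\<bar> = exp (- (1 - r) * s) * \<bar>E (c + 1)\<bar> * exp (- r * s)"
      by (simp add: exp_add[symmetric] algebra_simps)
    also have "\<dots> \<le> exp (- (1 - r) * (c + 1)) * \<bar>E (c + 1)\<bar> * exp (- r * s)"
      using s r by (intro mult_right_mono) (auto intro: mult_left_mono_neg)
    finally show ?thesis using W_le[of s] s by (simp add: M_def algebra_simps)
  qed

  show ?thesis
  proof (rule decaysI[where C = "sqrt (2 * M + B\<^sup>2)"])
    fix s t :: real assume "c + 1 < s" and t: "t \<in> {0..1}"
    then have s: "c < s" "c + 1 \<le> s" by auto
    \<comment> \<open>The weight that balances \<open>w h\<^sup>2\<close> against \<open>B\<^sup>2 / w\<close> in \<open>2 h h_t \<le> w h\<^sup>2 + h_t\<^sup>2 / w\<close>.\<close>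
    define w where "w = exp (r * s / 2)"
    have w: "0 < w" "1 / w = exp (- (r * s) / 2)" by (auto simp: w_def exp_minus field_simps)
    have "((\<lambda>\<tau>. h (s, \<tau>) * p (s, \<tau>) + p (s, \<tau>) * h (s, \<tau>)) has_integral
        h (s, t) * h (s, t) - h (s, 0) * h (s, 0)) {0..t}"
      using s t has_partialsD(2)[OF has_partials_mult[OF h_partials h_partials]]
      by (intro fundamental_theorem_of_calculus)
        (auto intro: has_vector_derivative_within_subset[where T = "{0..t}" and S = "{0..1}"])
    then have int: "((\<lambda>\<tau>. 2 * (h (s, \<tau>) * p (s, \<tau>))) has_integral (h (s, t))\<^sup>2) {0..t}"
      using bot[OF s(1)] by (simp add: h_def power2_eq_square algebra_simps)
    have int': "(\<lambda>\<tau>. w * (h (s, \<tau>))\<^sup>2 + B\<^sup>2 / w) integrable_on {0..1}"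
      using slice[OF s(1)] by (intro integrable_continuous_real continuous_intros)
    have "(h (s, t))\<^sup>2 \<le> integral {0..t} (\<lambda>\<tau>. w * (h (s, \<tau>))\<^sup>2 + B\<^sup>2 / w)"
    proof (rule has_integral_le[OF int])
      show "((\<lambda>\<tau>. w * (h (s, \<tau>))\<^sup>2 + B\<^sup>2 / w) has_integral
          integral {0..t} (\<lambda>\<tau>. w * (h (s, \<tau>))\<^sup>2 + B\<^sup>2 / w)) {0..t}"
        using int' t by (intro integrable_integral) (rule integrable_on_subinterval, auto)
      show "2 * (h (s, \<tau>) * p (s, \<tau>)) \<le> w * (h (s, \<tau>))\<^sup>2 + B\<^sup>2 / w" if "\<tau> \<in> {0..t}" for \<tau>
      proof -
        have "0 \<le> (w * h (s, \<tau>) - p (s, \<tau>))\<^sup>2 / w" using w by simp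
        also have "\<dots> = w * (h (s, \<tau>))\<^sup>2 - 2 * (h (s, \<tau>) * p (s, \<tau>)) + (p (s, \<tau>))\<^sup>2 / w"
          using w by (simp add: field_simps power2_eq_square)
        also have "(p (s, \<tau>))\<^sup>2 / w \<le> B\<^sup>2 / w"
          using pB[OF s(1), of \<tau>] that t w B(1)
          by (intro divide_right_mono) (auto simp: abs_le_square_iff[symmetric])
        finally show ?thesis by simp
      qed
    qed
    also have "\<dots> \<le> integral {0..1} (\<lambda>\<tau>. w * (h (s, \<tau>))\<^sup>2 + B\<^sup>2 / w)"
      using t w by (intro integral_subset_le int' integrable_on_subinterval[OF int']) auto
    also have "\<dots> = w * (2 * W s) + B\<^sup>2 / w"
    proof -
      have "((\<lambda>\<tau>. w * (h (s, \<tau>))\<^sup>2 + B\<^sup>2 / w) has_integral w * (2 * W s) + B\<^sup>2 / w) {0..1}"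
      proof (intro has_integral_add has_integral_mult_right)
        show "((\<lambda>\<tau>. (h (s, \<tau>))\<^sup>2) has_integral 2 * W s) {0..1}"
          using slice[OF s(1)]
          by (simp add: W_def has_integral_iff integrable_continuous_real continuous_intros)
        show "((\<lambda>\<tau>::real. B\<^sup>2 / w) has_integral B\<^sup>2 / w) {0..1}"
          using has_integral_const_real[of "B\<^sup>2 / w" 0 1] by simp
      qed
      then show ?thesis by (rule integral_unique)
    qed
    also have "\<dots> \<le> w * (2 * (M * exp (- r * s))) + B\<^sup>2 / w"
      using W_decay[OF s(2)] w by simp
    also have "\<dots> = (2 * M + B\<^sup>2) * (1 / w)"
    proof -
      have "w * exp (- r * s) = 1 / w"
        unfolding w by (simp add: w_def exp_add[symmetric])
      moreover have "w * (2 * (M * exp (- r * s))) = 2 * M * (w * exp (- r * s))"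
        by (simp only: mult.left_commute mult.assoc mult.commute)
      ultimately show ?thesis by (simp add: add_divide_distrib)
    qed
    also have "\<dots> = (2 * M + B\<^sup>2) * (exp (- (r / 4) * s))\<^sup>2"
      unfolding w by (simp add: exp_double[symmetric])
    finally have "sqrt ((h (s, t))\<^sup>2) \<le> sqrt ((2 * M + B\<^sup>2) * (exp (- (r / 4) * s))\<^sup>2)"
      by (rule real_sqrt_le_mono)
    then show "norm (Re (P 0 (s, t))) \<le> sqrt (2 * M + B\<^sup>2) * exp (- (r / 4) * s)"
      by (simp add: real_sqrt_mult h_def)
  qed
qed

section \<open>Interpolation of decay rates\<close>

text \<open>
  Landau's inequality on an interval: by the mean value theorem the derivative is small
  somewhere, and it varies by at most the length times the bound on the second derivative.
\<close>
lemma derivative_interpolation_bound: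
  fixes \<phi> \<psi> \<omega> :: "real \<Rightarrow> real"
  assumes ab: "a < b"
    and d1: "\<And>x. x \<in> {a..b} \<Longrightarrow> (\<phi> has_vector_derivative \<psi> x) (at x within {a..b})"
    and d2: "\<And>x. x \<in> {a..b} \<Longrightarrow> (\<psi> has_vector_derivative \<omega> x) (at x within {a..b})"
    and A: "\<And>x. x \<in> {a..b} \<Longrightarrow> \<bar>\<phi> x\<bar> \<le> A" and K: "\<And>x. x \<in> {a..b} \<Longrightarrow> \<bar>\<omega> x\<bar> \<le> K"
    and z: "z \<in> {a..b}"
  shows "\<bar>\<psi> z\<bar> \<le> 2 * A / (b - a) + K * (b - a)"
proof -
  obtain x where x: "x \<in> {a<..<b}" "\<phi> b - \<phi> a = (b - a) * \<psi> x"
    using mvt_simple[OF ab, of \<phi> "\<lambda>x y. y * \<psi> x"] d1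
    by (auto simp: has_vector_derivative_def)
  have "\<psi> x = (\<phi> b - \<phi> a) / (b - a)" using x(2) ab by simp
  then have "\<bar>\<psi> x\<bar> = \<bar>\<phi> b - \<phi> a\<bar> / (b - a)" using ab by simp
  also have "\<dots> \<le> 2 * A / (b - a)"
    using A[of a] A[of b] ab by (intro divide_right_mono) auto
  finally have "\<bar>\<psi> x\<bar> \<le> 2 * A / (b - a)" .
  moreover have "norm (\<psi> z - \<psi> x) \<le> K * norm (z - x)"
  proof (rule differentiable_bound[where S = "{a..b}" and f' = "\<lambda>x y. y * \<omega> x"])
    show "(\<psi> has_derivative (\<lambda>y. y * \<omega> x)) (at x within {a..b})" if "x \<in> {a..b}" for x
      using d2[OF that] by (simp add: has_vector_derivative_def)
    show "onorm (\<lambda>y. y * \<omega> x) \<le> K" if "x \<in> {a..b}" for x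
      using K[OF that] by (intro onorm_bound) (auto simp: abs_mult mult.commute[of K] intro!: mult_left_mono)
  qed (use x z in auto)
  moreover have "K * norm (z - x) \<le> K * (b - a)"
    using K[OF z] x(1) z by (intro mult_left_mono) auto
  ultimately show ?thesis by simp
qed

text \<open>
  The interval length \<open>e^{-(r - r2)s/2}\<close> makes both terms of the interpolation bound
  decay at the mean of the two rates.
\<close>
lemma interpolation_exponents:
  fixes r :: real
  shows "2 * (A * exp (- r * s)) / exp (- ((r - r2) / 2) * s) +
      (K * exp (- r2 * s)) * exp (- ((r - r2) / 2) * s) = (2 * A + K) * exp (- ((r + r2) / 2) * s)"
proof -
  have "exp (- r * s) / exp (- ((r - r2) / 2) * s) = exp (- ((r + r2) / 2) * s)"
    unfolding exp_diff[symmetric] by (rule arg_cong[where f = exp]) (simp add: field_simps)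
  moreover have "exp (- r2 * s) * exp (- ((r - r2) / 2) * s) = exp (- ((r + r2) / 2) * s)"
    unfolding exp_add[symmetric] by (rule arg_cong[where f = exp]) (simp add: field_simps)
  ultimately show ?thesis
    by (simp only: distrib_right mult.assoc times_divide_eq_right[symmetric])
qed

lemma decays_interpolation_t:
  fixes h :: "R2 \<Rightarrow> real"
  assumes h: "has_partials c h hs ht" and ht: "has_partials c ht hts htt"
    and dec: "decays c r h" "decays c r2 htt" and r: "r2 \<le> r" and c: "0 \<le> c"
  shows "decays c ((r + r2) / 2) ht"
proof -
  obtain A where A: "\<And>s t. c < s \<Longrightarrow> t \<in> {0..1} \<Longrightarrow> \<bar>h (s, t)\<bar> \<le> A * exp (- r * s)"
    using dec(1) by (rule decaysE) auto
  obtain K where K: "\<And>s t. c < s \<Longrightarrow> t \<in> {0..1} \<Longrightarrow> \<bar>htt (s, t)\<bar> \<le> K * exp (- r2 * s)"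
    using dec(2) by (rule decaysE) auto
  show ?thesis
  proof (rule decaysI)
    fix s t :: real assume s: "c < s" and t: "t \<in> {0..1}"
    define \<eta> where "\<eta> = exp (- ((r - r2) / 2) * s)"
    have \<eta>: "0 < \<eta>" "\<eta> \<le> 1" using r s c by (auto simp: \<eta>_def)
    \<comment> \<open>An interval of length \<open>\<eta>\<close> inside \<open>[0,1]\<close> that contains \<open>t\<close>.\<close>
    define a b where "a = t * (1 - \<eta>)" and "b = a + \<eta>"
    have ab: "a < b" "b - a = \<eta>" using \<eta> by (auto simp: b_def)
    have "b = 1 - (1 - t) * (1 - \<eta>)" by (simp add: a_def b_def algebra_simps)
    moreover have "0 \<le> a" "0 \<le> (1 - t) * (1 - \<eta>)" using t \<eta> by (auto simp: a_def)
    ultimately have sub: "{a..b} \<subseteq> {0..1}" by auto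
    have "t - a = t * \<eta>" "b - t = (1 - t) * \<eta>" by (auto simp: a_def b_def algebra_simps)
    moreover have "0 \<le> t * \<eta>" "0 \<le> (1 - t) * \<eta>" using t \<eta> by auto
    ultimately have "t \<in> {a..b}" by auto
    then have "\<bar>ht (s, t)\<bar> \<le> 2 * (A * exp (- r * s)) / (b - a) + K * exp (- r2 * s) * (b - a)"
      using sub s
      by (intro derivative_interpolation_bound[where \<phi> = "\<lambda>t. h (s, t)" and \<psi> = "\<lambda>t. ht (s, t)"
            and \<omega> = "\<lambda>t. htt (s, t)"] ab A K
          has_vector_derivative_within_subset[OF has_partialsD(2)[OF h]]
          has_vector_derivative_within_subset[OF has_partialsD(2)[OF ht]]) auto
    then show "norm (ht (s, t)) \<le> (2 * A + K) * exp (- ((r + r2) / 2) * s)"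
      unfolding ab(2) \<eta>_def interpolation_exponents by simp
  qed
qed

lemma decays_interpolation_s:
  fixes h :: "R2 \<Rightarrow> real"
  assumes h: "has_partials c h hs ht" and hs: "has_partials c hs hss hst"
    and dec: "decays c r h" "decays c r2 hss" and r: "0 \<le> r2" "r2 \<le> r" and c: "0 \<le> c"
  shows "decays c ((r + r2) / 2) hs"
proof -
  obtain A where A: "0 < A" "\<And>s t. c < s \<Longrightarrow> t \<in> {0..1} \<Longrightarrow> \<bar>h (s, t)\<bar> \<le> A * exp (- r * s)"
    using dec(1) by (rule decaysE) auto
  obtain K where K: "0 < K" "\<And>s t. c < s \<Longrightarrow> t \<in> {0..1} \<Longrightarrow> \<bar>hss (s, t)\<bar> \<le> K * exp (- r2 * s)"
    using dec(2) by (rule decaysE) auto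
  show ?thesis
  proof (rule decaysI)
    fix s t :: real assume s: "c < s" and t: "t \<in> {0..1}"
    define \<eta> where "\<eta> = exp (- ((r - r2) / 2) * s)"
    have \<eta>: "0 < \<eta>" by (simp add: \<eta>_def)
    have "\<bar>hs (s, t)\<bar> \<le> 2 * (A * exp (- r * s)) / (s + \<eta> - s) + K * exp (- r2 * s) * (s + \<eta> - s)"
    proof (rule derivative_interpolation_bound[where \<phi> = "\<lambda>s. h (s, t)" and \<psi> = "\<lambda>s. hs (s, t)"
            and \<omega> = "\<lambda>s. hss (s, t)"])
      fix x assume x: "x \<in> {s..s + \<eta>}"
      then have xc: "c < x" using s by auto
      show "((\<lambda>s. h (s, t)) has_vector_derivative hs (x, t)) (at x within {s..s + \<eta>})"
        by (rule has_vector_derivative_at_within[OF has_partialsD(1)[OF h xc t]])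
      show "((\<lambda>s. hs (s, t)) has_vector_derivative hss (x, t)) (at x within {s..s + \<eta>})"
        by (rule has_vector_derivative_at_within[OF has_partialsD(1)[OF hs xc t]])
      have "A * exp (- r * x) \<le> A * exp (- r * s)" "K * exp (- r2 * x) \<le> K * exp (- r2 * s)"
        using x r A(1) K(1) by (auto intro!: mult_left_mono)
      then show "\<bar>h (x, t)\<bar> \<le> A * exp (- r * s)" "\<bar>hss (x, t)\<bar> \<le> K * exp (- r2 * s)"
        using A(2)[OF xc t] K(2)[OF xc t] by auto
    qed (use \<eta> in auto)
    then show "norm (hs (s, t)) \<le> (2 * A + K) * exp (- ((r + r2) / 2) * s)"
      unfolding add_diff_cancel_left' \<eta>_def interpolation_exponents by simp
  qed
qed

text \<open>
  Read \<open>P k r\<close> as ``the \<open>k\<close>-th derivative decays at rate \<open>r\<close>''. Midpoint concavity of the rates in \<open>k\<close>,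
  together with nonnegativity for all \<open>k\<close>, forbids any drop: a concave sequence that is
  bounded below is nondecreasing. Since only approximate rates are available, one first
  derives for the derivative of a function with rate \<open>r\<close> the rates \<open>r n/(n+2)\<close>,
  by induction on \<open>n\<close>: applying the hypothesis twice gives the second derivative the rate \<open>r x\<^sup>2\<close>, where
  \<open>x = n/(n+2)\<close>, and the step improves the rate of the first derivative to \<open>r (1 + x\<^sup>2)/2\<close>.
\<close>
lemma interpolated_rates:
  fixes P :: "nat \<Rightarrow> real \<Rightarrow> bool"
  assumes mono: "\<And>k r r'. P k r \<Longrightarrow> r' \<le> r \<Longrightarrow> P k r'" and zero: "\<And>k. P k 0"
    and step: "\<And>k r r2. P k r \<Longrightarrow> P (Suc (Suc k)) r2 \<Longrightarrow> 0 \<le> r2 \<Longrightarrow> r2 \<le> r \<Longrightarrow> P (Suc k) ((r + r2) / 2)"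
    and start: "P 0 R" and R: "0 < R"
  shows "P k (R / 2)"
proof -
  have approx: "P (Suc k) (r * (real n / (real n + 2)))" if "P k r" "0 \<le> r" for k r and n :: nat
    using that
  proof (induction n arbitrary: k r)
    case 0
    show ?case by (simp add: zero)
  next
    case (Suc n)
    define x where "x = real n / (real n + 2)"
    have x: "0 \<le> x" "x \<le> 1" by (auto simp: x_def)
    have "P (Suc k) (r * x)" unfolding x_def by (rule Suc.IH) fact+
    then have "P (Suc (Suc k)) (r * x * x)"
      using Suc.prems x unfolding x_def by (intro Suc.IH) auto
    moreover have "r * x * x \<le> r"
      using x Suc.prems mult_left_mono[of "x * x" 1 r] mult_le_one[of x x] by (simp add: mult.assoc)
    ultimately have "P (Suc k) ((r + r * x * x) / 2)"
      using Suc.prems x by (intro step) auto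
    moreover have "r * (real (Suc n) / (real (Suc n) + 2)) \<le> (r + r * x * x) / 2"
    proof -
      have "(1 + x * x) / 2 - real (Suc n) / (real (Suc n) + 2) = 2 / ((real n + 2) * (n + 2) * (n + 3))"
      proof -
        have "real n + 2 \<noteq> 0" "real n + 3 \<noteq> 0" by linarith+
        then show ?thesis by (simp add: x_def divide_simps) (simp add: algebra_simps)
      qed
      moreover have "0 \<le> 2 / ((real n + 2) * (n + 2) * (n + 3))" by simp
      ultimately have "real (Suc n) / (real (Suc n) + 2) \<le> (1 + x * x) / 2" by linarith
      then have "r * (real (Suc n) / (real (Suc n) + 2)) \<le> r * ((1 + x * x) / 2)"
        using Suc.prems by (intro mult_left_mono) auto
      then show ?thesis by (simp add: algebra_simps)
    qed
    ultimately show ?case by (rule mono)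
  qed
  have "\<forall>r<R. P k r" for k
  proof (induction k)
    case 0
    show ?case using mono[OF start] by auto
  next
    case (Suc k)
    show ?case
    proof (intro allI impI)
      fix r assume "r < R"
      show "P (Suc k) r"
      proof (cases "r \<le> 0")
        case True
        then show ?thesis by (rule mono[OF zero])
      next
        case False
        define r1 where "r1 = (r + R) / 2"
        have r1: "r < r1" "r1 < R" "0 < r1" using \<open>r < R\<close> False by (auto simp: r1_def)
        have "(\<lambda>n. real n / (real n + 2)) \<longlonglongrightarrow> 1" by real_asymp
        then have "(\<lambda>n. r1 * (real n / (real n + 2))) \<longlonglongrightarrow> r1 * 1"
          by (intro tendsto_mult tendsto_const)
        then have "\<forall>\<^sub>F n in sequentially. r < r1 * (real n / (real n + 2))"
          using r1 by (auto dest!: order_tendstoD(1))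
        then obtain n where n: "r < r1 * (real n / (real n + 2))"
          by (auto simp: eventually_sequentially)
        have "P (Suc k) (r1 * (real n / (real n + 2)))"
          using Suc r1 by (intro approx) auto
        then show ?thesis using n by (auto intro: mono)
      qed
    qed
  qed
  then show ?thesis using R by simp
qed

text \<open>
  Interpolation in \<open>t\<close> covers the real parts. As \<open>Im (P (k+1))\<close> is the \<open>s\<close>-derivative of \<open>Re (P k)\<close>,
  one interpolation in \<open>s\<close> covers the imaginary parts; only \<open>Im (P 0)\<close>, which is determined
  by the real part up to a constant, is excluded.
\<close>
lemma cr_jet_decay:
  assumes P: "cr_jet c P" and c: "0 \<le> c" and dec: "decays c R (\<lambda>z. Re (P 0 z))" and R: "0 < R"
  shows "decays c (R / 2) (\<lambda>z. Re (P k z))" "decays c (R / 2) (\<lambda>z. Im (P (Suc k) z))"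
proof -
  have Re_partials: "has_partials c (\<lambda>z. Re (P k z)) (\<lambda>z. Im (P (Suc k) z)) (\<lambda>z. Re (P (Suc k) z))" for k
    using has_partials_linear[OF bounded_linear_Re cr_jetD(3)[OF P, of k]] by simp
  have Im_partials: "has_partials c (\<lambda>z. Im (P k z)) (\<lambda>z. - Re (P (Suc k) z)) (\<lambda>z. Im (P (Suc k) z))" for k
    using has_partials_linear[OF bounded_linear_Im cr_jetD(3)[OF P, of k]] by simp
  have *: "decays c (R / 2) (\<lambda>z. Re (P k z))" for k
  proof (rule interpolated_rates[where P = "\<lambda>k r. decays c r (\<lambda>z. Re (P k z))"])
    show "decays c 0 (\<lambda>z. Re (P k z))" for k
      by (rule decays_le[OF cr_jetD(2)[OF P, of k], where B = 1]) (simp add: abs_Re_le_cmod)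
  next
    fix k r r2
    assume "decays c r (\<lambda>z. Re (P k z))" "decays c r2 (\<lambda>z. Re (P (Suc (Suc k)) z))" "r2 \<le> r"
    then show "decays c ((r + r2) / 2) (\<lambda>z. Re (P (Suc k) z))"
      by (rule decays_interpolation_t[OF Re_partials Re_partials _ _ _ c])
  qed (use decays_mono dec R in auto)
  then show "decays c (R / 2) (\<lambda>z. Re (P k z))" .
  have "decays c (R / 2) (\<lambda>z. - Re (P (Suc (Suc k)) z))"
    by (rule decays_le[OF *[of "Suc (Suc k)"], where B = 1]) simp
  from decays_interpolation_s[OF Re_partials Im_partials *[of k] this _ _ c] R
  show "decays c (R / 2) (\<lambda>z. Im (P (Suc k) z))" by simp
qed

section \<open>Decay for two holomorphic functions with coupled boundary values\<close>

lemma decays_of_decaying_derivative: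
  fixes h :: "R2 \<Rightarrow> real"
  assumes h: "has_partials c h hs ht" and hs: "decays c r hs" and r: "0 < r"
    and lim: "\<And>t. t \<in> {0..1} \<Longrightarrow> ((\<lambda>s. h (s, t)) \<longlongrightarrow> l) at_top"
  shows "decays c r (\<lambda>z. h z - l)"
proof -
  obtain C where C: "\<And>s t. c < s \<Longrightarrow> t \<in> {0..1} \<Longrightarrow> \<bar>hs (s, t)\<bar> \<le> C * exp (- r * s)"
    using hs by (rule decaysE) auto
  show ?thesis
  proof (rule decaysI)
    fix s t :: real assume s: "c < s" and t: "t \<in> {0..1}"
    have "LIM s at_top. - r * s :> at_bot"
      by (rule filterlim_tendsto_neg_mult_at_bot[OF tendsto_const _ filterlim_ident]) (use r in simp)
    then have e: "((\<lambda>s. C / r * exp (- r * s)) \<longlongrightarrow> C / r * 0) at_top"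
      by (intro tendsto_mult tendsto_const filterlim_compose[OF exp_at_bot])
    have hl: "((\<lambda>s. h (s, t) - l) \<longlongrightarrow> l - l) at_top"
      by (intro tendsto_diff lim t tendsto_const)
    have h': "((\<lambda>s. h (s, t)) has_real_derivative hs (x, t)) (at x)" if "c < x" for x
      using has_partialsD(1)[OF h that t] by (simp add: has_real_derivative_iff_has_vector_derivative)
    have "0 \<le> C / r * exp (- r * s) + (h (s, t) - l)"
    proof (rule nonneg_of_nonincreasing_to_zero[OF _ _ s])
      show "((\<lambda>s. C / r * exp (- r * s) + (h (s, t) - l)) \<longlongrightarrow> 0) at_top"
        using tendsto_add[OF e hl] by simp
      fix x assume x: "c < x"
      have "((\<lambda>s. C / r * exp (- r * s) + (h (s, t) - l)) has_real_derivative
          hs (x, t) - C * exp (- r * x)) (at x)"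
        using r by (auto intro!: derivative_eq_intros h' x)
      then show "\<exists>d. ((\<lambda>s. C / r * exp (- r * s) + (h (s, t) - l)) has_real_derivative d) (at x) \<and> d \<le> 0"
        using C[OF x t] by (intro exI conjI) auto
    qed
    moreover have "0 \<le> C / r * exp (- r * s) - (h (s, t) - l)"
    proof (rule nonneg_of_nonincreasing_to_zero[OF _ _ s])
      show "((\<lambda>s. C / r * exp (- r * s) - (h (s, t) - l)) \<longlongrightarrow> 0) at_top"
        using tendsto_diff[OF e hl] by simp
      fix x assume x: "c < x"
      have "((\<lambda>s. C / r * exp (- r * s) - (h (s, t) - l)) has_real_derivative
          - hs (x, t) - C * exp (- r * x)) (at x)"
        using r by (auto intro!: derivative_eq_intros h' x)
      then show "\<exists>d. ((\<lambda>s. C / r * exp (- r * s) - (h (s, t) - l)) has_real_derivative d) (at x) \<and> d \<le> 0"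
        using C[OF x t] by (intro exI conjI) auto
    qed
    ultimately show "norm (h (s, t) - l) \<le> C / r * exp (- r * s)" by simp
  qed
qed

lemma decays_complexI:
  assumes "decays c r (\<lambda>z. Re (h z))" "decays c r (\<lambda>z. Im (h z))"
  shows "decays c r h"
proof -
  have "decays c r (\<lambda>z. complex_of_real (Re (h z)))" "decays c r (\<lambda>z. \<i> * complex_of_real (Im (h z)))"
    by (rule decays_le[OF assms(1), where B = 1], simp)
      (rule decays_le[OF assms(2), where B = 1], simp add: norm_mult)
  from decays_add[OF this] show ?thesis by (simp add: complex_eq[symmetric])
qed

text \<open>
  Here \<open>F = x + \<i>\<theta>\<close> and \<open>G = g + \<i>y\<close>. The energy estimate is applied first to \<open>- \<i> G\<close>, whose real
  part is \<open>y\<close>, and then to \<open>R = F + \<i> q(\<theta>0) G\<close>, whose real part is \<open>x - q(\<theta>0) y\<close>.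
\<close>
lemma coupled_cauchy_riemann_decay:
  assumes F: "cr_jet c F" and G: "cr_jet c G" and c: "0 \<le> c"
    and bot: "\<And>s. c < s \<Longrightarrow> Re (F 0 (s, 0)) = 0" "\<And>s. c < s \<Longrightarrow> Im (G 0 (s, 0)) = 0"
    and top: "\<And>s. c < s \<Longrightarrow> Re (G 0 (s, 1)) = - (Re (F 0 (s, 1)))\<^sup>2 / 2"
      "\<And>s. c < s \<Longrightarrow> Re (F 0 (s, 1)) = q (Im (F 0 (s, 1))) * Im (G 0 (s, 1))"
    and q: "isCont q \<theta>0"
    and lim: "uniform_limit {0..1} (\<lambda>s t. F 0 (s, t)) (\<lambda>_. \<i> * complex_of_real \<theta>0) at_top"
      "uniform_limit {0..1} (\<lambda>s t. G 0 (s, t)) (\<lambda>_. 0) at_top"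
      "uniform_limit {0..1} (\<lambda>s t. F 1 (s, t)) (\<lambda>_. 0) at_top"
  shows "\<exists>\<rho>>0. \<exists>c'\<ge>c. decays c' \<rho> (\<lambda>z. F 0 z - \<i> * complex_of_real \<theta>0) \<and>
    (\<forall>k. decays c' \<rho> (F (Suc k))) \<and> (\<forall>k. decays c' \<rho> (G k))"
proof -
  define q0 where "q0 = q \<theta>0"
  define Q where "Q = \<bar>q0\<bar> + 1"
  have Q: "0 < Q" by (simp add: Q_def)
  have one: "(1::real) \<in> {0..1}" by simp
  have lim_pt: "((\<lambda>s. F 0 (s, t)) \<longlongrightarrow> \<i> * complex_of_real \<theta>0) at_top"
    "((\<lambda>s. G 0 (s, t)) \<longlongrightarrow> 0) at_top" if "t \<in> {0..1}" for t
    using tendsto_uniform_limitI[OF lim(1) that] tendsto_uniform_limitI[OF lim(2) that] by auto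
  have "((\<lambda>s. q (Im (F 0 (s, 1)))) \<longlongrightarrow> q \<theta>0) at_top"
    using tendsto_Im[OF lim_pt(1)[OF one]] by (intro isCont_tendsto_compose[OF q]) simp
  then have "\<forall>\<^sub>F s in at_top. dist (q (Im (F 0 (s, 1)))) q0 < 1"
    unfolding q0_def by (rule tendstoD) simp
  moreover have "\<forall>\<^sub>F s in at_top. \<forall>t\<in>{0..1}. dist (F 1 (s, t)) 0 < 1 / (2 * Q)"
    using Q by (intro uniform_limitD[OF lim(3)]) simp
  ultimately have "\<forall>\<^sub>F s in at_top. \<bar>q (Im (F 0 (s, 1)))\<bar> \<le> Q \<and> cmod (F 1 (s, 1)) \<le> 1 / (2 * Q)"
  proof eventually_elim
    case (elim s)
    then have "cmod (F 1 (s, 1)) < 1 / (2 * Q)" by simp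
    with elim(1) show ?case by (auto simp: Q_def dist_real_def)
  qed
  then obtain c0 where c0:
    "\<And>s. c0 \<le> s \<Longrightarrow> \<bar>q (Im (F 0 (s, 1)))\<bar> \<le> Q \<and> cmod (F 1 (s, 1)) \<le> 1 / (2 * Q)"
    by (auto simp: eventually_at_top_linorder)
  define c1 where "c1 = max c c0"
  have c1: "c \<le> c1" "0 \<le> c1" using c by (auto simp: c1_def)
  have qQ: "\<bar>q (Im (F 0 (s, 1)))\<bar> \<le> Q" and F1: "\<bar>Im (F 1 (s, 1))\<bar> \<le> 1 / (2 * Q)" if "c1 < s" for s
    using c0[of s] that abs_Im_le_cmod[of "F 1 (s, 1)"] by (auto simp: c1_def)

  \<comment> \<open>A linear combination of jets, so that \<open>cr_jet_lincomb\<close> applies.\<close>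
  define P where "P = (\<lambda>k z. - \<i> * G k z + 0 * G k z)"
  have P: "cr_jet c1 P"
    unfolding P_def by (intro cr_jet_restrict[OF _ c1(1)] cr_jet_lincomb G)
  have ReP: "Re (P k z) = Im (G k z)" and ImP: "Im (P k z) = - Re (G k z)" for k z
    by (simp_all add: P_def)
  have G_partials: "has_partials c1 (\<lambda>z. Re (G 0 z)) (\<lambda>z. Im (G 1 z)) (\<lambda>z. Re (G 1 z))"
    "has_partials c1 (\<lambda>z. Im (G 0 z)) (\<lambda>z. - Re (G 1 z)) (\<lambda>z. Im (G 1 z))"
    using has_partials_restrict[OF has_partials_linear[OF bounded_linear_Re cr_jetD(3)[OF G, of 0]] c1(1)]
      has_partials_restrict[OF has_partials_linear[OF bounded_linear_Im cr_jetD(3)[OF G, of 0]] c1(1)]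
    by auto
  have F_partials: "has_partials c1 (\<lambda>z. Re (F 0 z)) (\<lambda>z. Im (F 1 z)) (\<lambda>z. Re (F 1 z))"
    using has_partials_restrict[OF has_partials_linear[OF bounded_linear_Re cr_jetD(3)[OF F, of 0]] c1(1)]
    by auto
  \<comment> \<open>Differentiating \<open>g = - x\<^sup>2/2\<close> along \<open>t = 1\<close> gives \<open>y_t = g_s = - x x_s\<close>. Hence
      \<open>y y_t = - q(\<theta>) x_s y\<^sup>2\<close>, where \<open>\<bar>q(\<theta>) x_s\<bar> \<le> 1/2\<close> for large \<open>s\<close>.\<close>
  have "decays (c1 + 1) (1 / 2 / 4) (\<lambda>z. Re (P 0 z))"
  proof (rule dirichlet_energy_decay[OF P, where C = 0])
    show "Re (P 0 (s, 0)) = 0" if "c1 < s" for s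
      using bot(2)[of s] that c1 by (simp add: ReP)
    show "uniform_limit {0..1} (\<lambda>s t. Re (P 0 (s, t))) (\<lambda>_. 0) at_top"
      unfolding ReP using bounded_linear.uniform_limit[OF bounded_linear_Im lim(2)] by simp
    fix s assume s: "c1 < s"
    have s': "((\<lambda>s. Re (G 0 (s, 1))) has_real_derivative Im (G 1 (s, 1))) (at s)"
      using has_partialsD(1)[OF G_partials(1) s one]
      by (simp add: has_real_derivative_iff_has_vector_derivative)
    have "((\<lambda>s. Re (F 0 (s, 1))) has_real_derivative Im (F 1 (s, 1))) (at s)"
      using has_partialsD(1)[OF F_partials s one]
      by (simp add: has_real_derivative_iff_has_vector_derivative)
    from DERIV_cdivide[OF DERIV_power[OF this, of 2], of "-2"]
    have "((\<lambda>s. - (Re (F 0 (s, 1)))\<^sup>2 / 2) has_real_derivative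
        - Re (F 0 (s, 1)) * Im (F 1 (s, 1))) (at s)"
      by (simp add: mult.commute)
    then have "((\<lambda>s. Re (G 0 (s, 1))) has_real_derivative - Re (F 0 (s, 1)) * Im (F 1 (s, 1))) (at s)"
      by (rule has_field_derivative_transform_within_open[where S = "{c1<..}"])
        (use s c1 top(1) in auto)
    from DERIV_unique[OF s' this] have "Im (G 1 (s, 1)) = - Re (F 0 (s, 1)) * Im (F 1 (s, 1))" .
    also have "Re (F 0 (s, 1)) = q (Im (F 0 (s, 1))) * Im (G 0 (s, 1))"
      using s c1 by (intro top(2)) auto
    finally have "Im (G 0 (s, 1)) * Im (G 1 (s, 1)) =
        - (q (Im (F 0 (s, 1))) * Im (F 1 (s, 1)) * (Im (G 0 (s, 1)))\<^sup>2)"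
      by (simp add: power2_eq_square)
    also have "\<dots> \<le> \<bar>q (Im (F 0 (s, 1)))\<bar> * \<bar>Im (F 1 (s, 1))\<bar> * (Im (G 0 (s, 1)))\<^sup>2"
      using abs_ge_minus_self[of "q (Im (F 0 (s, 1))) * Im (F 1 (s, 1)) * (Im (G 0 (s, 1)))\<^sup>2"]
      by (simp add: abs_mult)
    also have "\<dots> \<le> Q * (1 / (2 * Q)) * (Im (G 0 (s, 1)))\<^sup>2"
      using Q by (intro mult_right_mono mult_mono qQ F1 s) auto
    also have "\<dots> = (Im (G 0 (s, 1)))\<^sup>2 / 2" using Q by simp
    also have "\<dots> \<le> integral {0..1} (\<lambda>t. (Im (G 1 (s, t)))\<^sup>2 + (Re (G 1 (s, t)))\<^sup>2) / 2"
    proof (rule divide_right_mono)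
      have sl: "continuous_on {0..1} (\<lambda>t. G 1 (s, t))"
        using s c1 by (intro continuous_on_half_strip_slices(1)[OF cr_jetD(1)[OF G]]) auto
      have "(Im (G 0 (s, 1)))\<^sup>2 \<le> integral {0..1} (\<lambda>t. (Im (G 1 (s, t)))\<^sup>2)"
        using s c1 bot(2)[of s] has_partialsD(2)[OF G_partials(2) s]
        by (intro square_le_integral_derivative_square[where h = "\<lambda>t. Im (G 0 (s, t))"]
            continuous_intros sl) auto
      also have "\<dots> \<le> integral {0..1} (\<lambda>t. (Im (G 1 (s, t)))\<^sup>2 + (Re (G 1 (s, t)))\<^sup>2)"
        by (intro integral_le integrable_continuous_real continuous_intros sl) auto
      finally show "(Im (G 0 (s, 1)))\<^sup>2 \<le>
          integral {0..1} (\<lambda>t. (Im (G 1 (s, t)))\<^sup>2 + (Re (G 1 (s, t)))\<^sup>2)" .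
    qed simp
    finally show "Re (P 0 (s, 1)) * Re (P 1 (s, 1)) \<le>
        integral {0..1} (\<lambda>t. (Re (P 1 (s, t)))\<^sup>2 + (Im (P 1 (s, t)))\<^sup>2) / 2 + 0 * exp (- (1 / 2) * s)"
      by (simp add: ReP ImP)
  qed auto
  define c2 where "c2 = c1 + 1"
  have c2: "c1 \<le> c2" "c \<le> c2" "0 \<le> c2" using c1 by (auto simp: c2_def)
  from \<open>decays (c1 + 1) _ _\<close> have y: "decays c2 (1 / 8) (\<lambda>z. Re (P 0 z))" by (simp add: c2_def)
  note decP = cr_jet_decay[OF cr_jet_restrict[OF P c2(1)] c2(3) y]
  have ImG: "decays c2 (1 / 16) (\<lambda>z. Im (G k z))" for k
    using decP(1)[of k] by (simp add: ReP)
  have ReG: "decays c2 (1 / 16) (\<lambda>z. Re (G (Suc k) z))" for k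
    using decP(2)[of k] by (auto simp: ImP elim: decays_le[where B = 1])
  have "decays c2 (1 / 16) (\<lambda>z. Re (G 0 z) - 0)"
    using tendsto_Re[OF lim_pt(2)]
    by (intro decays_of_decaying_derivative[OF has_partials_restrict[OF G_partials(1) c2(1)] ImG])
      simp_all
  then have decG: "decays c2 (1 / 16) (G k)" for k
    by (cases k) (auto intro!: decays_complexI ImG ReG)

  define R where "R = (\<lambda>k z. 1 * F k z + \<i> * complex_of_real q0 * G k z)"
  have R: "cr_jet c2 R"
    unfolding R_def by (intro cr_jet_restrict[OF _ c2(2)] cr_jet_lincomb F G)
  have ReR: "Re (R k z) = Re (F k z) - q0 * Im (G k z)" and
    ImR: "Im (R k z) = Im (F k z) + q0 * Re (G k z)" for k z
    by (simp_all add: R_def)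
  obtain B where B: "0 < B" "\<And>s t. c2 < s \<Longrightarrow> t \<in> {0..1} \<Longrightarrow> cmod (R 1 (s, t)) \<le> B"
    using cr_jetD(2)[OF R, of 1] by (rule decaysE) auto
  obtain Y where Y: "0 < Y" "\<And>s t. c2 < s \<Longrightarrow> t \<in> {0..1} \<Longrightarrow> \<bar>Im (G 0 (s, t))\<bar> \<le> Y * exp (- (1 / 16) * s)"
    using ImG[of 0] by (rule decaysE) auto
  \<comment> \<open>On \<open>t = 1\<close> the real part is \<open>(q(\<theta>) - q0) y\<close>, which is \<open>O(e^{-s/16})\<close>, while its
      \<open>t\<close>-derivative is bounded.\<close>
  have "decays (c2 + 1) (1 / 16 / 4) (\<lambda>z. Re (R 0 z))"
  proof (rule dirichlet_energy_decay[OF R, where C = "2 * Q * Y * B"])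
    show "Re (R 0 (s, 0)) = 0" if "c2 < s" for s
      using bot[of s] that c2 by (simp add: ReR)
    show "uniform_limit {0..1} (\<lambda>s t. Re (R 0 (s, t))) (\<lambda>_. 0) at_top"
    proof -
      have "uniform_limit {0..1} (\<lambda>s t. Re (F 0 (s, t)) - q0 * Im (G 0 (s, t)))
          (\<lambda>_. Re (\<i> * complex_of_real \<theta>0) - q0 * Im 0) at_top"
        by (intro uniform_limit_minus bounded_linear.uniform_limit[OF bounded_linear_Re lim(1)]
            bounded_linear.uniform_limit[OF bounded_linear_mult_right]
            bounded_linear.uniform_limit[OF bounded_linear_Im lim(2)])
      then show ?thesis by (simp add: ReR)
    qed
    fix s assume s: "c2 < s"
    have "Re (R 0 (s, 1)) = (q (Im (F 0 (s, 1))) - q0) * Im (G 0 (s, 1))"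
      using top(2)[of s] s c2 by (simp add: ReR left_diff_distrib)
    moreover have "\<bar>q (Im (F 0 (s, 1))) - q0\<bar> \<le> 2 * Q"
      using qQ[of s] s c2 by (simp add: Q_def)
    ultimately have "\<bar>Re (R 0 (s, 1))\<bar> \<le> 2 * Q * (Y * exp (- (1 / 16) * s))"
      using Y(2)[OF s one] Q by (simp only: abs_mult) (intro mult_mono, auto)
    then have "\<bar>Re (R 0 (s, 1))\<bar> * \<bar>Re (R 1 (s, 1))\<bar> \<le> 2 * Q * (Y * exp (- (1 / 16) * s)) * B"
      using B(2)[OF s one] abs_Re_le_cmod[of "R 1 (s, 1)"] Q Y by (intro mult_mono) auto
    moreover have "0 \<le> integral {0..1} (\<lambda>t. (Re (R 1 (s, t)))\<^sup>2 + (Im (R 1 (s, t)))\<^sup>2)"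
    proof -
      have "continuous_on {0..1} (\<lambda>t. R 1 (s, t))"
        by (rule continuous_on_half_strip_slices(1)[OF cr_jetD(1)[OF R] s])
      then show ?thesis
        by (intro integral_nonneg integrable_continuous_real continuous_intros) auto
    qed
    ultimately show "Re (R 0 (s, 1)) * Re (R 1 (s, 1)) \<le>
        integral {0..1} (\<lambda>t. (Re (R 1 (s, t)))\<^sup>2 + (Im (R 1 (s, t)))\<^sup>2) / 2 +
        2 * Q * Y * B * exp (- (1 / 16) * s)"
      using abs_ge_self[of "Re (R 0 (s, 1)) * Re (R 1 (s, 1))"]
      by (simp add: abs_mult mult.assoc mult.left_commute mult.commute[of B])
  qed (use Q Y B in auto)
  define c3 where "c3 = c2 + 1"
  have c3: "c2 \<le> c3" "c \<le> c3" "0 \<le> c3" using c2 by (auto simp: c3_def)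
  from \<open>decays (c2 + 1) _ _\<close> have x: "decays c3 (1 / 64) (\<lambda>z. Re (R 0 z))" by (simp add: c3_def)
  have R3: "cr_jet c3 R" by (rule cr_jet_restrict[OF R c3(1)])
  note decR = cr_jet_decay[OF R3 c3(3) x, simplified]
  \<comment> \<open>The kernel direction: \<open>Im R\<close> has a decaying \<open>s\<close>-derivative and tends to \<open>\<theta>0\<close>.\<close>
  have "decays c3 (1 / 128) (\<lambda>z. Im (R 0 z) - \<theta>0)"
  proof (rule decays_of_decaying_derivative)
    show "has_partials c3 (\<lambda>z. Im (R 0 z)) (\<lambda>z. - Re (R 1 z)) (\<lambda>z. Im (R 1 z))"
      using has_partials_linear[OF bounded_linear_Im cr_jetD(3)[OF R3, of 0]] by simp
    show "decays c3 (1 / 128) (\<lambda>z. - Re (R 1 z))"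
      using decR(1)[of 1] by (rule decays_le[where B = 1]) simp
    show "((\<lambda>s. Im (R 0 (s, t))) \<longlongrightarrow> \<theta>0) at_top" if "t \<in> {0..1}" for t
    proof -
      have "((\<lambda>s. Im (F 0 (s, t)) + q0 * Re (G 0 (s, t))) \<longlongrightarrow>
          Im (\<i> * complex_of_real \<theta>0) + q0 * Re 0) at_top"
        by (intro tendsto_intros lim_pt that)
      then show ?thesis by (simp add: ImR)
    qed
  qed simp
  then have R0: "decays c3 (1 / 128) (\<lambda>z. R 0 z - \<i> * complex_of_real \<theta>0)"
    using decR(1)[of 0] by (intro decays_complexI) simp_all
  have Rk: "decays c3 (1 / 128) (R (Suc k))" for k
    by (rule decays_complexI) (use decR in auto)
  have G3: "decays c3 (1 / 128) (\<lambda>z. - \<i> * complex_of_real q0 * G k z)" for k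
    by (rule decays_le[OF decays_mono[OF decays_restrict[OF decG[of k] c3(1)]], where B = "\<bar>q0\<bar>"])
      (simp_all add: norm_mult)
  have "decays c3 (1 / 128) (\<lambda>z. F 0 z - \<i> * complex_of_real \<theta>0)"
    using decays_add[OF R0 G3[of 0]] by (simp add: R_def)
  moreover have "decays c3 (1 / 128) (F (Suc k))" for k
    using decays_add[OF Rk[of k] G3[of "Suc k"]] by (simp add: R_def)
  moreover have "decays c3 (1 / 128) (G k)" for k
    by (rule decays_mono[OF decays_restrict[OF decG c3(1)]]) simp
  ultimately show ?thesis
    using c3(2) by (intro exI[where x = "1/128"] exI[where x = c3] conjI) auto
qed

section \<open>Decay of all partial derivatives\<close>

text \<open>
  All partial derivatives of order at most \<open>n\<close>, in any sequence of directions, exist and are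
  \<open>O(e^{-rs})\<close>.
\<close>
fun Ck_decays :: "nat \<Rightarrow> real \<Rightarrow> real \<Rightarrow> (R2 \<Rightarrow> 'b::real_normed_vector) \<Rightarrow> bool" where
  "Ck_decays 0 c r h \<longleftrightarrow> decays c r h"
| "Ck_decays (Suc n) c r h \<longleftrightarrow> decays c r h \<and>
     (\<exists>hs ht. has_partials c h hs ht \<and> Ck_decays n c r hs \<and> Ck_decays n c r ht)"

lemma Ck_decays_SucI:
  "decays c r h \<Longrightarrow> has_partials c h hs ht \<Longrightarrow> Ck_decays n c r hs \<Longrightarrow> Ck_decays n c r ht \<Longrightarrow>
    Ck_decays (Suc n) c r h"
  by auto

lemma Ck_decays_SucE:
  assumes "Ck_decays (Suc n) c r h"
  obtains hs ht where "has_partials c h hs ht" "Ck_decays n c r hs" "Ck_decays n c r ht"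
  using assms by auto

lemma Ck_decays_0: "Ck_decays n c r h \<Longrightarrow> decays c r h"
  by (cases n) auto

lemma Ck_decays_SucD: "Ck_decays (Suc n) c r h \<Longrightarrow> Ck_decays n c r h"
proof (induction n arbitrary: h)
  case (Suc n)
  obtain hs ht where "has_partials c h hs ht" "Ck_decays (Suc n) c r hs" "Ck_decays (Suc n) c r ht"
    using Suc.prems by (rule Ck_decays_SucE)
  then show ?case
    using Suc.IH Ck_decays_0[OF Suc.prems] by (intro Ck_decays_SucI[of c r h hs ht]) blast+
qed auto

lemma Ck_decays_mono: "Ck_decays n c r h \<Longrightarrow> r' \<le> r \<Longrightarrow> Ck_decays n c r' h"
  by (induction n arbitrary: h) (auto intro: decays_mono)

lemma decays_linear:
  assumes "bounded_linear T" "decays c r h"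
  shows "decays c r (\<lambda>z. T (h z))"
proof -
  obtain B where "\<And>x. norm (T x) \<le> norm x * B" using bounded_linear.bounded[OF assms(1)] by blast
  then show ?thesis
    by (auto intro!: decays_le[OF assms(2), where B = B] simp: mult.commute)
qed

lemma Ck_decays_linear:
  assumes T: "bounded_linear T"
  shows "Ck_decays n c r h \<Longrightarrow> Ck_decays n c r (\<lambda>z. T (h z))"
proof (induction n arbitrary: h)
  case 0
  then show ?case using decays_linear[OF T] by simp
next
  case (Suc n)
  obtain hs ht where h: "has_partials c h hs ht" "Ck_decays n c r hs" "Ck_decays n c r ht"
    using Suc.prems by (rule Ck_decays_SucE)
  show ?case
    by (rule Ck_decays_SucI[OF decays_linear[OF T Ck_decays_0[OF Suc.prems]]
          has_partials_linear[OF T h(1)] Suc.IH[OF h(2)] Suc.IH[OF h(3)]])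
qed

lemma Ck_decays_add:
  "Ck_decays n c r f \<Longrightarrow> Ck_decays n c r h \<Longrightarrow> Ck_decays n c r (\<lambda>z. f z + h z)"
proof (induction n arbitrary: f h)
  case (Suc n)
  obtain fs ft where f: "has_partials c f fs ft" "Ck_decays n c r fs" "Ck_decays n c r ft"
    using Suc.prems(1) by (rule Ck_decays_SucE)
  obtain hs ht where h: "has_partials c h hs ht" "Ck_decays n c r hs" "Ck_decays n c r ht"
    using Suc.prems(2) by (rule Ck_decays_SucE)
  show ?case
    by (rule Ck_decays_SucI[OF decays_add[OF Suc.prems[THEN Ck_decays_0]] has_partials_add[OF f(1) h(1)]])
      (intro Suc.IH f h)+
qed (auto intro: decays_add)

lemma Ck_decays_mult:
  fixes f h :: "R2 \<Rightarrow> 'b::real_normed_algebra"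
  shows "Ck_decays n c r f \<Longrightarrow> Ck_decays n c r' h \<Longrightarrow> Ck_decays n c (r + r') (\<lambda>z. f z * h z)"
proof (induction n arbitrary: f h)
  case (Suc n)
  obtain fs ft where f: "has_partials c f fs ft" "Ck_decays n c r fs" "Ck_decays n c r ft"
    using Suc.prems(1) by (rule Ck_decays_SucE)
  obtain hs ht where h: "has_partials c h hs ht" "Ck_decays n c r' hs" "Ck_decays n c r' ht"
    using Suc.prems(2) by (rule Ck_decays_SucE)
  note fh = Ck_decays_SucD[OF Suc.prems(1)] Ck_decays_SucD[OF Suc.prems(2)]
  show ?case
    by (rule Ck_decays_SucI[OF decays_mult[OF Suc.prems[THEN Ck_decays_0]] has_partials_mult[OF f(1) h(1)]])
      (intro Ck_decays_add Suc.IH f h fh)+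
qed (auto intro: decays_mult)

lemma Ck_decays_const: "Ck_decays n c 0 (\<lambda>z. a)"
proof (induction n arbitrary: a)
  case (Suc n)
  have "has_partials c (\<lambda>z. a) (\<lambda>z. 0) (\<lambda>z. 0)" by (simp add: has_partials_def)
  then show ?case by (rule Ck_decays_SucI[OF decays_const _ Suc Suc])
qed (simp add: decays_const)

lemma Ck_decays_Pair:
  fixes f :: "R2 \<Rightarrow> 'a::real_normed_vector" and h :: "R2 \<Rightarrow> 'b::real_normed_vector"
  assumes "Ck_decays n c r f" "Ck_decays n c r h"
  shows "Ck_decays n c r (\<lambda>z. (f z, h z))"
proof -
  note assms
  moreover have "bounded_linear (\<lambda>x::'a. (x, 0::'b))" "bounded_linear (\<lambda>x::'b. (0::'a, x))"
    by (intro bounded_linear_Pair bounded_linear_ident bounded_linear_zero)+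
  ultimately have "Ck_decays n c r (\<lambda>z. (f z, 0::'b))" "Ck_decays n c r (\<lambda>z. (0::'a, h z))"
    using Ck_decays_linear by blast+
  from Ck_decays_add[OF this] show ?thesis by simp
qed

text \<open>
  \<open>\<phi>\<close> is the sequence of derivatives of a smooth function; they are bounded on the
  compact range of \<open>h\<close>. The induction on \<open>n\<close> has to treat all \<open>\<phi> k\<close> at once.
\<close>
lemma Ck_decays_compose:
  fixes \<phi> :: "nat \<Rightarrow> real \<Rightarrow> real"
  assumes \<phi>: "\<And>k x. (\<phi> k has_real_derivative \<phi> (Suc k) x) (at x)"
    and range: "\<And>s t. c < s \<Longrightarrow> t \<in> {0..1} \<Longrightarrow> h (s, t) \<in> {lo..hi}"
  shows "Ck_decays n c 0 h \<Longrightarrow> Ck_decays n c 0 (\<lambda>z. \<phi> k (h z))"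
proof (induction n arbitrary: k)
  case 0
  show ?case using \<open>Ck_decays 0 c 0 h\<close>
  proof -
    have "continuous_on {lo..hi} (\<phi> k)"
      using \<phi> by (intro DERIV_continuous_on) (auto intro: has_field_derivative_at_within)
    then have "bounded (\<phi> k ` {lo..hi})"
      by (intro compact_imp_bounded compact_continuous_image) auto
    then obtain B where "\<forall>x\<in>{lo..hi}. norm (\<phi> k x) \<le> B" unfolding bounded_iff by auto
    then show ?thesis using range by (auto intro!: decaysI[where C = B])
  qed
next
  case (Suc n)
  obtain hs ht where h: "has_partials c h hs ht" "Ck_decays n c 0 hs" "Ck_decays n c 0 ht"
    using Suc.prems by (rule Ck_decays_SucE)
  have "has_partials c (\<lambda>z. \<phi> k (h z)) (\<lambda>z. hs z * \<phi> (Suc k) (h z)) (\<lambda>z. ht z * \<phi> (Suc k) (h z))"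
    unfolding has_partials_def
    using field_vector_diff_chain_within[OF has_partialsD(1)[OF h(1)] has_field_derivative_at_within[OF \<phi>]]
      field_vector_diff_chain_within[OF has_partialsD(2)[OF h(1)] has_field_derivative_at_within[OF \<phi>]]
    unfolding o_def by blast
  moreover have "Ck_decays n c (0 + 0) (\<lambda>z. hs z * \<phi> (Suc k) (h z))"
    "Ck_decays n c (0 + 0) (\<lambda>z. ht z * \<phi> (Suc k) (h z))"
    by (intro Ck_decays_mult h Suc.IH Ck_decays_SucD[OF Suc.prems])+
  moreover have "decays c 0 (\<lambda>z. \<phi> k (h z))"
    by (rule Ck_decays_0[OF Suc.IH[OF Ck_decays_SucD[OF Suc.prems]]])
  ultimately show ?case
    unfolding add_0_left by (rule Ck_decays_SucI[rotated])
qed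

lemma Ck_decays_inverse:
  fixes h :: "R2 \<Rightarrow> real"
  assumes \<beta>: "0 < \<beta>" "\<And>s t. c < s \<Longrightarrow> t \<in> {0..1} \<Longrightarrow> \<beta> \<le> \<bar>h (s, t)\<bar>"
  shows "Ck_decays n c 0 h \<Longrightarrow> Ck_decays n c 0 (\<lambda>z. inverse (h z))"
proof (induction n)
  case 0
  have "\<bar>inverse (h (s, t))\<bar> \<le> inverse \<beta>" if "c < s" "t \<in> {0..1}" for s t
    using le_imp_inverse_le[OF \<beta>(2)[OF that] \<beta>(1)] by simp
  then show ?case by (auto intro!: decaysI[where C = "inverse \<beta>"])
next
  case (Suc n)
  obtain hs ht where h: "has_partials c h hs ht" "Ck_decays n c 0 hs" "Ck_decays n c 0 ht"
    using Suc.prems by (rule Ck_decays_SucE)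
  have nz: "h (s, t) \<noteq> 0" if "c < s" "t \<in> {0..1}" for s t using \<beta>(2)[OF that] \<beta>(1) by auto
  have inv: "(inverse has_field_derivative - (inverse x * inverse x)) (at x within S)"
    if "x \<noteq> 0" for x :: real and S
    using DERIV_inverse[OF that, of S] by (simp add: power2_eq_square)
  have IH: "Ck_decays n c 0 (\<lambda>z. inverse (h z))"
    by (rule Suc.IH[OF Ck_decays_SucD[OF Suc.prems]])
  have "has_partials c (\<lambda>z. inverse (h z)) (\<lambda>z. hs z * - (inverse (h z) * inverse (h z)))
      (\<lambda>z. ht z * - (inverse (h z) * inverse (h z)))"
    unfolding has_partials_def
    using field_vector_diff_chain_within[OF has_partialsD(1)[OF h(1)] inv[OF nz]]
      field_vector_diff_chain_within[OF has_partialsD(2)[OF h(1)] inv[OF nz]]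
    unfolding o_def by blast
  moreover have "Ck_decays n c (0 + 0) (\<lambda>z. hs z * - (inverse (h z) * inverse (h z)))"
    "Ck_decays n c (0 + 0) (\<lambda>z. ht z * - (inverse (h z) * inverse (h z)))"
    using Ck_decays_linear[OF bounded_linear_minus[OF bounded_linear_ident] Ck_decays_mult[OF IH IH]]
    by (intro Ck_decays_mult h; simp)+
  ultimately show ?case
    unfolding add_0_left by (rule Ck_decays_SucI[OF Ck_decays_0[OF IH]])
qed

lemma Ck_decays_jet:
  assumes "\<And>k. has_partials c (P k) (\<lambda>z. - \<i> * P (Suc k) z) (P (Suc k))" "\<And>k. decays c r (P k)"
  shows "Ck_decays n c r (P k)"
proof (induction n arbitrary: k)
  case (Suc n)
  show ?case
    by (rule Ck_decays_SucI[OF assms(2,1) Ck_decays_linear[OF bounded_linear_mult_right Suc] Suc])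
qed (simp add: assms)

lemma has_partials_eqI:
  assumes h: "has_partials c h hs ht" and eq: "\<And>z. z \<in> half_strip c \<Longrightarrow> h' z = h z"
  shows "has_partials c h' hs ht"
  unfolding has_partials_def
proof (intro allI ballI impI conjI)
  fix s t :: real assume st: "c < s" "t \<in> {0..1}"
  show "((\<lambda>s'. h' (s', t)) has_vector_derivative hs (s, t)) (at s)"
    by (rule has_vector_derivative_transform_within_open[OF has_partialsD(1)[OF h st], where S = "{c<..}"])
      (use st eq in auto)
  show "((\<lambda>t'. h' (s, t')) has_vector_derivative ht (s, t)) (at t within {0..1})"
    by (rule has_vector_derivative_transform[OF _ _ has_partialsD(2)[OF h st]]) (use st eq in auto)
qed

lemma Ck_decays_cong:
  assumes "\<And>z. z \<in> half_strip c \<Longrightarrow> h' z = h z" "Ck_decays n c r h"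
  shows "Ck_decays n c r h'"
proof -
  have "decays c r h'"
    using Ck_decays_0[OF assms(2)] decays_cong[of c h' h r] assms(1) by simp
  moreover have "has_partials c h' hs ht" if "has_partials c h hs ht" for hs ht
    using that assms(1) by (rule has_partials_eqI)
  ultimately show ?thesis using assms(2) by (cases n) auto
qed

lemma pd_eq_partials:
  assumes h: "has_partials c h hs ht" and z: "z \<in> half_strip c"
  shows "pd_s h z = hs z" "pd_t h z = ht z"
proof -
  obtain s t where [simp]: "z = (s, t)" by force
  show "pd_s h z = hs z"
    using z by (auto simp: pd_s_def intro!: vector_derivative_at has_partialsD(1)[OF h])
  show "pd_t h z = ht z"
    using z has_partialsD(2)[OF h, of s t] vector_derivative_within_cbox[of 0 1 t]
    by (auto simp: pd_t_def)
qed

lemma Ck_decays_pd: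
  assumes "Ck_decays (Suc n) c r h"
  shows "Ck_decays n c r (pd_s h)" "Ck_decays n c r (pd_t h)"
proof -
  obtain hs ht where h: "has_partials c h hs ht" "Ck_decays n c r hs" "Ck_decays n c r ht"
    using assms by (rule Ck_decays_SucE)
  show "Ck_decays n c r (pd_s h)" "Ck_decays n c r (pd_t h)"
    by (rule Ck_decays_cong[OF pd_eq_partials(1)[OF h(1)] h(2)]
        Ck_decays_cong[OF pd_eq_partials(2)[OF h(1)] h(3)]; assumption)+
qed

lemma decays_iterated_pd:
  assumes "\<And>n. Ck_decays n c r h"
  shows "decays c r ((pd_s ^^ j) ((pd_t ^^ k) h))"
proof -
  have "Ck_decays n c r ((pd_t ^^ k) h)" for n
    using assms by (induction k arbitrary: n) (simp_all add: Ck_decays_pd del: Ck_decays.simps)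
  then have "Ck_decays n c r ((pd_s ^^ j) ((pd_t ^^ k) h))" for n
    by (induction j arbitrary: n) (simp_all add: Ck_decays_pd del: Ck_decays.simps)
  from this[of 0] show ?thesis by simp
qed

section \<open>Smooth strips and the reduction to holomorphic functions\<close>

text \<open>
  The partial derivatives are values of the Frechet derivative within \<open>T\<close> on the two unit vectors.
\<close>
lemma smooth_has_partials:
  assumes \<omega>: "smooth_on T \<omega>" and T: "half_strip c \<subseteq> T"
  shows "\<exists>\<omega>s \<omega>t. smooth_on T \<omega>s \<and> smooth_on T \<omega>t \<and> has_partials c \<omega> \<omega>s \<omega>t"
proof (intro exI conjI)
  have C: "Ck_on (Suc k) T \<omega>" for k using \<omega> unfolding smooth_on_def by blast
  show "smooth_on T (\<lambda>z. frechet_derivative \<omega> (at z within T) (1, 0))"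
    "smooth_on T (\<lambda>z. frechet_derivative \<omega> (at z within T) (0, 1))"
    using C by (auto simp: smooth_on_def)
  show "has_partials c \<omega> (\<lambda>z. frechet_derivative \<omega> (at z within T) (1, 0))
      (\<lambda>z. frechet_derivative \<omega> (at z within T) (0, 1))"
    unfolding has_partials_def
  proof (intro allI impI ballI conjI)
    fix s t :: real assume s: "c < s" and t: "t \<in> {0..1}"
    define D where "D = frechet_derivative \<omega> (at (s, t) within T)"
    have "(s, t) \<in> T" using s t T by (auto simp: half_strip_def)
    then have "\<omega> differentiable (at (s, t) within T)"
      using C[of 0] unfolding Ck_on.simps differentiable_on_def by blast
    then have D: "(\<omega> has_derivative D) (at (s, t) within T)"
      unfolding D_def using frechet_derivative_works by blast
    have lin: "D (x *\<^sub>R z) = x *\<^sub>R D z" for x z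
      using has_derivative_bounded_linear[OF D] by (rule bounded_linear.linear[THEN linear_scale])
    have "((\<lambda>s'. \<omega> (s', t)) has_derivative (\<lambda>x. D (x, 0))) (at s within {c<..})"
    proof (rule has_derivative_in_compose[where f = "\<lambda>s'. (s', t)"])
      show "((\<lambda>s'. (s', t)) has_derivative (\<lambda>x. (x, 0))) (at s within {c<..})"
        by (auto intro!: derivative_eq_intros)
      show "(\<omega> has_derivative D) (at (s, t) within (\<lambda>s'. (s', t)) ` {c<..})"
        by (rule has_derivative_subset[OF D]) (use T t in \<open>auto simp: half_strip_def\<close>)
    qed
    then have "((\<lambda>s'. \<omega> (s', t)) has_derivative (\<lambda>x. D (x, 0))) (at s)"
      using s by (simp add: at_within_open[of s "{c<..}"])
    moreover have "(\<lambda>x. D (x, 0)) = (\<lambda>x. x *\<^sub>R D (1, 0))"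
      using lin[of _ "(1, 0)", symmetric] by (simp add: fun_eq_iff)
    ultimately show "((\<lambda>s'. \<omega> (s', t)) has_vector_derivative
        frechet_derivative \<omega> (at (s, t) within T) (1, 0)) (at s)"
      unfolding has_vector_derivative_def D_def by simp
    have "((\<lambda>t'. \<omega> (s, t')) has_derivative (\<lambda>x. D (0, x))) (at t within {0..1})"
    proof (rule has_derivative_in_compose[where f = "\<lambda>t'. (s, t')"])
      show "((\<lambda>t'. (s, t')) has_derivative (\<lambda>x. (0, x))) (at t within {0..1})"
        by (auto intro!: derivative_eq_intros)
      show "(\<omega> has_derivative D) (at (s, t) within (\<lambda>t'. (s, t')) ` {0..1})"
        by (rule has_derivative_subset[OF D]) (use T s in \<open>auto simp: half_strip_def\<close>)
    qed
    moreover have "(\<lambda>x. D (0, x)) = (\<lambda>x. x *\<^sub>R D (0, 1))"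
      using lin[of _ "(0, 1)", symmetric] by (simp add: fun_eq_iff)
    ultimately show "((\<lambda>t'. \<omega> (s, t')) has_vector_derivative
        frechet_derivative \<omega> (at (s, t) within T) (0, 1)) (at t within {0..1})"
      unfolding has_vector_derivative_def D_def by simp
  qed
qed

lemma smooth_iterated_pd_t:
  assumes \<omega>: "smooth_on T \<omega>" and T: "half_strip c \<subseteq> T"
  shows "continuous_on (half_strip c) ((pd_t ^^ k) \<omega>)"
    and "has_partials c ((pd_t ^^ k) \<omega>) (pd_s ((pd_t ^^ k) \<omega>)) ((pd_t ^^ Suc k) \<omega>)"
proof -
  have "\<exists>\<omega>'. smooth_on T \<omega>' \<and> (\<forall>z\<in>half_strip c. (pd_t ^^ k) \<omega> z = \<omega>' z)"
  proof (induction k)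
    case 0
    show ?case using \<omega> by auto
  next
    case (Suc k)
    then obtain \<omega>' where \<omega>': "smooth_on T \<omega>'" "\<forall>z\<in>half_strip c. (pd_t ^^ k) \<omega> z = \<omega>' z" by blast
    obtain \<omega>s \<omega>t where t: "smooth_on T \<omega>t" "has_partials c \<omega>' \<omega>s \<omega>t"
      using smooth_has_partials[OF \<omega>'(1) T] by blast
    have "has_partials c ((pd_t ^^ k) \<omega>) \<omega>s \<omega>t"
      using \<omega>'(2) by (intro has_partials_eqI[OF t(2)]) simp
    then show ?case using t(1) pd_eq_partials(2) by fastforce
  qed
  then obtain \<omega>' where \<omega>': "smooth_on T \<omega>'" "\<And>z. z \<in> half_strip c \<Longrightarrow> (pd_t ^^ k) \<omega> z = \<omega>' z" by blast
  have "Ck_on 0 T \<omega>'" using \<omega>'(1) unfolding smooth_on_def by blast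
  then have "continuous_on (half_strip c) \<omega>'" using T by (auto intro: continuous_on_subset)
  then show "continuous_on (half_strip c) ((pd_t ^^ k) \<omega>)"
    by (rule continuous_on_eq) (simp add: \<omega>'(2))
  obtain \<omega>s \<omega>t where "has_partials c \<omega>' \<omega>s \<omega>t"
    using smooth_has_partials[OF \<omega>'(1) T] by blast
  then have p: "has_partials c ((pd_t ^^ k) \<omega>) \<omega>s \<omega>t"
    by (rule has_partials_eqI) (simp add: \<omega>'(2))
  show "has_partials c ((pd_t ^^ k) \<omega>) (pd_s ((pd_t ^^ k) \<omega>)) ((pd_t ^^ Suc k) \<omega>)"
    by (rule has_partials_cong[OF p]) (simp_all add: pd_eq_partials[OF p])
qed

text \<open>
  Near infinity the limit bounds \<open>h\<close>, and the rest is compact once the open end at \<open>s = c\<close> is cut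
  off. This gives one half-strip on which all members of a jet are bounded, although the
  uniform limits are attained at speeds that depend on the order.
\<close>
lemma decays_0_of_uniform_limit:
  fixes h :: "R2 \<Rightarrow> 'b::real_normed_vector"
  assumes cont: "continuous_on (half_strip c) h" and lim: "uniform_limit {0..1} (\<lambda>s t. h (s, t)) (\<lambda>_. l) at_top"
  shows "decays (c + 1) 0 h"
proof -
  have "\<forall>\<^sub>F s in at_top. \<forall>t\<in>{0..1}. dist (h (s, t)) l < 1"
    using uniform_limitD[OF lim, of 1] by simp
  then obtain s1 where s1: "\<And>s t. s1 \<le> s \<Longrightarrow> t \<in> {0..1} \<Longrightarrow> dist (h (s, t)) l < 1"
    unfolding eventually_at_top_linorder by blast
  have "compact ({c + 1..s1} \<times> {0..1::real})" by (intro compact_Times compact_Icc)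
  moreover have "continuous_on ({c + 1..s1} \<times> {0..1}) h"
    by (rule continuous_on_subset[OF cont]) (auto simp: half_strip_def)
  ultimately have "bounded (h ` ({c + 1..s1} \<times> {0..1}))"
    by (intro compact_imp_bounded compact_continuous_image)
  then obtain B where B: "\<forall>x\<in>h ` ({c + 1..s1} \<times> {0..1}). norm x \<le> B" unfolding bounded_iff by auto
  show ?thesis
  proof (rule decaysI[where C = "max B (norm l + 1)"])
    fix s t :: real assume st: "c + 1 < s" "t \<in> {0..1}"
    show "norm (h (s, t)) \<le> max B (norm l + 1) * exp (- 0 * s)"
    proof (cases "s \<le> s1")
      case True
      then show ?thesis using B st by (auto simp: le_max_iff_disj)
    next
      case False
      then show ?thesis
        using s1[of s t] st norm_triangle_sub[of "h (s, t)" l] by (simp add: dist_norm le_max_iff_disj)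
    qed
  qed
qed

definition t_jet :: "real \<Rightarrow> (nat \<Rightarrow> R2 \<Rightarrow> real) \<Rightarrow> bool" where
  "t_jet c h \<longleftrightarrow> (\<forall>k. continuous_on (half_strip c) (h k) \<and> decays c 0 (h k) \<and>
     (\<forall>s>c. \<forall>t\<in>{0..1}. ((\<lambda>t'. h k (s, t')) has_real_derivative h (Suc k) (s, t)) (at t within {0..1})))"

text \<open>
  For a jet \<open>h\<close> of \<open>t\<close>-derivatives, \<open>square_jet h k i j\<close> is the \<open>k\<close>-th \<open>t\<close>-derivative of \<open>h i * h j\<close>. The recursion is the product
  rule iterated, and avoids the binomial coefficients of the closed formula.
\<close>
fun square_jet :: "(nat \<Rightarrow> R2 \<Rightarrow> real) \<Rightarrow> nat \<Rightarrow> nat \<Rightarrow> nat \<Rightarrow> R2 \<Rightarrow> real" where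
  "square_jet h 0 i j z = h i z * h j z"
| "square_jet h (Suc k) i j z = square_jet h k (Suc i) j z + square_jet h k i (Suc j) z"

lemma t_jetD:
  assumes "t_jet c h"
  shows "continuous_on (half_strip c) (h k)" "decays c 0 (h k)"
    "c < s \<Longrightarrow> t \<in> {0..1} \<Longrightarrow> ((\<lambda>t'. h k (s, t')) has_real_derivative h (Suc k) (s, t)) (at t within {0..1})"
  using assms unfolding t_jet_def by blast+

lemma t_jet_square:
  assumes h: "t_jet c h"
  shows "t_jet c (\<lambda>k. square_jet h k i j)"
proof -
  have "continuous_on (half_strip c) (\<lambda>z. square_jet h k i j z)" for k i j
    by (induction k arbitrary: i j) (auto intro!: continuous_intros t_jetD[OF h])
  moreover have "decays c 0 (\<lambda>z. square_jet h k i j z)" for k i j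
  proof (induction k arbitrary: i j)
    case 0
    show ?case using decays_mult[OF t_jetD(2)[OF h] t_jetD(2)[OF h], of i j] by simp
  next
    case (Suc k)
    show ?case unfolding square_jet.simps(2) by (intro decays_add Suc)
  qed
  moreover have "((\<lambda>t'. square_jet h k i j (s, t')) has_real_derivative square_jet h (Suc k) i j (s, t))
      (at t within {0..1})" if "c < s" "t \<in> {0..1}" for s t k i j
  proof (induction k arbitrary: i j)
    case 0
    show ?case using that by (auto intro!: derivative_eq_intros t_jetD(3)[OF h])
  next
    case (Suc k)
    show ?case
      using DERIV_add[OF Suc[of "Suc i" j] Suc[of i "Suc j"]] by (simp only: square_jet.simps(2))
  qed
  ultimately show ?thesis unfolding t_jet_def by blast
qed

lemma cr_jet_Complex:
  assumes U: "t_jet c U" and V: "t_jet c V"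
    and ds: "\<And>s t. c < s \<Longrightarrow> t \<in> {0..1} \<Longrightarrow> ((\<lambda>s'. U 0 (s', t)) has_real_derivative V 1 (s, t)) (at s)"
      "\<And>s t. c < s \<Longrightarrow> t \<in> {0..1} \<Longrightarrow> ((\<lambda>s'. V 0 (s', t)) has_real_derivative - U 1 (s, t)) (at s)"
  shows "cr_jet c (\<lambda>k z. Complex (U k z) (V k z))"
proof (rule cr_jetI)
  show "continuous_on (half_strip c) (\<lambda>z. Complex (U k z) (V k z))" for k
    by (intro continuous_intros t_jetD[OF U] t_jetD[OF V])
  show "decays c 0 (\<lambda>z. Complex (U k z) (V k z))" for k
    using t_jetD(2)[OF U, of k] t_jetD(2)[OF V, of k] by (intro decays_complexI) simp_all
  fix s t :: real assume "c < s" "t \<in> {0..1}"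
  then show "((\<lambda>t'. Complex (U k (s, t')) (V k (s, t'))) has_vector_derivative
      Complex (U (Suc k) (s, t)) (V (Suc k) (s, t))) (at t within {0..1})" for k
    by (simp add: has_vector_derivative_complex_iff t_jetD(3)[OF U] t_jetD(3)[OF V])
  show "((\<lambda>s'. Complex (U 0 (s', t)) (V 0 (s', t))) has_vector_derivative
      - \<i> * Complex (U 1 (s, t)) (V 1 (s, t))) (at s)"
    using ds[OF \<open>c < s\<close> \<open>t \<in> {0..1}\<close>] by (simp add: has_vector_derivative_complex_iff)
qed

lemma uniform_limit_Complex:
  assumes "uniform_limit X u (\<lambda>_. a) F" "uniform_limit X v (\<lambda>_. b) F"
  shows "uniform_limit X (\<lambda>s t. Complex (u s t) (v s t)) (\<lambda>_. Complex a b) F"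
proof -
  have "uniform_limit X (\<lambda>s t. complex_of_real (u s t) + \<i> * complex_of_real (v s t))
      (\<lambda>_. complex_of_real a + \<i> * complex_of_real b) F"
    by (intro uniform_limit_intros bounded_linear.uniform_limit[OF bounded_linear_of_real]
        bounded_linear.uniform_limit[OF bounded_linear_mult_right] assms)
  then show ?thesis by (simp add: Complex_eq)
qed

text \<open>
  The equations are those of a strip in tube coordinates, and \<open>g = f - x\<^sup>2/2\<close> makes both
  \<open>x + \<i>\<theta>\<close> and \<open>g + \<i>y\<close> holomorphic. Since \<open>f = g + x\<^sup>2/2\<close>, the decay of \<open>g\<close> and \<open>x\<close> gives that of \<open>f\<close>.
\<close>
lemma strip_decay:
  fixes f \<theta> x y :: "nat \<Rightarrow> R2 \<Rightarrow> real"
  assumes f: "t_jet c f" and \<theta>: "t_jet c \<theta>" and x: "t_jet c x" and y: "t_jet c y" and c: "0 \<le> c"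
    and ds: "\<And>s t. c < s \<Longrightarrow> t \<in> {0..1} \<Longrightarrow>
        ((\<lambda>s'. f 0 (s', t)) has_real_derivative y 1 (s, t) + x 0 (s, t) * \<theta> 1 (s, t)) (at s)"
      "\<And>s t. c < s \<Longrightarrow> t \<in> {0..1} \<Longrightarrow> ((\<lambda>s'. \<theta> 0 (s', t)) has_real_derivative - x 1 (s, t)) (at s)"
      "\<And>s t. c < s \<Longrightarrow> t \<in> {0..1} \<Longrightarrow> ((\<lambda>s'. x 0 (s', t)) has_real_derivative \<theta> 1 (s, t)) (at s)"
      "\<And>s t. c < s \<Longrightarrow> t \<in> {0..1} \<Longrightarrow>
        ((\<lambda>s'. y 0 (s', t)) has_real_derivative - f 1 (s, t) + x 0 (s, t) * x 1 (s, t)) (at s)"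
    and bot: "\<And>s. c < s \<Longrightarrow> x 0 (s, 0) = 0" "\<And>s. c < s \<Longrightarrow> y 0 (s, 0) = 0"
    and top: "\<And>s. c < s \<Longrightarrow> f 0 (s, 1) = 0" "\<And>s. c < s \<Longrightarrow> x 0 (s, 1) = q (\<theta> 0 (s, 1)) * y 0 (s, 1)"
    and q: "isCont q \<theta>0"
    and lim: "uniform_limit {0..1} (\<lambda>s t. f 0 (s, t)) (\<lambda>_. 0) at_top"
      "uniform_limit {0..1} (\<lambda>s t. \<theta> 0 (s, t)) (\<lambda>_. \<theta>0) at_top"
      "uniform_limit {0..1} (\<lambda>s t. x 0 (s, t)) (\<lambda>_. 0) at_top"
      "uniform_limit {0..1} (\<lambda>s t. y 0 (s, t)) (\<lambda>_. 0) at_top"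
      "uniform_limit {0..1} (\<lambda>s t. \<theta> 1 (s, t)) (\<lambda>_. 0) at_top"
      "uniform_limit {0..1} (\<lambda>s t. x 1 (s, t)) (\<lambda>_. 0) at_top"
  shows "\<exists>\<rho>>0. \<exists>c'\<ge>c. \<forall>n. Ck_decays n c' \<rho> (f 0) \<and> Ck_decays n c' \<rho> (\<lambda>z. \<theta> 0 z - \<theta>0) \<and>
    Ck_decays n c' \<rho> (x 0) \<and> Ck_decays n c' \<rho> (y 0)"
proof -
  define g where "g = (\<lambda>k z. f k z - square_jet x k 0 0 z / 2)"
  define F where "F = (\<lambda>k z. Complex (x k z) (\<theta> k z))"
  define G where "G = (\<lambda>k z. Complex (g k z) (y k z))"
  have F: "cr_jet c F" unfolding F_def by (rule cr_jet_Complex[OF x \<theta> ds(3,2)])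
  have sq: "t_jet c (\<lambda>k. square_jet x k 0 0)" by (rule t_jet_square[OF x])
  have g: "t_jet c g"
    unfolding t_jet_def
  proof (intro allI conjI impI ballI)
    fix k
    show "continuous_on (half_strip c) (g k)" unfolding g_def
      by (intro continuous_intros t_jetD[OF f] t_jetD[OF sq]) auto
    have "decays c 0 (\<lambda>z. - 1 / 2 * square_jet x k 0 0 z)"
      using t_jetD(2)[OF sq, of k] by (rule decays_le[where B = 1]) simp
    from decays_add[OF t_jetD(2)[OF f, of k] this] show "decays c 0 (g k)" by (simp add: g_def)
    fix s t :: real assume "c < s" "t \<in> {0..1}"
    then show "((\<lambda>t'. g k (s, t')) has_real_derivative g (Suc k) (s, t)) (at t within {0..1})"
      unfolding g_def by (intro DERIV_diff DERIV_cdivide t_jetD(3)[OF f] t_jetD(3)[OF sq])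
  qed
  have g0: "g 0 z = f 0 z - (x 0 z)\<^sup>2 / 2" and g1: "g 1 z = f 1 z - x 0 z * x 1 z" for z
    by (simp_all add: g_def power2_eq_square)
  have G: "cr_jet c G" unfolding G_def
  proof (rule cr_jet_Complex[OF g y])
    fix s t :: real assume st: "c < s" "t \<in> {0..1}"
    have "((\<lambda>s'. f 0 (s', t) - x 0 (s', t) * x 0 (s', t) / 2) has_real_derivative
        y 1 (s, t) + x 0 (s, t) * \<theta> 1 (s, t) - (\<theta> 1 (s, t) * x 0 (s, t) + \<theta> 1 (s, t) * x 0 (s, t)) / 2) (at s)"
      by (intro DERIV_diff DERIV_cdivide DERIV_mult ds st)
    then show "((\<lambda>s'. g 0 (s', t)) has_real_derivative y 1 (s, t)) (at s)"
      by (simp add: g0 power2_eq_square mult.commute)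
    show "((\<lambda>s'. y 0 (s', t)) has_real_derivative - g 1 (s, t)) (at s)"
      using ds(4)[OF st] unfolding g1 minus_diff_eq by (simp only: add.commute diff_conv_add_uminus)
  qed
  have "uniform_limit {0..1} (\<lambda>s t. g 0 (s, t)) (\<lambda>_. 0) at_top"
  proof -
    have "uniform_limit {0..1} (\<lambda>s t. x 0 (s, t) * x 0 (s, t)) (\<lambda>_. 0 * 0) at_top"
      by (intro uniform_lim_mult lim) (auto simp: image_constant_conv)
    then have "uniform_limit {0..1} (\<lambda>s t. f 0 (s, t) - (1 / 2) * (x 0 (s, t) * x 0 (s, t)))
        (\<lambda>_. 0 - (1 / 2) * (0 * 0)) at_top"
      by (intro uniform_limit_minus lim bounded_linear.uniform_limit[OF bounded_linear_mult_right])
    then show ?thesis by (simp add: g0 power2_eq_square)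
  qed
  from uniform_limit_Complex[OF this lim(4)]
  have limG: "uniform_limit {0..1} (\<lambda>s t. G 0 (s, t)) (\<lambda>_. 0) at_top"
    by (simp add: G_def Complex_eq)
  have limF: "uniform_limit {0..1} (\<lambda>s t. F 0 (s, t)) (\<lambda>_. \<i> * complex_of_real \<theta>0) at_top"
    using uniform_limit_Complex[OF lim(3,2)] by (simp add: F_def Complex_eq)
  have limF1: "uniform_limit {0..1} (\<lambda>s t. F 1 (s, t)) (\<lambda>_. 0) at_top"
    using uniform_limit_Complex[OF lim(6,5)] by (simp add: F_def Complex_eq)
  have "\<exists>\<rho>>0. \<exists>c'\<ge>c. decays c' \<rho> (\<lambda>z. F 0 z - \<i> * complex_of_real \<theta>0) \<and>
      (\<forall>k. decays c' \<rho> (F (Suc k))) \<and> (\<forall>k. decays c' \<rho> (G k))"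
    by (rule coupled_cauchy_riemann_decay[OF F G c, where q = q])
      (use bot top q limF limG limF1 in \<open>auto simp: F_def G_def g0\<close>)
  then obtain \<rho> c' where \<rho>: "0 < \<rho>" and c': "c \<le> c'"
    and F0: "decays c' \<rho> (\<lambda>z. F 0 z - \<i> * complex_of_real \<theta>0)"
    and Fk: "\<And>k. decays c' \<rho> (F (Suc k))" and Gk: "\<And>k. decays c' \<rho> (G k)" by blast
  note F' = cr_jetD(3)[OF cr_jet_restrict[OF F c']] and G' = cr_jetD(3)[OF cr_jet_restrict[OF G c']]
  \<comment> \<open>The jet of \<open>F\<close> with its limit subtracted.\<close>
  define F2 where "F2 = (\<lambda>k. case k of 0 \<Rightarrow> (\<lambda>z. F 0 z - \<i> * complex_of_real \<theta>0) | Suc k \<Rightarrow> F (Suc k))"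
  have "has_partials c' (F2 k) (\<lambda>z. - \<i> * F2 (Suc k) z) (F2 (Suc k))" for k
  proof (cases k)
    case 0
    have "has_partials c' (\<lambda>z. F 0 z + - (\<i> * complex_of_real \<theta>0)) (\<lambda>z. - \<i> * F 1 z + 0) (\<lambda>z. F 1 z + 0)"
      using F'[of 0] by (intro has_partials_add) (auto simp: has_partials_def)
    then show ?thesis using 0 by (simp add: F2_def)
  next
    case (Suc m)
    then show ?thesis using F'[of "Suc m"] by (simp add: F2_def)
  qed
  moreover have "decays c' \<rho> (F2 k)" for k
    using F0 Fk by (cases k) (simp_all add: F2_def)
  ultimately have "Ck_decays n c' \<rho> (F2 0)" for n by (rule Ck_decays_jet)
  then have CF: "Ck_decays n c' \<rho> (\<lambda>z. F 0 z - \<i> * complex_of_real \<theta>0)" for n by (simp add: F2_def)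
  have CG: "Ck_decays n c' \<rho> (G 0)" for n by (rule Ck_decays_jet[where P = G, OF G' Gk])
  have Cx: "Ck_decays n c' \<rho> (x 0)" and C\<theta>: "Ck_decays n c' \<rho> (\<lambda>z. \<theta> 0 z - \<theta>0)" for n
    using Ck_decays_linear[OF bounded_linear_Re CF, of n] Ck_decays_linear[OF bounded_linear_Im CF, of n]
    by (simp_all add: F_def)
  have Cg: "Ck_decays n c' \<rho> (g 0)" and Cy: "Ck_decays n c' \<rho> (y 0)" for n
    using Ck_decays_linear[OF bounded_linear_Re CG, of n] Ck_decays_linear[OF bounded_linear_Im CG, of n]
    by (simp_all add: G_def)
  have Cf: "Ck_decays n c' \<rho> (f 0)" for n
  proof -
    have "Ck_decays n c' (\<rho> + \<rho>) (\<lambda>z. x 0 z * x 0 z)" by (intro Ck_decays_mult Cx)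
    then have "Ck_decays n c' \<rho> (\<lambda>z. x 0 z * x 0 z)" by (rule Ck_decays_mono) (use \<rho> in simp)
    from Ck_decays_add[OF Cg Ck_decays_linear[OF bounded_linear_mult_right this, of "1 / 2"]]
    have "Ck_decays n c' \<rho> (\<lambda>z. g 0 z + 1 / 2 * (x 0 z * x 0 z))" .
    moreover have "g 0 z + 1 / 2 * (x 0 z * x 0 z) = f 0 z" for z by (simp add: g0 power2_eq_square)
    ultimately show ?thesis by simp
  qed
  show ?thesis using \<rho> c' Cf C\<theta> Cx Cy by blast
qed

section \<open>The tube coordinates\<close>

lemma smooth_real_iterated_deriv:
  assumes "smooth_on UNIV (a :: real \<Rightarrow> real)"
  shows "((deriv ^^ k) a has_real_derivative (deriv ^^ Suc k) a x) (at x)"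
proof -
  have *: "\<exists>a'. smooth_on UNIV a' \<and> (\<forall>x. (a has_real_derivative a' x) (at x))"
    if "smooth_on UNIV a" for a :: "real \<Rightarrow> real"
  proof (intro exI conjI allI)
    have C: "Ck_on (Suc k) UNIV a" for k using that unfolding smooth_on_def by blast
    show "smooth_on UNIV (\<lambda>x. frechet_derivative a (at x within UNIV) 1)"
      using C by (auto simp: smooth_on_def)
    fix x
    have "a differentiable (at x)" using C[of 0] by (simp add: differentiable_on_def)
    then have D: "(a has_derivative frechet_derivative a (at x)) (at x)"
      using frechet_derivative_works by blast
    have "frechet_derivative a (at x) = (\<lambda>h. frechet_derivative a (at x) 1 * h)"
      using linear_scale[OF has_derivative_linear[OF D], of _ 1, symmetric]
      by (simp add: fun_eq_iff mult.commute)
    with D show "(a has_real_derivative frechet_derivative a (at x within UNIV) 1) (at x)"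
      by (simp add: has_field_derivative_def)
  qed
  have **: "smooth_on UNIV (deriv a) \<and> (\<forall>x. (a has_real_derivative deriv a x) (at x))"
    if a: "smooth_on UNIV a" for a :: "real \<Rightarrow> real"
  proof -
    obtain a' where a': "smooth_on UNIV a'" "\<forall>x. (a has_real_derivative a' x) (at x)"
      using *[OF a] by blast
    then have "deriv a = a'" by (auto intro!: DERIV_imp_deriv)
    with a' show ?thesis by simp
  qed
  have "smooth_on UNIV ((deriv ^^ k) a)" for k
    using assms by (induction k) (simp_all add: **)
  then show ?thesis using ** by simp
qed

lemma periodic_int_shift:
  fixes a :: "real \<Rightarrow> real"
  assumes "\<And>\<theta>. a (\<theta> + 1) = a \<theta>" and "\<theta> - \<theta>' \<in> \<int>"
  shows "a \<theta> = a \<theta>'"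
proof -
  have nat: "a (\<theta> + real n) = a \<theta>" for \<theta> n
    by (induction n) (use assms(1) in \<open>simp_all add: add.assoc[symmetric] add.commute[of 1]\<close>)
  obtain m where m: "\<theta> = \<theta>' + of_int m" using assms(2) by (metis Ints_cases add.commute diff_add_cancel)
  show ?thesis
  proof (cases "0 \<le> m")
    case True
    then show ?thesis using nat[of \<theta>' "nat m"] m by simp
  next
    case False
    then show ?thesis using nat[of \<theta> "nat (- m)"] m by simp
  qed
qed

text \<open>
  Here \<open>d\<lambda> = dx \<and> d\<theta>\<close>, whose kernel is the \<open>y\<close>-direction.
\<close>
lemma reeb_normal_form:
  assumes U: "open U" "(\<theta>, x, y) \<in> U"
    and \<omega>: "\<And>\<theta> x y h k l. (\<theta>, x, y) \<in> U \<Longrightarrow> \<omega> (\<theta>, x, y) (h, k, l) = l + x * h"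
  shows "reeb \<omega> (\<theta>, x, y) = (0, 0, 1)"
proof -
  let ?z = "(\<theta>, x, y)"
  have \<omega>': "\<omega> (\<theta>, x, y) w = snd (snd w) + x * fst w" if "(\<theta>, x, y) \<in> U" for \<theta> x y w
    using \<omega>[OF that, of "fst w" "fst (snd w)" "snd (snd w)"] by simp
  have ext: "extd \<omega> ?z v w = fst (snd v) * fst w - fst (snd w) * fst v" for v w
  proof -
    have "frechet_derivative (\<lambda>z. \<omega> z w) (at ?z) = (\<lambda>v. fst (snd v) * fst w)" for w
    proof -
      have "((\<lambda>z. snd (snd w) + fst (snd z) * fst w) has_derivative (\<lambda>v. fst (snd v) * fst w)) (at ?z)"
        by (auto intro!: derivative_eq_intros)
      then have "((\<lambda>z. \<omega> z w) has_derivative (\<lambda>v. fst (snd v) * fst w)) (at ?z)"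
        by (rule has_derivative_transform_within_open[OF _ U]) (metis \<omega>' prod.collapse fst_conv snd_conv)
      then show ?thesis by (rule frechet_derivative_at[symmetric])
    qed
    then show ?thesis by (simp add: extd_def)
  qed
  show ?thesis unfolding reeb_def
  proof (rule the_equality)
    show "(\<forall>w. extd \<omega> ?z (0, 0, 1) w = 0) \<and> \<omega> ?z (0, 0, 1) = 1"
      using U by (simp add: ext \<omega>)
    fix X assume X: "(\<forall>w. extd \<omega> ?z X w = 0) \<and> \<omega> ?z X = 1"
    obtain X1 X2 X3 where [simp]: "X = (X1, X2, X3)" by (cases X)
    have "X2 = 0" using X[THEN conjunct1, rule_format, of "(1, 0, 0)"] by (simp add: ext)
    moreover have "X1 = 0" using X[THEN conjunct1, rule_format, of "(0, 1, 0)"] by (simp add: ext)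
    ultimately show "X = (0, 0, 1)" using X U by (simp add: \<omega>)
  qed
qed

lemma tube_piece_inj:
  assumes "tube_coordinates A lam J L V \<Phi>"
  shows "inj_on \<Phi> (tube_piece V \<theta>0)"
proof (rule inj_onI)
  fix z z' assume z: "z \<in> tube_piece V \<theta>0" "z' \<in> tube_piece V \<theta>0" "\<Phi> z = \<Phi> z'"
  have "\<forall>z\<in>V. \<forall>z'\<in>V. \<Phi> z = \<Phi> z' \<longleftrightarrow> fst z - fst z' \<in> \<int> \<and> snd z = snd z'"
    using assms unfolding tube_coordinates_def by (elim conjE) assumption
  moreover have "z \<in> V" "z' \<in> V" and d: "\<bar>fst z - \<theta>0\<bar> < 1 / 2" "\<bar>fst z' - \<theta>0\<bar> < 1 / 2"
    using z by (simp_all add: tube_piece_def)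
  ultimately have "fst z - fst z' \<in> \<int> \<and> snd z = snd z'" using z(3) by blast
  moreover have "\<bar>fst z - fst z'\<bar> < 1" using d by linarith
  ultimately show "z = z'"
    using Ints_nonzero_abs_less1[of "fst z - fst z'"] by (auto simp: prod_eq_iff)
qed

lemma tube_chart_simps:
  assumes T: "tube_coordinates A lam J L V \<Phi>"
  shows "dom_of (tube_chart V \<Phi> \<theta>0) = \<Phi> ` tube_piece V \<theta>0"
    and "z \<in> tube_piece V \<theta>0 \<Longrightarrow> coord (tube_chart V \<Phi> \<theta>0) (\<Phi> z) = z"
    and "m \<in> dom_of (tube_chart V \<Phi> \<theta>0) \<Longrightarrow> coord (tube_chart V \<Phi> \<theta>0) m \<in> tube_piece V \<theta>0"
    and "m \<in> dom_of (tube_chart V \<Phi> \<theta>0) \<Longrightarrow> \<Phi> (coord (tube_chart V \<Phi> \<theta>0) m) = m"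
    and "img_of (tube_chart V \<Phi> \<theta>0) = tube_piece V \<theta>0"
    and "z \<in> tube_piece V \<theta>0 \<Longrightarrow> param (tube_chart V \<Phi> \<theta>0) z = \<Phi> z"
proof -
  note inj = tube_piece_inj[OF T, of \<theta>0]
  show dom: "dom_of (tube_chart V \<Phi> \<theta>0) = \<Phi> ` tube_piece V \<theta>0" by (simp add: tube_chart_def)
  show co: "coord (tube_chart V \<Phi> \<theta>0) (\<Phi> z) = z" if "z \<in> tube_piece V \<theta>0" for z
    using inj that by (simp add: tube_chart_def)
  show "coord (tube_chart V \<Phi> \<theta>0) m \<in> tube_piece V \<theta>0" "\<Phi> (coord (tube_chart V \<Phi> \<theta>0) m) = m"
    if "m \<in> dom_of (tube_chart V \<Phi> \<theta>0)" for m
    using that co unfolding dom by auto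
  show "img_of (tube_chart V \<Phi> \<theta>0) = tube_piece V \<theta>0"
    unfolding img_of_def dom image_image using co by simp
  have "inj_on (coord (tube_chart V \<Phi> \<theta>0)) (dom_of (tube_chart V \<Phi> \<theta>0))"
    unfolding dom by (rule inj_on_imageI) (auto simp: inj_on_def co)
  then show "param (tube_chart V \<Phi> \<theta>0) z = \<Phi> z" if "z \<in> tube_piece V \<theta>0" for z
    using inv_into_f_f[of "coord (tube_chart V \<Phi> \<theta>0)" "dom_of (tube_chart V \<Phi> \<theta>0)" "\<Phi> z"] that
    by (simp add: param_def co dom)
qed

lemma open_tube_piece: "tube_coordinates A lam J L V \<Phi> \<Longrightarrow> open (tube_piece V \<theta>0)"
proof -
  assume "tube_coordinates A lam J L V \<Phi>"
  then have "open V" by (simp add: tube_coordinates_def)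
  moreover have "open {z::R3. \<bar>fst z - \<theta>0\<bar> < 1 / 2}"
    by (intro open_Collect_less continuous_intros)
  moreover have "tube_piece V \<theta>0 = V \<inter> {z. \<bar>fst z - \<theta>0\<bar> < 1 / 2}" by (auto simp: tube_piece_def)
  ultimately show ?thesis by (simp add: open_Int)
qed

text \<open>
  The vector \<open>(w1, w2, w3)\<close> is \<open>w1 (1, 0, -x) + w2 (0, 1, 0)\<close> modulo the Reeb direction, and \<open>J\<close> is given on
  these two generators of the contact plane.
\<close>
lemma Jtilde_normal_form:
  assumes T: "tube_coordinates A lam J L V \<Phi>" and J: "compatible_complex_structure A lam J"
    and z: "(\<theta>, x, y) \<in> tube_piece V \<theta>0"
    and J1: "J (tube_chart V \<Phi> \<theta>0) (\<theta>, x, y) (1, 0, - x) = (0, - 1, 0)"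
    and J2: "J (tube_chart V \<Phi> \<theta>0) (\<theta>, x, y) (0, 1, 0) = (1, 0, - x)"
  shows "Jtilde lam J (tube_chart V \<Phi> \<theta>0) (\<theta>, x, y) (h, w1, w2, w3) =
    (- (w3 + x * w1), w2, - w1, h - x * w2)"
proof -
  let ?c = "tube_chart V \<Phi> \<theta>0" and ?z = "(\<theta>, x, y)"
  have cA: "?c \<in> A" using T by (simp add: tube_coordinates_def)
  have lam: "lam ?c (\<theta>, x, y) (h, k, l) = l + x * h" if "(\<theta>, x, y) \<in> tube_piece V \<theta>0" for \<theta> x y h k l
  proof -
    have "\<forall>\<theta>0 \<theta> x y h k l. (\<theta>, x, y) \<in> tube_piece V \<theta>0 \<longrightarrow>
        lam (tube_chart V \<Phi> \<theta>0) (\<theta>, x, y) (h, k, l) = l + x * h"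
      using T unfolding tube_coordinates_def by (elim conjE) assumption
    with that show ?thesis by blast
  qed
  have reeb: "reeb (lam ?c) ?z = (0, 0, 1)"
    by (rule reeb_normal_form[OF open_tube_piece[OF T] z lam])
  have zi: "?z \<in> img_of ?c" using z by (simp add: tube_chart_simps(5)[OF T])
  have ker: "(h, k, - x * h) \<in> ker_form (lam ?c) ?z" for h k
    by (simp add: ker_form_def lam[OF z])
  have J_add: "J ?c ?z (v + w) = J ?c ?z v + J ?c ?z w"
    if "v \<in> ker_form (lam ?c) ?z" "w \<in> ker_form (lam ?c) ?z" for v w
    using J cA zi that unfolding compatible_complex_structure_def by blast
  have J_scale: "J ?c ?z (r *\<^sub>R v) = r *\<^sub>R J ?c ?z v" if "v \<in> ker_form (lam ?c) ?z" for v r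
    using J cA zi that unfolding compatible_complex_structure_def by blast
  have "J ?c ?z (xi_proj (lam ?c) ?z (w1, w2, w3)) = J ?c ?z (w1 *\<^sub>R (1, 0, - x) + w2 *\<^sub>R (0, 1, 0))"
    by (simp add: xi_proj_def reeb lam[OF z] mult.commute)
  also have "\<dots> = J ?c ?z (w1 *\<^sub>R (1, 0, - x)) + J ?c ?z (w2 *\<^sub>R (0, 1, 0))"
    by (rule J_add) (use ker[of w1 0] ker[of 0 w2] in \<open>simp_all add: mult.commute\<close>)
  also have "\<dots> = w1 *\<^sub>R J ?c ?z (1, 0, - x) + w2 *\<^sub>R J ?c ?z (0, 1, 0)"
    using J_scale[of "(1, 0, - x)" w1] J_scale[of "(0, 1, 0)" w2] ker[of 1 0] ker[of 0 1] by simp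
  finally have "J ?c ?z (xi_proj (lam ?c) ?z (w1, w2, w3)) = (w2, - w1, - x * w2)"
    by (simp add: J1 J2)
  then show ?thesis by (simp add: Jtilde_def lam[OF z] reeb)
qed

lemma has_partials_Pair:
  assumes "has_partials c f fs ft" "has_partials c h hs ht"
  shows "has_partials c (\<lambda>z. (f z, h z)) (\<lambda>z. (fs z, hs z)) (\<lambda>z. (ft z, ht z))"
  unfolding has_partials_def
  by (intro allI impI ballI conjI has_vector_derivative_Pair
      has_partialsD[OF assms(1)] has_partialsD[OF assms(2)])

lemma iterated_pd_t_Pair:
  assumes f: "smooth_on T f" "half_strip c \<subseteq> T" and h: "smooth_on T' h" "half_strip c \<subseteq> T'"
  shows "z \<in> half_strip c \<Longrightarrow> (pd_t ^^ k) (\<lambda>z. (f z, h z)) z = ((pd_t ^^ k) f z, (pd_t ^^ k) h z)"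
proof (induction k arbitrary: z)
  case (Suc k)
  from has_partials_eqI[OF has_partials_Pair[OF smooth_iterated_pd_t(2)[OF f] smooth_iterated_pd_t(2)[OF h]] Suc.IH]
  show ?case using pd_eq_partials(2) Suc.prems by fastforce
qed simp

text \<open>
  In a chart of the atlas \<open>\<Phi>\<close> is continuous, being the inverse of the coordinate map. Thus a
  condition that holds on a neighbourhood of the end point holds for coordinates near its own.
\<close>
lemma tube_neighbourhood:
  assumes S: "smooth_structure A" and T: "tube_coordinates A lam J L V \<Phi>"
    and W: "open W" "\<Phi> (\<theta>0, 0, 0) \<in> W"
  obtains e where "0 < e"
    "\<And>z. dist z (\<theta>0, 0, 0) < e \<Longrightarrow> z \<in> tube_piece V \<theta>0" "\<And>z. dist z (\<theta>0, 0, 0) < e \<Longrightarrow> \<Phi> z \<in> W"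
proof -
  let ?c = "tube_chart V \<Phi> \<theta>0"
  have "is_chart ?c" using S T by (simp add: smooth_structure_def tube_coordinates_def)
  then have "continuous_on (tube_piece V \<theta>0) (param ?c)"
    unfolding is_chart_def homeomorphism_def by (simp add: tube_chart_simps[OF T])
  then have "continuous_on (tube_piece V \<theta>0) \<Phi>"
    by (rule continuous_on_eq) (simp add: tube_chart_simps(6)[OF T])
  then have "open (tube_piece V \<theta>0 \<inter> \<Phi> -` W)"
    by (rule continuous_open_preimage[OF _ open_tube_piece[OF T] W(1)])
  moreover have "(\<theta>0, 0, 0) \<in> tube_piece V \<theta>0 \<inter> \<Phi> -` W"
    using T W by (simp add: tube_piece_def tube_coordinates_def)
  ultimately obtain e where "0 < e" "ball (\<theta>0, 0, 0) e \<subseteq> tube_piece V \<theta>0 \<inter> \<Phi> -` W"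
    by (meson open_contains_ball)
  then show thesis by (intro that[of e]) (auto simp: dist_commute)
qed

lemma tube_coords_on_knot:
  assumes T: "tube_coordinates A lam J L V \<Phi>" and z: "z \<in> V" "\<Phi> z \<in> L"
  shows "snd z = (0, 0)"
proof -
  have inj: "\<forall>z\<in>V. \<forall>z'\<in>V. \<Phi> z = \<Phi> z' \<longleftrightarrow> fst z - fst z' \<in> \<int> \<and> snd z = snd z'"
    and L: "L = {\<Phi> (\<theta>, 0, 0) |\<theta>. True}" and V: "\<forall>\<theta>. (\<theta>, 0, 0) \<in> V"
    using T unfolding tube_coordinates_def by - (elim conjE; assumption)+
  from z L obtain \<theta> where "\<Phi> z = \<Phi> (\<theta>, 0, 0)" by auto
  then show ?thesis using inj z V by (metis snd_conv)
qed

text \<open>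
  The equation \<open>x b = a y\<close> holds along the rays \<open>(x, y) = (a r, b r)\<close>. The value of \<open>\<theta>\<close>
  in the parametrization of the surface is only determined modulo \<open>1\<close>, hence the periodicity of \<open>a\<close> and
  \<open>b\<close>.
\<close>
lemma tube_coords_on_surface:
  assumes T: "tube_coordinates A lam J L V \<Phi>" and S: "surface_normal_form A lam L D V \<Phi> a b"
  obtains W where "open W" "L \<subseteq> W"
    "\<And>\<theta> x y. (\<theta>, x, y) \<in> V \<Longrightarrow> \<Phi> (\<theta>, x, y) \<in> D \<inter> W \<Longrightarrow> x * b \<theta> = a \<theta> * y"
proof -
  have inj: "\<forall>z\<in>V. \<forall>z'\<in>V. \<Phi> z = \<Phi> z' \<longleftrightarrow> fst z - fst z' \<in> \<int> \<and> snd z = snd z'"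
    using T unfolding tube_coordinates_def by (elim conjE) assumption
  have per: "\<forall>\<theta>. a (\<theta> + 1) = a \<theta> \<and> b (\<theta> + 1) = b \<theta> \<and> (a \<theta>, b \<theta>) \<noteq> (0, 0)"
    and ex: "\<exists>\<epsilon>>0. \<exists>N. open N \<and> L \<subseteq> N \<and>
        (\<forall>\<theta> r. 0 \<le> r \<and> r < \<epsilon> \<longrightarrow> (\<theta>, a \<theta> * r, b \<theta> * r) \<in> V) \<and>
        D \<inter> N = {\<Phi> (\<theta>, a \<theta> * r, b \<theta> * r) | \<theta> r. 0 \<le> r \<and> r < \<epsilon>}"
    using S unfolding surface_normal_form_def by - (elim conjE; assumption)+
  from ex obtain \<epsilon> W where W: "open W" "L \<subseteq> W"
    "\<And>\<theta> r. 0 \<le> r \<and> r < \<epsilon> \<Longrightarrow> (\<theta>, a \<theta> * r, b \<theta> * r) \<in> V"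
    "D \<inter> W = {\<Phi> (\<theta>, a \<theta> * r, b \<theta> * r) | \<theta> r. 0 \<le> r \<and> r < \<epsilon>}" by auto
  show thesis
  proof (rule that[OF W(1,2)])
    fix \<theta> x y assume z: "(\<theta>, x, y) \<in> V" "\<Phi> (\<theta>, x, y) \<in> D \<inter> W"
    from z(2) W(4) obtain \<theta>' r where r: "0 \<le> r \<and> r < \<epsilon>" "\<Phi> (\<theta>, x, y) = \<Phi> (\<theta>', a \<theta>' * r, b \<theta>' * r)"
      by auto
    from inj[rule_format, OF z(1) W(3)[OF r(1), of \<theta>']] r(2)
    have d: "\<theta> - \<theta>' \<in> \<int>" "x = a \<theta>' * r" "y = b \<theta>' * r" by auto
    have "a \<theta> = a \<theta>'" "b \<theta> = b \<theta>'" using per d(1) by (auto intro: periodic_int_shift)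
    then show "x * b \<theta> = a \<theta> * y" using d by simp
  qed
qed

theorem theorem4p6:
  fixes A :: "'m::{t2_space,second_countable_topology} chart set"
    and lam :: "'m chart \<Rightarrow> R3 \<Rightarrow> R3 \<Rightarrow> real"
    and J :: "'m chart \<Rightarrow> R3 \<Rightarrow> R3 \<Rightarrow> R3"
    and L D N :: "'m set"
    and \<sigma> :: "'m chart \<Rightarrow> R2 \<Rightarrow> R2 \<Rightarrow> R2 \<Rightarrow> real"
    and V :: "R3 set" and \<Phi> :: "R3 \<Rightarrow> 'm"
    and a b :: "real \<Rightarrow> real"
    and f :: "R2 \<Rightarrow> real" and u :: "R2 \<Rightarrow> 'm"
    and p :: 'm and \<theta>0 :: real
    and v :: "R2 \<Rightarrow> R4"
  assumes "smooth_structure A"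
    and "contact_form A lam"
    and "compatible_complex_structure A lam J"
    and "legendrian_knot A lam L"
    and "compact D" and "embedded_surface A D" and "surface_volume_form A D \<sigma>"
    and "surface_boundary A D = L"
    and "\<And>p. singular_point A lam D p \<Longrightarrow> nondegenerate_point A lam D \<sigma> p"
    and "tube_coordinates A lam J L V \<Phi>"
    and "surface_normal_form A lam L D V \<Phi> a b"
    and "open N" and "{p. singular_point A lam D p} \<subseteq> N"
    and "finite_energy_strip A lam J L (D - N) f u"
    and "smooth_limit_at_infinity A f u p"
    and "p \<in> L" and "\<not> singular_point A lam D p"
    and "p = \<Phi> (\<theta>0, 0, 0)"
    and "\<And>z. v z = end_coords V \<Phi> a b \<theta>0 (f z) (u z)"
  shows "\<exists>\<rho>>0. \<exists>s'>0.
    (\<forall>s\<ge>s'. \<forall>t\<in>{0..1}. u (s, t) \<in> end_dom V \<Phi> b \<theta>0) \<and>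
    (\<forall>j k. \<exists>C>0. \<forall>s\<ge>s'. \<forall>t\<in>{0..1}.
       norm ((pd_s ^^ j) ((pd_t ^^ k) v) (s, t)) \<le> C * exp (- \<rho> * (s - s')))"
proof -
  note T = assms(10) and p = assms(18)
  define \<kappa> where "\<kappa> = tube_chart V \<Phi> \<theta>0"
  define z0 :: R3 where "z0 = (\<theta>0, 0, 0)"
  have \<kappa>A: "\<kappa> \<in> A" using T by (simp add: \<kappa>_def tube_coordinates_def)
  have z0: "z0 \<in> tube_piece V \<theta>0" using T by (simp add: z0_def tube_piece_def tube_coordinates_def)
  have pz0: "p = \<Phi> z0" by (simp add: z0_def p)
  have p\<kappa>: "p \<in> dom_of \<kappa>" "coord \<kappa> p = z0"
    unfolding \<kappa>_def pz0 using z0 by (auto simp: tube_chart_simps[OF T])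
  have ab: "smooth_on UNIV a" "smooth_on UNIV b" and sing: "\<forall>\<theta>. singular_point A lam D (\<Phi> (\<theta>,0,0)) \<longleftrightarrow> b \<theta> = 0"
    using assms(11) unfolding surface_normal_form_def by - (elim conjE; assumption)+
  note da = smooth_real_iterated_deriv[OF ab(1)] and db = smooth_real_iterated_deriv[OF ab(2)]
  have b0: "b \<theta>0 \<noteq> 0" using sing assms(17) p by simp
  have cont_ab: "isCont a \<theta>0" "isCont b \<theta>0"
    using DERIV_isCont[OF da[of 0]] DERIV_isCont[OF db[of 0]] by simp_all
  then have q: "isCont (\<lambda>\<theta>. a \<theta> / b \<theta>) \<theta>0" using b0 by (intro continuous_intros) auto

  have "\<exists>N. open N \<and> L \<subseteq> N \<and> (\<forall>\<theta>0 \<theta> x y. (\<theta>,x,y) \<in> tube_piece V \<theta>0 \<and> \<Phi> (\<theta>,x,y) \<in> N \<longrightarrow>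
      J (tube_chart V \<Phi> \<theta>0) (\<theta>,x,y) (1,0,-x) = (0,-1,0) \<and>
      J (tube_chart V \<Phi> \<theta>0) (\<theta>,x,y) (0,1,0) = (1,0,-x))"
    using T unfolding tube_coordinates_def by (elim conjE) assumption
  then obtain NJ where NJ: "open NJ" "L \<subseteq> NJ" "\<And>\<theta> x y. (\<theta>,x,y) \<in> tube_piece V \<theta>0 \<Longrightarrow> \<Phi> (\<theta>,x,y) \<in> NJ \<Longrightarrow>
      J \<kappa> (\<theta>,x,y) (1,0,-x) = (0,-1,0) \<and> J \<kappa> (\<theta>,x,y) (0,1,0) = (1,0,-x)"
    unfolding \<kappa>_def by (elim exE conjE) blast
  obtain ND where ND: "open ND" "L \<subseteq> ND"
    "\<And>\<theta> x y. (\<theta>, x, y) \<in> V \<Longrightarrow> \<Phi> (\<theta>, x, y) \<in> D \<inter> ND \<Longrightarrow> x * b \<theta> = a \<theta> * y"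
    using tube_coords_on_surface[OF T assms(11)] by blast
  have "open (NJ \<inter> ND)" "\<Phi> (\<theta>0, 0, 0) \<in> NJ \<inter> ND"
    using NJ ND assms(16) p by auto
  then obtain e1 where e1: "0 < e1" "\<And>z. dist z z0 < e1 \<Longrightarrow> z \<in> tube_piece V \<theta>0"
    "\<And>z. dist z z0 < e1 \<Longrightarrow> \<Phi> z \<in> NJ \<inter> ND"
    unfolding z0_def using tube_neighbourhood[OF assms(1) T] by metis
  define \<beta> where "\<beta> = \<bar>b \<theta>0\<bar> / 2"
  have \<beta>: "0 < \<beta>" using b0 by (simp add: \<beta>_def)
  obtain e2 where e2: "0 < e2" "\<And>\<theta>. dist \<theta> \<theta>0 < e2 \<Longrightarrow> dist (b \<theta>) (b \<theta>0) < \<beta>"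
    using cont_ab(2) \<beta> by (metis continuous_at_eps_delta dist_commute dist_real_def)
  define e where "e = min 1 (min e1 e2)"
  have e: "0 < e" "e \<le> 1" "e \<le> e1" "e \<le> e2" using e1(1) e2(1) by (auto simp: e_def)

  define w where "w = in_chart \<kappa> f u"
  define cu where "cu = coord \<kappa> \<circ> u"
  have w: "w = (\<lambda>z. (f z, cu z))" by (simp add: w_def in_chart_def cu_def)
  have dom: "\<forall>\<^sub>F s in at_top. \<forall>t\<in>{0..1}. u (s, t) \<in> dom_of \<kappa>"
    and lim: "\<And>k. uniform_limit {0..1} (\<lambda>s t. (pd_t ^^ k) w (s, t)) (\<lambda>t. if k = 0 then (0, z0) else 0) at_top"
    using assms(15)[unfolded smooth_limit_at_infinity_def, rule_format, OF \<kappa>A p\<kappa>(1)]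
    unfolding w_def p\<kappa>(2) by blast+
  have w_near: "\<forall>\<^sub>F s in at_top. \<forall>t\<in>{0..1}. dist (w (s, t)) (0, z0) < e"
    using uniform_limitD[OF lim[of 0] e(1)] by simp
  have cu_le: "dist (cu z) z0 \<le> dist (w z) (0, z0)" for z
    using dist_snd_le[of "w z" "(0, z0)"] by (simp add: w)
  have "\<forall>\<^sub>F s in at_top. (\<forall>t\<in>{0..1}. u (s, t) \<in> dom_of \<kappa>) \<and> (\<forall>t\<in>{0..1}. dist (cu (s, t)) z0 < e)"
    using dom w_near by eventually_elim (use cu_le le_less_trans in blast)
  then obtain c0 where c0: "\<And>s. c0 \<le> s \<Longrightarrow>
      (\<forall>t\<in>{0..1}. u (s, t) \<in> dom_of \<kappa>) \<and> (\<forall>t\<in>{0..1}. dist (cu (s, t)) z0 < e)"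
    unfolding eventually_at_top_linorder by blast
  define c where "c = max 0 c0"
  have c: "0 \<le> c" by (simp add: c_def)
  have u_dom: "u z \<in> dom_of \<kappa>" and cu_near: "dist (cu z) z0 < e" if "z \<in> half_strip c" for z
    using c0[of "fst z"] that by (cases z; simp add: c_def)+
  have cu_piece: "cu z \<in> tube_piece V \<theta>0" and cu_N: "\<Phi> (cu z) \<in> NJ \<inter> ND" and \<Phi>cu: "\<Phi> (cu z) = u z"
    if "z \<in> half_strip c" for z
    using e1(2,3)[of "cu z"] cu_near[OF that] u_dom[OF that] e tube_chart_simps(4)[OF T, of "u z"]
    by (auto simp: cu_def \<kappa>_def)
  have cu_V: "cu z \<in> V" if "z \<in> half_strip c" for z
    using cu_piece[OF that] by (simp add: tube_piece_def)
  have b_low: "\<beta> \<le> \<bar>b (fst (cu z))\<bar>" and th_near: "\<bar>fst (cu z) - \<theta>0\<bar> \<le> 1" if "z \<in> half_strip c" for z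
  proof -
    have "dist (fst (cu z)) \<theta>0 < e"
      using cu_near[OF that] dist_fst_le[of "cu z" z0] by (simp add: z0_def)
    then have "\<bar>fst (cu z) - \<theta>0\<bar> < e" by (simp add: dist_real_def)
    then show "\<bar>fst (cu z) - \<theta>0\<bar> \<le> 1" using e by simp
    have "dist (b (fst (cu z))) (b \<theta>0) < \<beta>"
      using \<open>dist (fst (cu z)) \<theta>0 < e\<close> e by (intro e2(2)) simp
    then show "\<beta> \<le> \<bar>b (fst (cu z))\<bar>" unfolding \<beta>_def dist_real_def by linarith
  qed

  have str: "smooth_on strip f" "smooth_map A strip u"
    "\<forall>z\<in>strip. \<forall>c\<in>A. u z \<in> dom_of c \<longrightarrow>
        pd_s (in_chart c f u) z + Jtilde lam J c (coord c (u z)) (pd_t (in_chart c f u) z) = 0"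
    "\<forall>s. u (s, 0) \<in> L" "\<forall>s. f (s, 1) = 0 \<and> u (s, 1) \<in> D - N"
    using assms(14) unfolding finite_energy_strip_def by - (elim conjE; assumption)+
  define T1 where "T1 = {z \<in> strip. u z \<in> dom_of \<kappa>}"
  have sub: "half_strip c \<subseteq> strip" "half_strip c \<subseteq> T1"
    using u_dom by (auto simp: half_strip_def strip_def T1_def)
  have cu_smooth: "smooth_on T1 cu"
    using str(2) \<kappa>A unfolding smooth_map_def T1_def cu_def by blast

  note f_iter = smooth_iterated_pd_t[OF str(1) sub(1)] and cu_iter = smooth_iterated_pd_t[OF cu_smooth sub(2)]
  have w_iter: "(pd_t ^^ k) w z = ((pd_t ^^ k) f z, (pd_t ^^ k) cu z)" if "z \<in> half_strip c" for z k
    unfolding w by (rule iterated_pd_t_Pair[OF str(1) sub(1) cu_smooth sub(2) that])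
  define F \<theta> x y where "F = (\<lambda>k. (pd_t ^^ k) f)" and "\<theta> = (\<lambda>k z. fst ((pd_t ^^ k) cu z))"
    and "x = (\<lambda>k z. fst (snd ((pd_t ^^ k) cu z)))" and "y = (\<lambda>k z. snd (snd ((pd_t ^^ k) cu z)))"
  have cu_eq: "(pd_t ^^ k) cu z = (\<theta> k z, x k z, y k z)" for k z
    by (simp add: \<theta>_def x_def y_def)
  have lin: "bounded_linear (fst :: R4 \<Rightarrow> real)" "bounded_linear (\<lambda>z::R4. fst (snd z))"
    "bounded_linear (\<lambda>z::R4. fst (snd (snd z)))" "bounded_linear (\<lambda>z::R4. snd (snd (snd z)))"
    "bounded_linear (fst :: R3 \<Rightarrow> real)" "bounded_linear (\<lambda>z::R3. fst (snd z))" "bounded_linear (\<lambda>z::R3. snd (snd z))"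
    by (intro bounded_linear_fst bounded_linear_fst_comp bounded_linear_snd_comp bounded_linear_ident)+
  have lims: "uniform_limit {0..1} (\<lambda>s t. R ((pd_t ^^ k) f (s, t), (pd_t ^^ k) cu (s, t)))
      (\<lambda>_. R (if k = 0 then (0, z0) else 0)) at_top" if "bounded_linear R" for R :: "R4 \<Rightarrow> real" and k
  proof -
    have "uniform_limit {0..1} (\<lambda>s t. R ((pd_t ^^ k) w (s, t))) (\<lambda>t. R (if k = 0 then (0, z0) else 0)) at_top"
      by (rule bounded_linear.uniform_limit[OF that lim])
    moreover have "\<forall>\<^sub>F s in at_top. \<forall>t\<in>{0..1}.
        R ((pd_t ^^ k) w (s, t)) = R ((pd_t ^^ k) f (s, t), (pd_t ^^ k) cu (s, t))"
      using eventually_gt_at_top[of c] by eventually_elim (auto simp: w_iter)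
    ultimately show ?thesis
      by (rule uniform_limit_cong[THEN iffD1, rotated 2]) (rule refl)
  qed
  have F_lim: "uniform_limit {0..1} (\<lambda>s t. F k (s, t)) (\<lambda>_. 0) at_top"
    and \<theta>_lim: "uniform_limit {0..1} (\<lambda>s t. \<theta> k (s, t)) (\<lambda>_. if k = 0 then \<theta>0 else 0) at_top"
    and x_lim: "uniform_limit {0..1} (\<lambda>s t. x k (s, t)) (\<lambda>_. 0) at_top"
    and y_lim: "uniform_limit {0..1} (\<lambda>s t. y k (s, t)) (\<lambda>_. 0) at_top" for k
    using lims[OF lin(1), of k] lims[OF lin(2), of k] lims[OF lin(3), of k] lims[OF lin(4), of k]
    by (cases "k = 0"; simp add: F_def \<theta>_def x_def y_def z0_def)+
  have F_p: "has_partials c (F k) (pd_s (F k)) (F (Suc k))" for k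
    using f_iter(2)[of k] by (simp add: F_def)
  have cu_p: "has_partials c (\<theta> k) (\<lambda>z. fst (pd_s ((pd_t ^^ k) cu) z)) (\<theta> (Suc k))"
    "has_partials c (x k) (\<lambda>z. fst (snd (pd_s ((pd_t ^^ k) cu) z))) (x (Suc k))"
    "has_partials c (y k) (\<lambda>z. snd (snd (pd_s ((pd_t ^^ k) cu) z))) (y (Suc k))" for k
    using has_partials_linear[OF lin(5) cu_iter(2), of k] has_partials_linear[OF lin(6) cu_iter(2), of k]
      has_partials_linear[OF lin(7) cu_iter(2), of k]
    by (simp_all add: \<theta>_def x_def y_def)
  have cont: "continuous_on (half_strip c) (F k)" "continuous_on (half_strip c) (\<theta> k)"
    "continuous_on (half_strip c) (x k)" "continuous_on (half_strip c) (y k)" for k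
    unfolding F_def \<theta>_def x_def y_def by (intro continuous_intros f_iter(1) cu_iter(1))+
  \<comment> \<open>Moving from \<open>c\<close> to \<open>c + 1\<close> makes every jet bounded.\<close>
  have jetI: "t_jet (c + 1) h"
    if h: "\<And>k. continuous_on (half_strip c) (h k)" "\<And>k. \<exists>hs. has_partials c (h k) hs (h (Suc k))"
      "\<And>k. \<exists>l. uniform_limit {0..1} (\<lambda>s t. h k (s, t)) (\<lambda>_. l) at_top" for h
    unfolding t_jet_def
  proof (intro allI conjI impI ballI)
    fix k
    show "continuous_on (half_strip (c + 1)) (h k)"
      using h(1)[of k] by (rule continuous_on_subset) (simp add: half_strip_mono)
    show "decays (c + 1) 0 (h k)"
      using decays_0_of_uniform_limit[OF h(1)] h(3) by blast
    fix s t :: real assume st: "c + 1 < s" "t \<in> {0..1}"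
    obtain hs where "has_partials c (h k) hs (h (Suc k))" using h(2)[of k] by blast
    from has_partialsD(2)[OF this _ st(2), of s] st(1)
    show "((\<lambda>t'. h k (s, t')) has_real_derivative h (Suc k) (s, t)) (at t within {0..1})"
      by (simp add: has_real_derivative_iff_has_vector_derivative)
  qed
  have jets: "t_jet (c + 1) F" "t_jet (c + 1) \<theta>" "t_jet (c + 1) x" "t_jet (c + 1) y"
    by (rule jetI; use cont F_p cu_p F_lim \<theta>_lim x_lim y_lim in blast)+

  \<comment> \<open>The Cauchy-Riemann equation, written out with the explicit almost complex structure.\<close>
  have eqn: "pd_s f z = y 1 z + x 0 z * \<theta> 1 z" "fst (pd_s cu z) = - x 1 z"
    "fst (snd (pd_s cu z)) = \<theta> 1 z" "snd (snd (pd_s cu z)) = - F 1 z + x 0 z * x 1 z"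
    if z: "z \<in> half_strip c" for z
  proof -
    have "has_partials c w (\<lambda>z. (pd_s f z, pd_s cu z)) (\<lambda>z. (F 1 z, \<theta> 1 z, x 1 z, y 1 z))"
      using has_partials_Pair[OF f_iter(2)[of 0] cu_iter(2)[of 0]] by (simp add: w F_def \<theta>_def x_def y_def)
    note pdw = pd_eq_partials[OF this z]
    have "pd_s w z + Jtilde lam J \<kappa> (coord \<kappa> (u z)) (pd_t w z) = 0"
      using str(3) \<kappa>A u_dom[OF z] sub z unfolding w_def by blast
    moreover have "coord \<kappa> (u z) = (\<theta> 0 z, x 0 z, y 0 z)"
      using cu_eq[of 0 z] by (simp add: cu_def)
    moreover have "(\<theta> 0 z, x 0 z, y 0 z) \<in> tube_piece V \<theta>0" "\<Phi> (\<theta> 0 z, x 0 z, y 0 z) \<in> NJ"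
      using cu_piece[OF z] cu_N[OF z] cu_eq[of 0 z] by auto
    ultimately have "(pd_s f z, pd_s cu z) +
        (- (y 1 z + x 0 z * \<theta> 1 z), x 1 z, - \<theta> 1 z, F 1 z - x 0 z * x 1 z) = 0"
      using Jtilde_normal_form[OF T assms(3), of "\<theta> 0 z" "x 0 z" "y 0 z" \<theta>0 "F 1 z" "\<theta> 1 z" "x 1 z" "y 1 z"]
        NJ(3)[of "\<theta> 0 z" "x 0 z" "y 0 z"] by (simp add: pdw \<kappa>_def)
    then show "pd_s f z = y 1 z + x 0 z * \<theta> 1 z" "fst (pd_s cu z) = - x 1 z"
      "fst (snd (pd_s cu z)) = \<theta> 1 z" "snd (snd (pd_s cu z)) = - F 1 z + x 0 z * x 1 z"
      by (auto simp: prod_eq_iff)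
  qed

  have bottom: "x 0 (s, 0) = 0" "y 0 (s, 0) = 0" if "c < s" for s
    using tube_coords_on_knot[OF T cu_V[of "(s, 0)"]] str(4) \<Phi>cu[of "(s, 0)"] that
    by (auto simp: x_def y_def)
  have top: "x 0 (s, 1) = a (\<theta> 0 (s, 1)) / b (\<theta> 0 (s, 1)) * y 0 (s, 1)" if "c < s" for s
  proof -
    have z: "(s, 1) \<in> half_strip c" using that by simp
    have "\<Phi> (\<theta> 0 (s, 1), x 0 (s, 1), y 0 (s, 1)) \<in> D \<inter> ND"
      using cu_N[OF z] \<Phi>cu[OF z] str(5) cu_eq[of 0 "(s, 1)"] by auto
    then have "x 0 (s, 1) * b (\<theta> 0 (s, 1)) = a (\<theta> 0 (s, 1)) * y 0 (s, 1)"
      using cu_V[OF z] cu_eq[of 0 "(s, 1)"] by (intro ND(3)) auto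
    moreover have "b (\<theta> 0 (s, 1)) \<noteq> 0" using b_low[OF z] \<beta> by (auto simp: \<theta>_def)
    ultimately show ?thesis by (simp add: field_simps)
  qed

  have "\<exists>\<rho>>0. \<exists>c'\<ge>c + 1. \<forall>n. Ck_decays n c' \<rho> (F 0) \<and> Ck_decays n c' \<rho> (\<lambda>z. \<theta> 0 z - \<theta>0) \<and>
    Ck_decays n c' \<rho> (x 0) \<and> Ck_decays n c' \<rho> (y 0)"
  proof (rule strip_decay[OF jets])
    fix s t :: real assume st: "c + 1 < s" "t \<in> {0..1}"
    then have s: "c < s" and z: "(s, t) \<in> half_strip c" by auto
    show "((\<lambda>s'. F 0 (s', t)) has_real_derivative y 1 (s, t) + x 0 (s, t) * \<theta> 1 (s, t)) (at s)"
      using has_partialsD(1)[OF F_p[of 0] s st(2)] eqn(1)[OF z]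
      by (simp add: has_real_derivative_iff_has_vector_derivative F_def)
    show "((\<lambda>s'. \<theta> 0 (s', t)) has_real_derivative - x 1 (s, t)) (at s)"
      using has_partialsD(1)[OF cu_p(1)[of 0] s st(2)] eqn(2)[OF z]
      by (simp add: has_real_derivative_iff_has_vector_derivative)
    show "((\<lambda>s'. x 0 (s', t)) has_real_derivative \<theta> 1 (s, t)) (at s)"
      using has_partialsD(1)[OF cu_p(2)[of 0] s st(2)] eqn(3)[OF z]
      by (simp add: has_real_derivative_iff_has_vector_derivative)
    show "((\<lambda>s'. y 0 (s', t)) has_real_derivative - F 1 (s, t) + x 0 (s, t) * x 1 (s, t)) (at s)"
      using has_partialsD(1)[OF cu_p(3)[of 0] s st(2)] eqn(4)[OF z]
      by (simp add: has_real_derivative_iff_has_vector_derivative)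
  next
    show "F 0 (s, 1) = 0" for s using str(5) by (simp add: F_def)
    show "uniform_limit {0..1} (\<lambda>s t. \<theta> 0 (s, t)) (\<lambda>_. \<theta>0) at_top"
      "uniform_limit {0..1} (\<lambda>s t. \<theta> 1 (s, t)) (\<lambda>_. 0) at_top"
      using \<theta>_lim[of 0] \<theta>_lim[of 1] by simp_all
  qed (use c bottom top q F_lim x_lim y_lim in auto)
  then obtain \<rho> c' where \<rho>: "0 < \<rho>" and c': "c + 1 \<le> c'" and dec: "\<And>n. Ck_decays n c' \<rho> (F 0)"
    "\<And>n. Ck_decays n c' \<rho> (\<lambda>z. \<theta> 0 z - \<theta>0)" "\<And>n. Ck_decays n c' \<rho> (x 0)" "\<And>n. Ck_decays n c' \<rho> (y 0)"
    by blast
  have hs: "z \<in> half_strip c" if "z \<in> half_strip c'" for z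
    using that c' half_strip_mono[of c c'] by auto

  \<comment> \<open>The third component of \<open>v\<close> is \<open>x - q(\<theta>) y\<close>, with \<open>q = a / b\<close>; \<open>b\<close> is bounded away
      from zero near \<open>\<theta>0\<close>.\<close>
  have v_decay: "Ck_decays n c' \<rho> v" for n
  proof -
    have "Ck_decays n c' 0 (\<lambda>z. (\<theta> 0 z - \<theta>0) + \<theta>0)"
      by (intro Ck_decays_add Ck_decays_const Ck_decays_mono[OF dec(2)]) (use \<rho> in simp)
    then have th: "Ck_decays n c' 0 (\<theta> 0)" by simp
    have th_range: "\<theta> 0 (s, t) \<in> {\<theta>0 - 1..\<theta>0 + 1}" if "c' < s" "t \<in> {0..1}" for s t
      using th_near[OF hs, of "(s, t)"] that by (auto simp: \<theta>_def abs_if split: if_splits)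
    have A: "Ck_decays n c' 0 (\<lambda>z. a (\<theta> 0 z))"
      using Ck_decays_compose[where \<phi> = "\<lambda>k. (deriv ^^ k) a" and k = 0, OF da th_range th] by simp
    have "Ck_decays n c' 0 (\<lambda>z. b (\<theta> 0 z))"
      using Ck_decays_compose[where \<phi> = "\<lambda>k. (deriv ^^ k) b" and k = 0, OF db th_range th] by simp
    then have B: "Ck_decays n c' 0 (\<lambda>z. inverse (b (\<theta> 0 z)))"
      using b_low[OF hs] by (intro Ck_decays_inverse[OF \<beta>]) (auto simp: \<theta>_def)
    have "Ck_decays n c' (0 + 0 + \<rho>) (\<lambda>z. a (\<theta> 0 z) * inverse (b (\<theta> 0 z)) * y 0 z)"
      by (intro Ck_decays_mult A B dec)
    from Ck_decays_linear[OF bounded_linear_mult_right this, of "- 1"]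
    have Q: "Ck_decays n c' \<rho> (\<lambda>z. - 1 * (a (\<theta> 0 z) * inverse (b (\<theta> 0 z)) * y 0 z))"
      by simp
    have "Ck_decays n c' \<rho> (\<lambda>z. (F 0 z, \<theta> 0 z - \<theta>0,
        x 0 z + - 1 * (a (\<theta> 0 z) * inverse (b (\<theta> 0 z)) * y 0 z), y 0 z))"
      by (rule Ck_decays_Pair[OF dec(1) Ck_decays_Pair[OF dec(2) Ck_decays_Pair[OF Ck_decays_add[OF dec(3) Q] dec(4)]]])
    then show ?thesis
    proof (rule Ck_decays_cong[rotated])
      fix z
      have "coord (tube_chart V \<Phi> \<theta>0) (u z) = (\<theta> 0 z, x 0 z, y 0 z)"
        using cu_eq[of 0 z] by (simp add: cu_def \<kappa>_def)
      then show "v z = (F 0 z, \<theta> 0 z - \<theta>0,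
          x 0 z + - 1 * (a (\<theta> 0 z) * inverse (b (\<theta> 0 z)) * y 0 z), y 0 z)"
        by (simp add: assms(19) end_coords_def Let_def F_def divide_inverse)
    qed
  qed
  have c'0: "0 < c' + 1" using c c' by simp
  show ?thesis
  proof (rule exI[of _ \<rho>], rule conjI[OF \<rho>], rule exI[of _ "c' + 1"], rule conjI[OF c'0], rule conjI;
      intro allI impI ballI)
    fix s t :: real assume "c' + 1 \<le> s" "t \<in> {0..1}"
    then have z: "(s, t) \<in> half_strip c" using c' by simp
    show "u (s, t) \<in> end_dom V \<Phi> b \<theta>0"
      unfolding end_dom_def using cu_piece[OF z] \<Phi>cu[OF z] b_low[OF z] \<beta>
      by (intro CollectI exI[of _ "cu (s, t)"]) auto
  next
    fix j k
    obtain C where C: "0 < C" "\<And>s t. c' < s \<Longrightarrow> t \<in> {0..1} \<Longrightarrow>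
        norm ((pd_s ^^ j) ((pd_t ^^ k) v) (s, t)) \<le> C * exp (- \<rho> * s)"
      using decays_iterated_pd[OF v_decay] by (rule decaysE) blast
    show "\<exists>C>0. \<forall>s\<ge>c' + 1. \<forall>t\<in>{0..1}.
        norm ((pd_s ^^ j) ((pd_t ^^ k) v) (s, t)) \<le> C * exp (- \<rho> * (s - (c' + 1)))"
    proof (intro exI[of _ "C * exp (- \<rho> * (c' + 1))"] conjI allI impI ballI)
      fix s t :: real assume "c' + 1 \<le> s" "t \<in> {0..1}"
      then have "norm ((pd_s ^^ j) ((pd_t ^^ k) v) (s, t)) \<le> C * exp (- \<rho> * s)" by (intro C(2)) auto
      also have "exp (- \<rho> * s) = exp (- \<rho> * (c' + 1)) * exp (- \<rho> * (s - (c' + 1)))"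
        by (simp add: exp_add[symmetric] algebra_simps)
      finally show "norm ((pd_s ^^ j) ((pd_t ^^ k) v) (s, t)) \<le>
          C * exp (- \<rho> * (c' + 1)) * exp (- \<rho> * (s - (c' + 1)))" by (simp add: mult.assoc)
    qed (use C in auto)
  qed
qed

end
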